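(* Let $r\in(0,1)$, $m\in\mathbb{N}$ with $m\ge2$, let $G_{r,m}=\{z:|z^m-1|<r^m\}$ and let $\mu_0$ be planar area measure restricted to $G_{r,m}$. Let $J$ be a closed arc contained in $\partial G_{r,m}$. For $z_0\in J$ write $w_0=\frac{z_0^m-1}{r^m}$ (so $|w_0|=1$) and, for $a,b\in\mathbb{C}$, \[ A=\frac{\overline{w}_0\,a\,z_0^{m-1}+w_0\,\bar b\,\bar z_0^{m-1}}{r^m}. \] Then, uniformly for $a$ and $b$ in compact subsets of $\mathbb{C}$ and $z_0\in J$, \[ K_n\!\left(z_0+\frac an,z_0+\frac bn;\mu_0\right)=n^2H(A)\frac{|z_0|^{2m-2}}{2\pi r^{2m}}+o(n^2)\qquad(n\to\infty), \] where $H(t)=2\frac{e^t(t-1)+1}{t^2}$ for $t\neq0$ and $H(0)=1$.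
   Context: $\varphi_n(z;\mu_0)$ denote the orthonormal polynomials for $\mu_0$ with positive leading coefficients, and $K_n(z,w;\mu_0)=\sum_{k=0}^n\varphi_k(z;\mu_0)\overline{\varphi_k(w;\mu_0)}$. *)

theory Defs
  imports "HOL-Analysis.Analysis" "HOL-Computational_Algebra.Polynomial"
begin

definition Grm :: "real \<Rightarrow> nat \<Rightarrow> complex set" where
  "Grm r m = {z. cmod (z ^ m - 1) < r ^ m}"

definition area_ip :: "complex set \<Rightarrow> complex poly \<Rightarrow> complex poly \<Rightarrow> complex" where
  "area_ip S p q = (LINT z : S | lborel. poly p z * cnj (poly q z))"

definition is_orthonormal_poly :: "complex set \<Rightarrow> nat \<Rightarrow> complex poly \<Rightarrow> bool" where
  "is_orthonormal_poly S n p \<longleftrightarrow>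
     degree p = n \<and> lead_coeff p \<in> \<real> \<and> Re (lead_coeff p) > 0 \<and>
     (\<forall>q. degree q < n \<longrightarrow> area_ip S p q = 0) \<and> area_ip S p p = 1"

definition orthonormal_poly :: "complex set \<Rightarrow> nat \<Rightarrow> complex poly" where
  "orthonormal_poly S n = (THE p. is_orthonormal_poly S n p)"

definition CD_kernel :: "complex set \<Rightarrow> nat \<Rightarrow> complex \<Rightarrow> complex \<Rightarrow> complex" where
  "CD_kernel S n z w = (\<Sum>k\<le>n. poly (orthonormal_poly S k) z * cnj (poly (orthonormal_poly S k) w))"

definition Hfun :: "complex \<Rightarrow> complex" where
  "Hfun t = (if t = 0 then 1 else 2 * (exp t * (t - 1) + 1) / t ^ 2)"

end

theory Submission
  imports Defs "HOL-Computational_Algebra.Polynomial_FPS" "HOL-Real_Asymp.Real_Asymp"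
begin

text \<open>
  Put \<open>R = r^m\<close> and \<open>\<phi>(z) = (z^m - 1)/R\<close>. On each of the \<open>m\<close> components of the domain \<open>\<phi>\<close> is a conformal map
  onto the unit disk, and every polynomial is \<open>p(z) = \<Sum>\<^sub>j z^j P\<^sub>j(\<phi>(z))\<close> with \<open>j < m\<close>. Since \<open>0\<close> lies
  outside the closed disk of radius \<open>R\<close> about \<open>1\<close>, the area inner product splits into \<open>m\<close> inner products
  of the disk with the weights \<open>|(1 + R x)^(-\<beta>\<^sub>j)|\<^sup>2\<close>, \<open>\<beta>\<^sub>j = 1 - (j+1)/m\<close>, which are analytic beyond the unit circle.
  Multiplying the truncated Bergman kernel of the disk by Taylor polynomials of \<open>(1 + R x)^\<beta>\<^sub>j\<close> gives an
  explicit polynomial \<open>Q\<^sub>w\<close> of degree at most \<open>n\<close> that reproduces point evaluation at \<open>w\<close> on polynomials of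
  degree at most \<open>n\<close> up to an error \<open>o(n) ||p||\<close>. The reproducing property of \<open>K\<^sub>n\<close> and the Cauchy--Schwarz
  inequality then give \<open>K\<^sub>n(z, w) = Q\<^sub>w(z) + o(n\<^sup>2)\<close>, and \<open>Q\<^sub>w(z)/n\<^sup>2\<close> is essentially a Riemann sum for
  \<open>\<integral> t e^(A t) dt = H(A)/2\<close> over \<open>[0, 1]\<close>.
\<close>

section \<open>Holomorphic change of variables\<close>

text \<open>On the inverse branch \<open>z = \<zeta> (1 + R x) powr (1/m)\<close>,
  \<open>\<zeta>^m = 1\<close>, the product of \<open>z^j\<close> with the derivative of the branch
  is a constant multiple of \<open>\<zeta>^(j+1)\<close> times \<open>1 + R x\<close> to the
  exponent \<open>j/m + 1/m - 1\<close>. This is the origin of \<open>\<beta>\<close>, and summing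
  over the branches cancels products of different residues. Undoing the weight consumes a degree
  budget \<open>M\<close>, so about \<open>M\<close> of the topmost weighted coefficients of a
  polynomial are not reproduced. Each of them is bounded only by a multiple of \<open>sqrt n\<close>
  times the norm, which costs \<open>M sqrt n\<close>, while the Taylor tails need
  \<open>n R^M\<close> to be small; there is room between the two demands. An error
  \<open>o(n)\<close> in the functional suffices because the kernel sections have norm
  \<open>O(n)\<close>. For the constant: the \<open>m\<close> residues contribute
  \<open>|z0|^(2m-2)\<close> each, the geometric sum has about \<open>n/m\<close> terms with ratio
  near \<open>1 + m A/n\<close> and so behaves like \<open>(n/m)^2 H(A)/2\<close>, and the prefactor
  is \<open>m / (pi R^2)\<close>.\<close>

definition complex_to_vec :: "complex \<Rightarrow> real^2" where
  "complex_to_vec z = vector [Re z, Im z]"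

definition vec_to_complex :: "real^2 \<Rightarrow> complex" where
  "vec_to_complex v = Complex (v $ 1) (v $ 2)"

lemma vec_to_complex_inverse [simp]: "complex_to_vec (vec_to_complex v) = v"
  by (simp add: complex_to_vec_def vec_to_complex_def vec_eq_iff forall_2)

lemma complex_to_vec_inverse [simp]: "vec_to_complex (complex_to_vec z) = z"
  by (simp add: complex_to_vec_def vec_to_complex_def complex_eq_iff)

lemma bounded_linear_complex_to_vec: "bounded_linear complex_to_vec"
  unfolding linear_conv_bounded_linear[symmetric]
  by (rule linearI) (simp_all add: complex_to_vec_def vec_eq_iff forall_2)

lemma bounded_linear_vec_to_complex: "bounded_linear vec_to_complex"
  unfolding linear_conv_bounded_linear[symmetric]
  by (rule linearI) (simp_all add: vec_to_complex_def complex_eq_iff)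

lemma complex_to_vec_of_real_mult: "complex_to_vec (of_real a * z) = a *\<^sub>R complex_to_vec z"
  by (simp add: complex_to_vec_def vec_eq_iff forall_2)

lemma borel_measurable_complex_to_vec [measurable]: "complex_to_vec \<in> borel_measurable borel"
  by (intro borel_measurable_continuous_onI linear_continuous_on bounded_linear_complex_to_vec)

lemma borel_measurable_vec_to_complex [measurable]: "vec_to_complex \<in> borel_measurable borel"
  by (intro borel_measurable_continuous_onI linear_continuous_on bounded_linear_vec_to_complex)

lemma complex_to_vec_image: "complex_to_vec ` U = vec_to_complex -` U"
  by (force simp: image_iff)

lemma Basis_vec2: "(Basis :: (real^2) set) = {axis 1 1, axis 2 1}"
  by (auto simp: Basis_vec_def) (metis exhaust_2)

text \<open>Both measures give a box the product of its side lengths, and boxes determine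
  \<open>lborel\<close>. The identification lets a change of variables on \<open>real^2\<close> be
  applied to complex integrals.\<close>

lemma lborel_complex_to_vec: "lborel = distr lborel borel complex_to_vec"
proof (rule lborel_eqI)
  fix l u :: "real^2"
  assume le: "\<And>b. b \<in> Basis \<Longrightarrow> l \<bullet> b \<le> u \<bullet> b"
  have "l $ 1 \<le> u $ 1" "l $ 2 \<le> u $ 2"
    using le[of "axis 1 1"] le[of "axis 2 1"] by (auto simp: Basis_vec2 inner_axis)
  moreover have "complex_to_vec -` box l u = box (vec_to_complex l) (vec_to_complex u)"
    by (auto simp: box_def Basis_vec2 inner_axis Basis_complex_def complex_to_vec_def vec_to_complex_def)
  moreover have "axis 1 1 \<noteq> (axis 2 1 :: real^2)"
    by (simp add: axis_eq_axis)
  ultimately show "emeasure (distr lborel borel complex_to_vec) (box l u) = (\<Prod>b\<in>Basis. (u - l) \<bullet> b)"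
    by (simp add: emeasure_distr emeasure_lborel_box_eq Basis_complex_def Basis_vec2 inner_axis vec_to_complex_def)
qed simp

text \<open>The identification acts on domain and values at once, so a complex integrand becomes a
  vector-valued one on \<open>real^2\<close>. Borel measurability on \<open>U\<close> allows the
  passage between the completed measure, in which absolute integrability is phrased, and
  \<open>lborel\<close>.\<close>

lemma integral_complex_to_vec:
  fixes f :: "complex \<Rightarrow> complex"
  assumes U: "U \<in> sets borel" and f: "set_borel_measurable borel U f"
  defines "F \<equiv> \<lambda>v. complex_to_vec (f (vec_to_complex v))"
  shows "F absolutely_integrable_on (complex_to_vec ` U) \<longleftrightarrow> set_integrable lborel U f"
    and "set_integrable lborel U f \<Longrightarrow>
         integral (complex_to_vec ` U) F = complex_to_vec (set_lebesgue_integral lborel U f)"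
proof -
  interpret T: bounded_linear complex_to_vec by (rule bounded_linear_complex_to_vec)
  define k where "k = (\<lambda>v. indicat_real (complex_to_vec ` U) v *\<^sub>R F v)"
  have fm [measurable]: "(\<lambda>z. indicat_real U z *\<^sub>R f z) \<in> borel_measurable borel"
    using f by (simp add: set_borel_measurable_def)
  have k: "k v = complex_to_vec (indicat_real U (vec_to_complex v) *\<^sub>R f (vec_to_complex v))" for v
    by (auto simp: k_def F_def complex_to_vec_image indicator_def T.zero)
  have km [measurable]: "k \<in> borel_measurable borel"
    unfolding k by measurable
  have "F absolutely_integrable_on (complex_to_vec ` U) \<longleftrightarrow> integrable lebesgue k"
    by (simp add: set_integrable_def k_def)
  also have "\<dots> \<longleftrightarrow> integrable lborel k"
    by (rule integrable_completion) simp
  also have "\<dots> \<longleftrightarrow> integrable lborel (\<lambda>z. k (complex_to_vec z))"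
    by (subst lborel_complex_to_vec, rule integrable_distr_eq) auto
  also have "\<dots> \<longleftrightarrow> integrable lborel (\<lambda>z. indicat_real U z *\<^sub>R f z)"
    unfolding k using integrable_bounded_linear[OF bounded_linear_vec_to_complex]
      integrable_bounded_linear[OF bounded_linear_complex_to_vec] by fastforce
  finally show iff: "F absolutely_integrable_on (complex_to_vec ` U) \<longleftrightarrow> set_integrable lborel U f"
    by (simp add: set_integrable_def)
  assume int: "set_integrable lborel U f"
  have "integral (complex_to_vec ` U) F = (LINT v|lebesgue. k v)"
    using iff int by (subst set_lebesgue_integral_eq_integral(2)[symmetric]) (auto simp: set_lebesgue_integral_def k_def)
  also have "\<dots> = (LINT v|lborel. k v)"
    by (rule integral_completion) simp
  also have "\<dots> = (LINT z|lborel. k (complex_to_vec z))"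
    by (subst lborel_complex_to_vec, rule integral_distr) auto
  also have "\<dots> = complex_to_vec (set_lebesgue_integral lborel U f)"
    unfolding k set_lebesgue_integral_def using int
    by (simp add: integral_bounded_linear[OF bounded_linear_complex_to_vec] set_integrable_def)
  finally show "integral (complex_to_vec ` U) F = complex_to_vec (set_lebesgue_integral lborel U f)" .
qed

text \<open>Multiplication by \<open>c\<close> is a rotation combined with scaling by
  \<open>cmod c\<close>, so the Jacobian of a holomorphic map is the squared modulus of its
  derivative.\<close>

lemma det_complex_mult:
  "det (matrix (\<lambda>v. complex_to_vec (c * vec_to_complex v))) = (cmod c)\<^sup>2"
  by (simp add: det_2 matrix_def complex_to_vec_def vec_to_complex_def axis_def cmod_power2)
    (simp add: power2_eq_square)

text \<open>Continuity of \<open>g'\<close> and \<open>f\<close> makes both integrands Borel on open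
  sets; the image of \<open>S\<close> is open by invariance of domain.\<close>

theorem complex_change_of_variables:
  fixes f g g' :: "complex \<Rightarrow> complex"
  assumes S: "open S" and inj: "inj_on g S"
    and der: "\<And>x. x \<in> S \<Longrightarrow> (g has_field_derivative g' x) (at x)"
    and cont': "continuous_on S g'" and cont: "continuous_on (g ` S) f"
    and int: "set_integrable lborel (g ` S) f"
  shows "set_integrable lborel S (\<lambda>x. (cmod (g' x))\<^sup>2 * f (g x))"
    and "(LINT x:S|lborel. (cmod (g' x))\<^sup>2 * f (g x)) = (LINT z:g ` S|lborel. f z)"
proof -
  have cg: "continuous_on S g"
    using der by (meson DERIV_isCont continuous_at_imp_continuous_on)
  have og: "open (g ` S)"
    by (rule invariance_of_domain) (use cg S inj in auto)
  define h where "h = (\<lambda>x. (cmod (g' x))\<^sup>2 * f (g x))"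
  define G where "G = (\<lambda>v. complex_to_vec (g (vec_to_complex v)))"
  define G' where "G' = (\<lambda>v w. complex_to_vec (g' (vec_to_complex v) * vec_to_complex w))"
  define F where "F = (\<lambda>v. complex_to_vec (f (vec_to_complex v)))"
  define S' where "S' = complex_to_vec ` S"
  have ch: "continuous_on S h"
    unfolding h_def using continuous_on_compose[OF cg] cont
    by (intro continuous_intros cont') (simp add: o_def)
  have hm: "set_borel_measurable borel S h" and fm: "set_borel_measurable borel (g ` S) f"
    using S og ch cont by (auto intro!: borel_measurable_continuous_on_indicator simp: set_borel_measurable_def)
  have GS: "G ` S' = complex_to_vec ` g ` S"
    by (simp add: G_def S'_def image_image)
  have "F absolutely_integrable_on (G ` S') \<and>
      integral (G ` S') F = complex_to_vec (LINT z:g ` S|lborel. f z)"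
    unfolding GS F_def
    using integral_complex_to_vec[OF _ fm] og int by simp
  also have "?this \<longleftrightarrow> (\<lambda>x. \<bar>det (matrix (G' x))\<bar> *\<^sub>R F (G x)) absolutely_integrable_on S' \<and>
      integral S' (\<lambda>x. \<bar>det (matrix (G' x))\<bar> *\<^sub>R F (G x)) = complex_to_vec (LINT z:g ` S|lborel. f z)"
  proof (rule has_absolute_integral_change_of_variables[symmetric])
    have "open S'"
      unfolding S'_def complex_to_vec_image
      by (rule open_vimage[OF S]) (intro linear_continuous_on bounded_linear_vec_to_complex)
    then show "S' \<in> sets lebesgue" by auto
    show "inj_on G S'"
      using inj unfolding inj_on_def G_def S'_def by (metis complex_to_vec_inverse imageE)
    fix v assume "v \<in> S'"
    then have v: "vec_to_complex v \<in> S" by (auto simp: S'_def)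
    have "(g has_derivative (\<lambda>w. g' (vec_to_complex v) * w)) (at (vec_to_complex v))"
      using der[OF v] by (simp add: has_field_derivative_def)
    from diff_chain_at[OF bounded_linear_imp_has_derivative[OF bounded_linear_vec_to_complex] this]
    have "((\<lambda>v. g (vec_to_complex v)) has_derivative (\<lambda>w. g' (vec_to_complex v) * vec_to_complex w)) (at v)"
      by (simp add: o_def)
    from bounded_linear.has_derivative[OF bounded_linear_complex_to_vec this]
    show "(G has_derivative G' v) (at v within S')"
      unfolding G_def G'_def by (rule has_derivative_at_withinI)
  qed
  also have "(\<lambda>x. \<bar>det (matrix (G' x))\<bar> *\<^sub>R F (G x)) = (\<lambda>v. complex_to_vec (h (vec_to_complex v)))"
    using complex_to_vec_of_real_mult[of "(cmod (g' x))\<^sup>2" for x]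
    by (simp add: G'_def det_complex_mult F_def G_def h_def fun_eq_iff)
  finally have *: "(\<lambda>v. complex_to_vec (h (vec_to_complex v))) absolutely_integrable_on S'"
    "integral S' (\<lambda>v. complex_to_vec (h (vec_to_complex v))) = complex_to_vec (LINT z:g ` S|lborel. f z)"
    by auto
  show i: "set_integrable lborel S (\<lambda>x. (cmod (g' x))\<^sup>2 * f (g x))"
    using *(1) integral_complex_to_vec(1)[OF _ hm] S unfolding S'_def h_def by auto
  have "complex_to_vec (LINT x:S|lborel. h x) = complex_to_vec (LINT z:g ` S|lborel. f z)"
    using *(2) integral_complex_to_vec(2)[OF _ hm] i S unfolding S'_def h_def by auto
  then show "(LINT x:S|lborel. (cmod (g' x))\<^sup>2 * f (g x)) = (LINT z:g ` S|lborel. f z)"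
    unfolding h_def by (metis complex_to_vec_inverse)
qed

section \<open>Power series in the Bergman space of the disk\<close>

lemma set_integrable_ball_continuous:
  fixes f :: "complex \<Rightarrow> 'a::{banach, second_countable_topology}"
  assumes "continuous_on (cball a e) f"
  shows "set_integrable lborel (ball a e) f"
proof (rule set_integrable_subset)
  show "set_integrable lborel (cball a e) f"
    unfolding set_integrable_def using assms by (intro borel_integrable_compact) auto
qed (auto simp: ball_subset_cball)

lemma image_scale_ball:
  fixes c :: complex
  shows "c \<noteq> 0 \<Longrightarrow> (\<lambda>x. c * x) ` ball 0 e = ball 0 (cmod c * e)"
proof (intro set_eqI iffI)
  fix z :: complex assume c: "c \<noteq> 0" and "z \<in> ball 0 (cmod c * e)"
  then have "z = c * (z / c)" "z / c \<in> ball 0 e"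
    by (auto simp: norm_divide field_simps)
  then show "z \<in> (\<lambda>x. c * x) ` ball 0 e" by blast
qed (auto simp: norm_mult)

text \<open>One substitution serves two purposes: a unimodular \<open>c\<close> is a rotation and
  yields orthogonality, a positive real \<open>c\<close> changes the radius and yields the
  norms.\<close>

lemma monomial_integral_scale:
  fixes c :: complex
  assumes "c \<noteq> 0"
  shows "(LINT z:ball 0 (cmod c)|lborel. z ^ j * cnj z ^ k) =
         (cmod c)\<^sup>2 * c ^ j * cnj c ^ k * (LINT z:ball 0 1|lborel. z ^ j * cnj z ^ k)"
proof -
  have "(LINT z:(\<lambda>x. c * x) ` ball 0 1|lborel. z ^ j * cnj z ^ k) =
        (LINT x:ball 0 1|lborel. (cmod c)\<^sup>2 * ((c * x) ^ j * cnj (c * x) ^ k))"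
  proof (rule complex_change_of_variables(2)[symmetric])
    show "set_integrable lborel ((\<lambda>x. c * x) ` ball 0 1) (\<lambda>z. z ^ j * cnj z ^ k)"
      unfolding image_scale_ball[OF assms] by (intro set_integrable_ball_continuous continuous_intros)
  qed (use assms in \<open>auto intro!: inj_onI derivative_eq_intros continuous_intros\<close>)
  also have "\<dots> = (LINT x:ball 0 1|lborel. ((cmod c)\<^sup>2 * c ^ j * cnj c ^ k) * (x ^ j * cnj x ^ k))"
    by (simp add: power_mult_distrib mult_ac)
  finally show ?thesis
    unfolding image_scale_ball[OF assms] by simp
qed

lemma disk_monomials_orthogonal:
  assumes "j \<noteq> k"
  shows "(LINT z:ball 0 1|lborel. z ^ j * cnj z ^ k) = 0"
proof -
  \<comment> \<open>The angle for which rotation multiplies the integrand by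
    \<open>cis pi = -1\<close>. Rotation preserves the integral over the disk, which therefore
    equals its own negative.\<close>
  define t where "t = pi / (real j - real k)"
  have "cis t ^ j * cnj (cis t) ^ k = cis ((real j - real k) * t)"
    by (simp add: cis_cnj Complex.DeMoivre cis_mult algebra_simps)
  also have "\<dots> = -1"
    using assms by (simp add: t_def)
  finally have "cis t ^ j * cnj (cis t) ^ k = -1" .
  then show ?thesis
    using monomial_integral_scale[of "cis t" j k] by simp
qed

text \<open>
  With \<open>I(\<rho>)\<close> the integral over the disk of radius \<open>\<rho>\<close>, scaling gives \<open>I(\<rho>) = \<rho>^(2k+2) I(1)\<close>, while \<open>I(1) - I(\<rho>)\<close>
  is squeezed between \<open>\<rho>^(2k)\<close> and \<open>1\<close> times the area of the annulus; let \<open>\<rho>\<close> tend to \<open>1\<close>.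
\<close>

lemma disk_monomial_norm:
  "(LINT z:ball 0 1|lborel. z ^ k * cnj z ^ k) = of_real (pi / (real k + 1))"
proof -
  define I where "I S = (LINT z:S|lborel. cmod z ^ (2 * k))" for S :: "complex set"
  have pw: "z ^ k * cnj z ^ k = of_real (cmod z ^ (2 * k))" for z :: complex
    by (metis complex_norm_square of_real_power power_mult power_mult_distrib)
  have Ic: "(LINT z:S|lborel. z ^ k * cnj z ^ k) = of_real (I S)" for S
    unfolding pw I_def by (rule set_integral_complex_of_real)
  have int: "set_integrable lborel (ball 0 e) (\<lambda>z::complex. cmod z ^ (2 * k))" for e
    by (intro set_integrable_ball_continuous continuous_intros)
  have scale: "I (ball 0 \<rho>) = \<rho> ^ (2 * k + 2) * I (ball 0 1)" if "0 < \<rho>" for \<rho>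
  proof -
    have "complex_of_real (I (ball 0 \<rho>)) = of_real (\<rho> ^ (2 * k + 2) * I (ball 0 1))"
      using monomial_integral_scale[of "of_real \<rho>" k k] that
      by (simp add: Ic power_add power2_eq_square mult_ac mult_2_right)
    then show ?thesis by (simp only: of_real_eq_iff)
  qed
  have bounds: "I (ball 0 1) * (\<Sum>i<Suc k. (\<rho>\<^sup>2) ^ i) \<le> pi"
    "\<rho> ^ (2 * k) * pi \<le> I (ball 0 1) * (\<Sum>i<Suc k. (\<rho>\<^sup>2) ^ i)" if \<rho>: "0 < \<rho>" "\<rho> < 1" for \<rho>
  proof -
    define A where "A = ball (0::complex) 1 - ball 0 \<rho>"
    have Asub: "A \<subseteq> ball 0 1" and Am: "A \<in> sets lborel"
      by (auto simp: A_def)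
    have sub: "ball (0::complex) \<rho> \<subseteq> ball 0 1" using \<rho> by auto
    have intA: "set_integrable lborel A (\<lambda>z. cmod z ^ (2 * k))"
      by (rule set_integrable_subset[OF int Am Asub])
    have intc: "set_integrable lborel A (\<lambda>z. c)" for c :: real
      by (rule set_integrable_subset[OF set_integrable_ball_continuous Am Asub]) auto
    have "measure lborel A = measure lborel (ball (0::complex) 1) - measure lborel (ball (0::complex) \<rho>)"
      unfolding A_def using sub emeasure_lborel_ball_finite[of "0::complex" 1] by (intro measure_Diff) auto
    also have "\<dots> = pi * (1 - \<rho>\<^sup>2)"
      using \<rho> by (simp add: content_ball unit_ball_vol_2 algebra_simps)
    finally have mA: "measure lborel A = pi * (1 - \<rho>\<^sup>2)" .
    have cA: "(LINT z:A|lborel. c) = c * (pi * (1 - \<rho>\<^sup>2))" for c :: real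
      using mA by (simp add: set_lebesgue_integral_def mult.commute)
    have "I (ball 0 1) = I (A \<union> ball 0 \<rho>)"
      using sub by (auto simp: A_def intro!: arg_cong[where f = I])
    also have "\<dots> = I A + I (ball 0 \<rho>)"
      unfolding I_def by (rule set_integral_Un) (use intA int in \<open>auto simp: A_def\<close>)
    finally have IA: "I A = I (ball 0 1) * (1 - \<rho> ^ (2 * k + 2))"
      using scale[OF \<rho>(1)] by (simp add: algebra_simps)
    \<comment> \<open>The annulus has area \<open>pi * (1 - \<rho>\<^sup>2)\<close>, so with this
      factor split off it cancels on both sides of the squeeze; the remaining sum tends to
      \<open>k + 1\<close>.\<close>
    also have "1 - \<rho> ^ (2 * k + 2) = (1 - \<rho>\<^sup>2) * (\<Sum>i<Suc k. (\<rho>\<^sup>2) ^ i)"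
      using one_diff_power_eq[of "\<rho>\<^sup>2" "Suc k"] unfolding power_mult[of \<rho> 2 "Suc k", symmetric] by simp
    finally have IA: "I A = (I (ball 0 1) * (\<Sum>i<Suc k. (\<rho>\<^sup>2) ^ i)) * (1 - \<rho>\<^sup>2)"
      by simp
    have pos: "1 - \<rho>\<^sup>2 > 0" using \<rho> by (simp add: power_less_one_iff)
    have "I A \<le> (LINT z:A|lborel. 1)"
      unfolding I_def by (intro set_integral_mono intA intc) (auto simp: A_def power_le_one)
    then show "I (ball 0 1) * (\<Sum>i<Suc k. (\<rho>\<^sup>2) ^ i) \<le> pi"
      unfolding cA IA using pos by simp
    have "(LINT z:A|lborel. \<rho> ^ (2 * k)) \<le> I A"
      unfolding I_def using \<rho> by (intro set_integral_mono intA intc) (auto simp: A_def power_mono)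
    then show "\<rho> ^ (2 * k) * pi \<le> I (ball 0 1) * (\<Sum>i<Suc k. (\<rho>\<^sup>2) ^ i)"
      unfolding cA IA using pos by (simp flip: mult.assoc)
  qed
  have ev: "eventually (\<lambda>\<rho>. 0 < \<rho> \<and> \<rho> < 1) (at_left (1::real))"
    using eventually_at_left_real[of 0 1] by simp
  have lim: "((\<lambda>\<rho>. I (ball 0 1) * (\<Sum>i<Suc k. (\<rho>\<^sup>2) ^ i)) \<longlongrightarrow> I (ball 0 1) * (\<Sum>i<Suc k. (1\<^sup>2) ^ i)) (at_left (1::real))"
    by (intro tendsto_intros)
  have lim2: "((\<lambda>\<rho>. \<rho> ^ (2 * k) * pi) \<longlongrightarrow> 1 ^ (2 * k) * pi) (at_left (1::real))"
    by (intro tendsto_intros)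
  have "I (ball 0 1) * (\<Sum>i<Suc k. (1\<^sup>2) ^ i) \<le> pi"
    by (rule tendsto_upperbound[OF lim]) (use ev bounds(1) in \<open>auto elim!: eventually_mono\<close>)
  moreover have "1 ^ (2 * k) * pi \<le> I (ball 0 1) * (\<Sum>i<Suc k. (1\<^sup>2) ^ i)"
    by (rule tendsto_le[OF _ lim lim2]) (use ev bounds(2) in \<open>auto elim!: eventually_mono\<close>)
  ultimately have "I (ball 0 1) = pi / (real k + 1)"
    by (simp add: field_simps)
  then show ?thesis by (simp add: Ic)
qed

lemma disk_power_series_sums:
  fixes u :: "nat \<Rightarrow> complex"
  assumes u: "summable (\<lambda>k. cmod (u k))" and b: "continuous_on (cball 0 1) b"
  shows "(\<lambda>k. u k * (LINT z:ball 0 1|lborel. z ^ k * b z)) sums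
         (LINT z:ball 0 1|lborel. (\<Sum>k. u k * z ^ k) * b z)"
proof -
  let ?D = "ball (0::complex) 1"
  obtain B where B: "\<And>z. z \<in> cball 0 1 \<Longrightarrow> cmod (b z) \<le> B"
    using compact_imp_bounded[OF compact_continuous_image[OF b compact_cball]]
    unfolding bounded_iff by blast
  define F where "F k z = indicat_real ?D z *\<^sub>R (u k * z ^ k * b z)" for k z
  have iF: "integrable lborel (F k)" for k
    unfolding F_def set_integrable_def[symmetric]
    by (intro set_integrable_ball_continuous continuous_intros b)
  have bnd: "cmod (F k z) \<le> cmod (u k) * B * indicat_real ?D z" for k z
  proof (cases "z \<in> ?D")
    case True
    then have "cmod (z ^ k) \<le> 1" "cmod (b z) \<le> B" using B by (auto simp: norm_power power_le_one)
    then have "cmod (u k) * (cmod (z ^ k) * cmod (b z)) \<le> cmod (u k) * (1 * B)"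
      by (intro mult_left_mono mult_mono) auto
    then show ?thesis using True by (simp add: F_def norm_mult mult_ac)
  qed (simp add: F_def)
  have iD: "integrable lborel (\<lambda>z. cmod (u k) * B * indicat_real ?D z)" for k
    by (intro integrable_mult_right integrable_real_indicator) (use emeasure_lborel_ball_finite[of "0::complex" 1] in auto)
  have sn: "summable (\<lambda>k. cmod (F k z))" for z
    by (rule summable_comparison_test'[where N = 0, of "\<lambda>k. cmod (u k) * B * indicat_real ?D z"])
       (use bnd in \<open>auto intro!: summable_mult2 u\<close>)
  have si: "summable (\<lambda>k. LINT z|lborel. cmod (F k z))"
  proof (rule summable_comparison_test'[where N = 0])
    show "summable (\<lambda>k. cmod (u k) * (B * measure lborel ?D))"
      by (intro summable_mult2 u)
    fix k
    have "(LINT z|lborel. cmod (F k z)) \<le> (LINT z|lborel. cmod (u k) * B * indicat_real ?D z)"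
      by (intro integral_mono integrable_norm iF iD bnd)
    then show "norm (LINT z|lborel. cmod (F k z)) \<le> cmod (u k) * (B * measure lborel ?D)"
      by (simp add: mult_ac)
  qed
  have "(\<lambda>k. integral\<^sup>L lborel (F k)) sums (LINT z|lborel. (\<Sum>k. F k z))"
    by (rule sums_integral) (use iF sn si in auto)
  also have "(\<lambda>k. integral\<^sup>L lborel (F k)) = (\<lambda>k. u k * (LINT z:?D|lborel. z ^ k * b z))"
    unfolding F_def set_lebesgue_integral_def
    by (subst integral_mult_right_zero[symmetric]) (auto intro!: arg_cong2[where f="integral\<^sup>L"] simp: fun_eq_iff indicator_def)
  also have "(LINT z|lborel. (\<Sum>k. F k z)) = (LINT z:?D|lborel. (\<Sum>k. u k * z ^ k) * b z)"
    unfolding set_lebesgue_integral_def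
  proof (intro Bochner_Integration.integral_cong refl)
    fix z
    show "(\<Sum>k. F k z) = indicat_real ?D z *\<^sub>R ((\<Sum>k. u k * z ^ k) * b z)"
    proof (cases "z \<in> ?D")
      case True
      have "summable (\<lambda>k. u k * z ^ k)"
        by (rule summable_comparison_test'[where N = 0, OF u])
           (use True in \<open>auto simp: norm_mult norm_power intro!: mult_left_le power_le_one\<close>)
      then show ?thesis using True by (simp add: F_def suminf_mult2)
    qed (simp add: F_def)
  qed
  finally show ?thesis .
qed

text \<open>Parseval's identity: expanding the second series gives its moments against the
  monomials, by orthogonality, and expanding the first series then gives the sum. The factor
  \<open>pi / (k + 1)\<close> is the squared norm of \<open>z ^ k\<close>.\<close>

lemma disk_power_series_inner:
  fixes u v :: "nat \<Rightarrow> complex"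
  assumes u: "summable (\<lambda>k. cmod (u k))" and v: "summable (\<lambda>k. cmod (v k))"
  shows "(\<lambda>k. of_real (pi / (real k + 1)) * u k * cnj (v k)) sums
         (LINT z:ball 0 1|lborel. (\<Sum>k. u k * z ^ k) * cnj (\<Sum>k. v k * z ^ k))"
proof -
  have cont: "continuous_on (cball 0 1) (\<lambda>z. \<Sum>k. w k * z ^ k)" if w: "summable (\<lambda>k. cmod (w k))" for w :: "nat \<Rightarrow> complex"
  proof (rule uniform_limit_theorem)
    show "uniform_limit (cball 0 1) (\<lambda>n z. \<Sum>k<n. w k * z ^ k) (\<lambda>z. \<Sum>k. w k * z ^ k) sequentially"
      by (rule Weierstrass_m_test[OF _ w]) (auto simp: norm_mult norm_power intro!: mult_left_le power_le_one)
  qed (auto intro!: always_eventually continuous_intros)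
  have moment: "(LINT z:ball 0 1|lborel. z ^ k * cnj (\<Sum>k. v k * z ^ k)) = of_real (pi / (real k + 1)) * cnj (v k)" for k
  proof -
    let ?V = "\<lambda>z. \<Sum>i. v i * z ^ i"
    have "(\<lambda>i. v i * (LINT z:ball 0 1|lborel. z ^ i * cnj z ^ k)) sums
        (LINT z:ball 0 1|lborel. ?V z * cnj z ^ k)"
      by (rule disk_power_series_sums[OF v]) (intro continuous_intros)
    also have "(\<lambda>i. v i * (LINT z:ball 0 1|lborel. z ^ i * cnj z ^ k)) =
        (\<lambda>i. if i = k then v k * of_real (pi / (real k + 1)) else 0)"
      using disk_monomials_orthogonal disk_monomial_norm by auto
    finally have *: "(LINT z:ball 0 1|lborel. ?V z * cnj z ^ k) = v k * of_real (pi / (real k + 1))"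
      using sums_single[of k "\<lambda>_. v k * of_real (pi / (real k + 1))"] sums_unique2 by blast
    have "(LINT z:ball 0 1|lborel. z ^ k * cnj (?V z)) = cnj (LINT z:ball 0 1|lborel. ?V z * cnj z ^ k)"
      unfolding set_lebesgue_integral_def by (subst Bochner_Integration.integral_cnj[symmetric]) (simp add: mult.commute)
    then show ?thesis unfolding * by (simp add: mult.commute)
  qed
  have "(\<lambda>k. u k * (LINT z:ball 0 1|lborel. z ^ k * cnj (\<Sum>k. v k * z ^ k))) sums
         (LINT z:ball 0 1|lborel. (\<Sum>k. u k * z ^ k) * cnj (\<Sum>k. v k * z ^ k))"
    by (rule disk_power_series_sums[OF u]) (intro continuous_intros cont v)
  then show ?thesis unfolding moment by (simp add: mult_ac)
qed

section \<open>Orthonormal polynomials for area measure\<close>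

locale area_domain =
  fixes S :: "complex set"
  assumes S_open: "open S" and S_bounded: "bounded S" and S_nonempty: "S \<noteq> {}"
begin

abbreviation ip :: "complex poly \<Rightarrow> complex poly \<Rightarrow> complex" where
  "ip \<equiv> area_ip S"

definition nrm :: "complex poly \<Rightarrow> real" where
  "nrm p = sqrt (Re (ip p p))"

lemma set_integrable_continuous:
  fixes f :: "complex \<Rightarrow> 'a::{banach, second_countable_topology}"
  assumes "continuous_on UNIV f"
  shows "set_integrable lborel S f"
proof (rule set_integrable_subset)
  show "set_integrable lborel (closure S) f"
    unfolding set_integrable_def using assms S_bounded
    by (intro borel_integrable_compact) (auto intro: continuous_on_subset)
qed (use S_open closure_subset in auto)

lemma ip_integrable: "set_integrable lborel S (\<lambda>z. poly p z * cnj (poly q z))"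
  by (intro set_integrable_continuous continuous_intros)

lemma ip_add_left: "ip (p + q) s = ip p s + ip q s"
  using set_integral_add(2)[OF ip_integrable ip_integrable, of p s q s]
  by (simp add: area_ip_def algebra_simps)

lemma ip_smult_left: "ip (smult c p) q = c * ip p q"
  by (simp add: area_ip_def mult.assoc)

lemma ip_cnj: "cnj (ip p q) = ip q p"
  unfolding area_ip_def set_lebesgue_integral_def
  by (subst Bochner_Integration.integral_cnj[symmetric]) (simp add: mult.commute)

lemma ip_0_left [simp]: "ip 0 q = 0"
  using ip_smult_left[of 0 0 q] by simp

lemma ip_minus_left: "ip (p - q) s = ip p s - ip q s"
  using ip_add_left[of p "smult (-1) q" s] ip_smult_left[of "-1" q s] by simp

lemma ip_sum_left: "ip (sum f A) q = (\<Sum>k\<in>A. ip (f k) q)"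
  by (induction A rule: infinite_finite_induct) (auto simp: ip_add_left)

lemma ip_0_right [simp]: "ip q 0 = 0"
  using ip_cnj[of 0 q] by simp

lemma ip_smult_right: "ip p (smult c q) = cnj c * ip p q"
  using ip_cnj[of "smult c q" p] by (simp add: ip_smult_left ip_cnj)

lemma ip_minus_right: "ip s (p - q) = ip s p - ip s q"
  using ip_cnj[of "p - q" s] by (simp add: ip_minus_left ip_cnj)

lemma ip_sum_right: "ip q (sum f A) = (\<Sum>k\<in>A. ip q (f k))"
  using ip_cnj[of "sum f A" q] by (simp add: ip_sum_left ip_cnj)

lemma ip_self: "ip p p = of_real (LINT z:S|lborel. (cmod (poly p z))\<^sup>2)"
  unfolding area_ip_def set_integral_complex_of_real[symmetric] complex_norm_square ..

text \<open>The zeros of \<open>p\<close> are finitely many while \<open>S\<close> is infinite, so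
  some ball inside \<open>S\<close> carries \<open>cmod (poly p y) > c\<close>, and the integral is
  at least \<open>c\<^sup>2\<close> times the area of that ball.\<close>

lemma ip_self_pos:
  assumes "p \<noteq> 0"
  shows "Re (ip p p) > 0"
proof -
  have "infinite S"
    using S_open S_nonempty finite_imp_not_open by blast
  then obtain z where z: "z \<in> S" "poly p z \<noteq> 0"
    using poly_roots_finite[OF assms] by (metis (mono_tags, lifting) finite_subset mem_Collect_eq subsetI)
  define c where "c = cmod (poly p z) / 2"
  have c: "c > 0" using z by (simp add: c_def)
  have "open {y. c < cmod (poly p y)}"
    by (intro open_Collect_less continuous_intros)
  moreover have "z \<in> {y. c < cmod (poly p y)}" using z by (simp add: c_def)
  ultimately obtain e where e: "e > 0" "ball z e \<subseteq> S \<inter> {y. c < cmod (poly p y)}"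
    using S_open z by (meson IntI open_Int open_contains_ball)
  have int: "set_integrable lborel S (\<lambda>z. (cmod (poly p z))\<^sup>2)"
    by (intro set_integrable_continuous continuous_intros)
  have intb: "set_integrable lborel (ball z e) (\<lambda>z. c\<^sup>2)"
    by (rule set_integrable_subset[OF set_integrable_continuous]) (use e in auto)
  have "0 < c\<^sup>2 * measure lborel (ball z e)"
    using c e by simp
  also have "\<dots> = (LINT y:ball z e|lborel. c\<^sup>2)"
    by (simp add: set_lebesgue_integral_def)
  also have "\<dots> \<le> (LINT y:S|lborel. (cmod (poly p y))\<^sup>2)"
    unfolding set_lebesgue_integral_def
  proof (rule integral_mono)
    fix y
    have "c\<^sup>2 \<le> (cmod (poly p y))\<^sup>2" if "y \<in> ball z e"
      using e c that by (intro power_mono) auto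
    then show "indicat_real (ball z e) y *\<^sub>R c\<^sup>2 \<le> indicat_real S y *\<^sub>R (cmod (poly p y))\<^sup>2"
      using e by (auto simp: indicator_def)
  qed (use int intb in \<open>auto simp: set_integrable_def\<close>)
  finally show ?thesis by (simp add: ip_self)
qed

lemma ip_self_nonneg: "Re (ip p p) \<ge> 0"
  using ip_self_pos[of p] by (cases "p = 0") auto

lemma nrm_nonneg [simp]: "nrm p \<ge> 0"
  by (simp add: nrm_def ip_self_nonneg)

lemma ip_self_nrm: "ip p p = of_real ((nrm p)\<^sup>2)"
  unfolding nrm_def real_sqrt_pow2[OF ip_self_nonneg] by (simp add: ip_self)

lemma Cauchy_Schwarz_ip: "cmod (ip p q) \<le> nrm p * nrm q"
proof (cases "q = 0")
  case False
  define Q where "Q = (nrm q)\<^sup>2"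
  have Q: "Q > 0" "ip q q = of_real Q"
    using ip_self_pos[OF False] by (auto simp: Q_def ip_self_nrm simp del: of_real_power)
  define c where "c = ip p q / of_real Q"
  have "ip (p - smult c q) (p - smult c q) = ip p p - c * cnj (ip p q) - cnj c * ip p q + c * cnj c * ip q q"
    by (simp add: ip_minus_left ip_minus_right ip_smult_left ip_smult_right ip_cnj algebra_simps)
  also have "\<dots> = of_real ((nrm p)\<^sup>2) - ip p q * cnj (ip p q) / of_real Q"
    using Q by (simp add: c_def ip_self_nrm[of p] field_simps)
  also have "\<dots> = of_real ((nrm p)\<^sup>2 - (cmod (ip p q))\<^sup>2 / Q)"
    by (simp add: complex_norm_square[symmetric] del: of_real_power)
  finally have "(cmod (ip p q))\<^sup>2 / Q \<le> (nrm p)\<^sup>2"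
    using ip_self_nonneg[of "p - smult c q"] by simp
  then have "(cmod (ip p q))\<^sup>2 \<le> (nrm p * nrm q)\<^sup>2"
    using Q by (simp add: field_simps Q_def power_mult_distrib)
  then show ?thesis
    by (rule power2_le_imp_le) simp
qed simp

section \<open>Existence, uniqueness and expansions for orthonormal polynomials\<close>

text \<open>Phrased by vanishing coefficients because for \<open>n = 0\<close> this means
  \<open>q = 0\<close>, matching the empty sum; the condition \<open>degree q < 0\<close> would
  exclude even the zero polynomial.\<close>

lemma orthonormal_span:
  assumes "\<And>k. k < n \<Longrightarrow> is_orthonormal_poly S k (\<phi> k)" and "\<And>i. i \<ge> n \<Longrightarrow> coeff q i = 0"
  shows "\<exists>c. q = (\<Sum>k<n. smult (c k) (\<phi> k))"
  using assms
proof (induction n arbitrary: q)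
  case 0
  then have "q = 0" by (simp add: poly_eq_iff)
  then show ?case by simp
next
  case (Suc n)
  define a where "a = coeff q n / lead_coeff (\<phi> n)"
  have \<phi>: "degree (\<phi> n) = n" "lead_coeff (\<phi> n) \<noteq> 0"
    using Suc.prems(1)[of n] by (auto simp: is_orthonormal_poly_def)
  have "coeff (q - smult a (\<phi> n)) i = 0" if "i \<ge> n" for i
  proof (cases "i = n")
    case True
    then show ?thesis using \<phi> by (simp add: a_def)
  next
    case False
    then show ?thesis using that \<phi> Suc.prems(2)[of i] by (simp add: coeff_eq_0)
  qed
  then obtain c where c: "q - smult a (\<phi> n) = (\<Sum>k<n. smult (c k) (\<phi> k))"
    using Suc.IH[of "q - smult a (\<phi> n)"] Suc.prems(1) by auto
  have "q = (\<Sum>k<Suc n. smult ((c(n := a)) k) (\<phi> k))"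
    using c by (simp add: algebra_simps)
  then show ?case by blast
qed

lemma orthonormal_ip:
  assumes "is_orthonormal_poly S j p" "is_orthonormal_poly S k q" "j \<noteq> k"
  shows "ip p q = 0"
proof (cases "k < j")
  case False
  then have "ip q p = 0" using assms by (auto simp: is_orthonormal_poly_def)
  then show ?thesis using ip_cnj[of q p] by simp
qed (use assms in \<open>auto simp: is_orthonormal_poly_def\<close>)

lemma orthonormal_poly_ex: "\<exists>p. is_orthonormal_poly S n p"
proof (induction n rule: less_induct)
  case (less n)
  then obtain \<phi> where \<phi>: "\<And>k. k < n \<Longrightarrow> is_orthonormal_poly S k (\<phi> k)"
    by metis
  define p where "p = monom 1 n - (\<Sum>k<n. smult (ip (monom 1 n) (\<phi> k)) (\<phi> k))"
  have deg: "degree (\<phi> k) = k" if "k < n" for k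
    using \<phi>[OF that] by (simp add: is_orthonormal_poly_def)
  have c: "coeff p i = (if i = n then 1 else 0)" if "i \<ge> n" for i
    using that by (auto simp: p_def coeff_sum coeff_eq_0 deg)
  then have degp: "degree p = n"
    by (intro antisym degree_le le_degree) auto
  then have lead: "lead_coeff p = 1" using c by simp
  then have p0: "p \<noteq> 0" by auto
  have orth: "ip p (\<phi> j) = 0" if "j < n" for j
  proof -
    have "(\<Sum>k<n. ip (monom 1 n) (\<phi> k) * ip (\<phi> k) (\<phi> j)) =
        (\<Sum>k<n. if k = j then ip (monom 1 n) (\<phi> j) else 0)"
    proof (intro sum.cong refl)
      fix k assume "k \<in> {..<n}"
      then show "ip (monom 1 n) (\<phi> k) * ip (\<phi> k) (\<phi> j) = (if k = j then ip (monom 1 n) (\<phi> j) else 0)"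
        using orthonormal_ip[OF \<phi>[of k] \<phi>[of j]] \<phi>[of j] that by (auto simp: is_orthonormal_poly_def)
    qed
    also have "\<dots> = ip (monom 1 n) (\<phi> j)"
      using that by simp
    finally show ?thesis
      by (simp add: p_def ip_minus_left ip_sum_left ip_smult_left)
  qed
  have orth': "ip p q = 0" if "degree q < n" for q
  proof -
    have "\<exists>c. q = (\<Sum>k<n. smult (c k) (\<phi> k))"
      by (rule orthonormal_span[OF \<phi>]) (use that in \<open>auto intro: coeff_eq_0\<close>)
    then obtain c where "q = (\<Sum>k<n. smult (c k) (\<phi> k))" ..
    then show ?thesis by (simp add: ip_sum_right ip_smult_right orth)
  qed
  have pos: "nrm p > 0" using ip_self_pos[OF p0] by (simp add: nrm_def)
  define P where "P = smult (of_real (1 / nrm p)) p"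
  have "is_orthonormal_poly S n P"
    unfolding is_orthonormal_poly_def
  proof (intro conjI allI impI)
    show "degree P = n" using pos degp by (simp add: P_def)
    have "lead_coeff P = of_real (1 / nrm p)"
      using lead by (simp add: P_def)
    then show "lead_coeff P \<in> \<real>" "Re (lead_coeff P) > 0"
      using pos by (auto simp del: of_real_divide)
    show "ip P q = 0" if "degree q < n" for q
      by (simp add: P_def ip_smult_left orth' that)
    show "ip P P = 1"
      using pos by (simp add: P_def ip_smult_left ip_smult_right ip_self_nrm[of p] power2_eq_square)
  qed
  then show ?case by blast
qed

lemma orthonormal_poly_unique:
  assumes p: "is_orthonormal_poly S n p" and q: "is_orthonormal_poly S n q"
  shows "p = q"
proof -
  \<comment> \<open>\<open>a\<close> matches the leading coefficients, so the difference
    \<open>d\<close> drops below degree \<open>n\<close> and is orthogonal to \<open>p\<close> and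
    to \<open>q\<close>, hence to itself. Once \<open>p\<close> is \<open>a\<close> times
    \<open>q\<close>, the normalisation and \<open>a > 0\<close> force \<open>a = 1\<close>.\<close>
  define a where "a = Re (lead_coeff p) / Re (lead_coeff q)"
  have a: "a > 0"
    using p q unfolding a_def is_orthonormal_poly_def by (intro divide_pos_pos) auto
  have "complex_of_real (Re (lead_coeff p)) = lead_coeff p" "complex_of_real (Re (lead_coeff q)) = lead_coeff q"
    using p q unfolding is_orthonormal_poly_def by (metis of_real_Re)+
  moreover have "lead_coeff q \<noteq> 0" using q by (auto simp: is_orthonormal_poly_def)
  ultimately have lead: "lead_coeff p = of_real a * lead_coeff q"
    by (simp add: a_def)
  define d where "d = p - smult (of_real a) q"
  have deg: "degree p = n" "degree q = n"
    using p q by (auto simp: is_orthonormal_poly_def)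
  have cd: "coeff d i = 0" if "i \<ge> n" for i
    using that lead deg by (cases "i = n") (auto simp: d_def coeff_eq_0)
  have "d = 0"
  proof (rule ccontr)
    assume "d \<noteq> 0"
    then have "degree d < n"
      using cd by (metis leading_coeff_0_iff not_le_imp_less)
    then have "ip d d = 0"
      using p q unfolding is_orthonormal_poly_def
      by (subst d_def, subst ip_minus_left) (simp add: ip_smult_left)
    then show False using ip_self_pos[OF \<open>d \<noteq> 0\<close>] by simp
  qed
  then have pq: "p = smult (of_real a) q" by (simp add: d_def)
  have "(1::complex) = of_real (a * a)"
    using p q unfolding pq is_orthonormal_poly_def by (simp add: ip_smult_left ip_smult_right)
  then have "a * a = 1" by (metis of_real_eq_1_iff)
  then have "a = 1" using a by (simp add: square_eq_1_iff)
  then show ?thesis using pq by simp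
qed

lemma orthonormal_poly: "is_orthonormal_poly S n (orthonormal_poly S n)"
  unfolding orthonormal_poly_def 
  by (rule theI', rule ex_ex1I[OF orthonormal_poly_ex], rule orthonormal_poly_unique)

lemma orthonormal_expansion:
  assumes "degree p \<le> n"
  shows "p = (\<Sum>k\<le>n. smult (ip p (orthonormal_poly S k)) (orthonormal_poly S k))"
proof -
  let ?\<phi> = "orthonormal_poly S"
  have orth: "ip (?\<phi> j) (?\<phi> k) = (if j = k then 1 else 0)" for j k
  proof (cases "j = k")
    case True
    then show ?thesis using orthonormal_poly[of k] by (simp add: is_orthonormal_poly_def)
  next
    case False
    then show ?thesis using orthonormal_ip[OF orthonormal_poly orthonormal_poly] by simp
  qed
  have "\<exists>c. p = (\<Sum>k<Suc n. smult (c k) (?\<phi> k))"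
    by (rule orthonormal_span[OF orthonormal_poly]) (use assms in \<open>auto intro: coeff_eq_0\<close>)
  then obtain c where c: "p = (\<Sum>k<Suc n. smult (c k) (?\<phi> k))" ..
  have "ip p (?\<phi> k) = c k" if "k < Suc n" for k
  proof -
    have "ip p (?\<phi> k) = (\<Sum>j<Suc n. c j * (if j = k then 1 else 0))"
      unfolding c ip_sum_left ip_smult_left orth ..
    also have "\<dots> = (\<Sum>j<Suc n. if j = k then c k else 0)"
      by (rule sum.cong) auto
    also have "\<dots> = c k"
      using that by (subst sum.delta) auto
    finally show ?thesis .
  qed
  then have "(\<Sum>k<Suc n. smult (ip p (?\<phi> k)) (?\<phi> k)) = (\<Sum>k<Suc n. smult (c k) (?\<phi> k))"
    by (intro sum.cong) auto
  from this[folded c] show ?thesis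
    unfolding lessThan_Suc_atMost by (rule sym)
qed

section \<open>The kernel as a polynomial and its reproducing property\<close>

text \<open>The section of the kernel in its first variable, kept as a polynomial so that it can
  enter \<open>ip\<close>.\<close>

definition kernel_poly :: "nat \<Rightarrow> complex \<Rightarrow> complex poly" where
  "kernel_poly n w = (\<Sum>k\<le>n. smult (cnj (poly (orthonormal_poly S k) w)) (orthonormal_poly S k))"

lemma poly_kernel_poly: "poly (kernel_poly n w) z = CD_kernel S n z w"
  by (simp add: kernel_poly_def CD_kernel_def poly_sum mult.commute)

lemma degree_kernel_poly: "degree (kernel_poly n w) \<le> n"
  unfolding kernel_poly_def
proof (rule degree_sum_le)
  fix k assume "k \<in> {..n}"
  moreover have "degree (orthonormal_poly S k) = k"
    using orthonormal_poly[of k] by (simp add: is_orthonormal_poly_def)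
  ultimately show "degree (smult (cnj (poly (orthonormal_poly S k) w)) (orthonormal_poly S k)) \<le> n"
    by simp
qed simp

text \<open>The second slot of \<open>ip\<close> is conjugate-linear and undoes the conjugates in
  \<open>kernel_poly\<close>, so the pairing reassembles the orthonormal expansion of
  \<open>p\<close> at the point \<open>w\<close>.\<close>

lemma ip_kernel_poly:
  assumes "degree p \<le> n"
  shows "ip p (kernel_poly n w) = poly p w"
proof -
  have "ip p (kernel_poly n w) = (\<Sum>k\<le>n. poly (orthonormal_poly S k) w * ip p (orthonormal_poly S k))"
    by (simp add: kernel_poly_def ip_sum_right ip_smult_right)
  also have "\<dots> = poly p w"
    unfolding arg_cong[OF orthonormal_expansion[OF assms], of "\<lambda>p. poly p w"] poly_sum
    by (simp add: mult.commute)
  finally show ?thesis .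
qed

text \<open>
  For \<open>d = K\<^sub>n(\<cdot>, w) - Qw\<close> the reproducing property gives \<open>\<langle>d, d\<rangle> = d(w) - \<langle>d, Qw\<rangle>\<close>, hence \<open>nrm d \<le> \<eta>\<close>;
  then \<open>d(z)\<close> is compared with \<open>\<langle>d, Qz\<rangle>\<close>.
\<close>

lemma CD_kernel_approx:
  assumes degw: "degree Qw \<le> n" and degz: "degree Qz \<le> n"
    and w: "\<And>p. degree p \<le> n \<Longrightarrow> cmod (ip p Qw - poly p w) \<le> \<eta> * nrm p"
    and z: "\<And>p. degree p \<le> n \<Longrightarrow> cmod (ip p Qz - poly p z) \<le> \<eta> * nrm p"
    and B: "cmod (poly Qz z) \<le> B\<^sup>2" "B \<ge> 0" and \<eta>: "\<eta> \<ge> 0"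
  shows "cmod (CD_kernel S n z w - poly Qw z) \<le> \<eta> * (B + 2 * \<eta>)"
proof -
  define d where "d = kernel_poly n w - Qw"
  have degd: "degree d \<le> n"
    unfolding d_def by (intro degree_diff_le degree_kernel_poly degw)
  have "(nrm d)\<^sup>2 = cmod (ip d d)"
    by (simp add: ip_self_nrm norm_power)
  also have "ip d d = poly d w - ip d Qw"
    by (subst (2) d_def) (simp add: ip_minus_right ip_kernel_poly degd)
  also have "cmod \<dots> \<le> \<eta> * nrm d"
    using w[OF degd] by (simp add: norm_minus_commute)
  finally have nd: "nrm d \<le> \<eta>"
    using \<eta> nrm_nonneg[of d] by (cases "nrm d = 0") (simp_all add: power2_eq_square)
  \<comment> \<open>A quadratic inequality: \<open>(nrm Qz)\<^sup>2\<close> is at most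
    \<open>B\<^sup>2 + \<eta> * nrm Qz\<close>. If the norm exceeded \<open>B + \<eta>\<close>, then
    \<open>B\<^sup>2 \<le> B * nrm Qz\<close>, and the square would be at most
    \<open>(B + \<eta>) * nrm Qz\<close>, a contradiction.\<close>
  have nz: "nrm Qz \<le> B + \<eta>"
  proof (rule ccontr)
    assume "\<not> nrm Qz \<le> B + \<eta>"
    then have *: "nrm Qz > B + \<eta>" by simp
    have "(nrm Qz)\<^sup>2 = cmod (ip Qz Qz)"
      by (simp add: ip_self_nrm norm_power)
    also have "\<dots> \<le> cmod (poly Qz z) + cmod (ip Qz Qz - poly Qz z)"
      by (metis add.commute diff_add_cancel norm_triangle_ineq)
    also have "\<dots> \<le> B\<^sup>2 + \<eta> * nrm Qz"
      using z[OF degz] B by simp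
    also have "\<dots> \<le> (B + \<eta>) * nrm Qz"
      using * B \<eta> by (simp add: distrib_right power2_eq_square mult_left_mono)
    finally show False
      using * B \<eta> by (simp add: power2_eq_square)
  qed
  have "cmod (poly d z) \<le> cmod (ip d Qz) + cmod (ip d Qz - poly d z)"
    by (metis norm_minus_commute norm_triangle_sub)
  also have "\<dots> \<le> nrm d * nrm Qz + \<eta> * nrm d"
    by (intro add_mono Cauchy_Schwarz_ip z degd)
  also have "\<dots> \<le> \<eta> * (B + \<eta>) + \<eta> * \<eta>"
    using nd nz \<eta> by (intro add_mono mult_mono) auto
  finally show ?thesis
    by (simp add: d_def poly_kernel_poly algebra_simps)
qed

end

section \<open>The inner product on the lemniscate\<close>

text \<open>Passing from \<open>k\<close> to \<open>k + 1\<close> multiplies by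
  \<open>(a - k) / (k + 1)\<close>, of modulus at most 1. This makes the Taylor coefficients of the
  weights decay like \<open>R ^ k\<close>.\<close>

lemma norm_gbinomial_le_one:
  fixes a :: complex
  assumes "cmod a \<le> 1"
  shows "cmod (a gchoose k) \<le> 1"
proof (induction k)
  case (Suc k)
  have "cmod (a - of_nat k) \<le> real (Suc k)"
    using norm_triangle_ineq4[of a "of_nat k"] assms by simp
  then have "cmod (a gchoose k) * cmod (a - of_nat k) \<le> 1 * real (Suc k)"
    by (intro mult_mono Suc.IH) auto
  moreover have "of_nat (Suc k) * (a gchoose Suc k) = (a gchoose k) * (a - of_nat k)"
    using gbinomial_mult_1[of a k] by (simp add: algebra_simps)
  then have "real (Suc k) * cmod (a gchoose Suc k) = cmod (a gchoose k) * cmod (a - of_nat k)"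
    by (metis norm_mult norm_of_nat)
  ultimately have "real (Suc k) * cmod (a gchoose Suc k) \<le> real (Suc k) * 1" by simp
  then show ?case by (rule mult_left_le_imp_le) simp
qed simp

text \<open>The exponents are shifted by one because the derivative of an inverse branch contributes
  one more root of unity to \<open>z ^ j\<close>. With the conjugate serving as inverse, the sum is
  geometric with ratio \<open>\<zeta>^(j - k)\<close>, which is not 1 for distinct
  \<open>j, k < m\<close>.\<close>

lemma roots_of_unity_orthogonal:
  assumes "j < m" "k < m"
  shows "(\<Sum>l<m. cis (2 * pi * real l / real m) ^ Suc j * cnj (cis (2 * pi * real l / real m) ^ Suc k)) =
         (if j = k then of_nat m else 0)"
proof -
  define \<zeta> where "\<zeta> = cis (2 * pi / real m)"
  define q where "q = \<zeta> ^ Suc j * cnj \<zeta> ^ Suc k"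
  have m: "m > 0" using assms by simp
  have pow: "\<zeta> ^ l = cis (2 * pi * real l / real m)" for l
    by (simp add: \<zeta>_def Complex.DeMoivre mult_ac)
  have \<zeta>\<zeta>: "\<zeta> * cnj \<zeta> = 1" by (simp add: \<zeta>_def cis_cnj cis_mult)
  have "(\<Sum>l<m. cis (2 * pi * real l / real m) ^ Suc j * cnj (cis (2 * pi * real l / real m) ^ Suc k)) = (\<Sum>l<m. q ^ l)"
    unfolding pow[symmetric] q_def by (intro sum.cong refl) (simp add: power_mult_distrib power_mult[symmetric] mult_ac)
  also have "\<dots> = (if j = k then of_nat m else 0)"
  proof (cases "j = k")
    case True
    then have "q = (\<zeta> * cnj \<zeta>) ^ Suc k" by (simp add: q_def power_mult_distrib)
    then have "q = 1" by (simp add: \<zeta>\<zeta>)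
    then show ?thesis using True by simp
  next
    case False
    have "q \<noteq> 1"
    proof
      assume "q = 1"
      have "\<zeta> ^ j = \<zeta> ^ j * (\<zeta> * cnj \<zeta>) ^ Suc k" by (simp add: \<zeta>\<zeta>)
      also have "\<dots> = q * \<zeta> ^ k"  by (simp add: q_def power_mult_distrib mult_ac)
      finally have "\<zeta> ^ j = \<zeta> ^ k" using \<open>q = 1\<close> by simp
      then show False
        using bij_betw_imp_inj_on[OF Complex.bij_betw_roots_unity[OF m]] assms False
        by (auto simp: pow inj_on_def)
    qed
    moreover have "\<zeta> ^ m = 1" using m by (simp add: pow)
    moreover have "q ^ m = (\<zeta> ^ m) ^ Suc j * cnj (\<zeta> ^ m) ^ Suc k"
      unfolding q_def power_mult_distrib complex_cnj_power power_mult[symmetric] by (simp only: mult.commute)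
    ultimately show ?thesis
      using False sum_gp_strict[of q m] by simp
  qed
  finally show ?thesis .
qed

locale lemniscate =
  fixes r :: real and m :: nat
  assumes r_pos: "0 < r" and r_less: "r < 1" and m_pos: "m > 0"
begin

definition R :: real where "R = r ^ m"
definition \<phi> :: "complex \<Rightarrow> complex" where "\<phi> z = (z ^ m - 1) / of_real R"
definition \<beta> :: "nat \<Rightarrow> real" where "\<beta> j = 1 - (real j + 1) / real m"
text \<open>
  \<open>hc j\<close> and \<open>gc j\<close> are the Taylor coefficients of \<open>(1 + R x)^(-\<beta> j)\<close> and of its reciprocal, and \<open>cf j P\<close> those of
  \<open>P(x) (1 + R x)^(-\<beta> j)\<close>.
\<close>

definition hc :: "nat \<Rightarrow> nat \<Rightarrow> complex" where "hc j k = (of_real (- \<beta> j) gchoose k) * of_real R ^ k"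
definition gc :: "nat \<Rightarrow> nat \<Rightarrow> complex" where "gc j k = (of_real (\<beta> j) gchoose k) * of_real R ^ k"
definition cf :: "nat \<Rightarrow> complex poly \<Rightarrow> nat \<Rightarrow> complex" where
  "cf j P k = (\<Sum>i\<le>k. coeff P i * hc j (k - i))"

lemma R_pos: "0 < R" and R_less: "R < 1"
  using r_pos r_less m_pos by (auto simp: R_def power_less_one_iff)

lemma Grm_eq: "Grm r m = {z. cmod (\<phi> z) < 1}"
  using R_pos unfolding Grm_def \<phi>_def norm_divide R_def[symmetric] norm_of_real by (simp add: field_simps)

sublocale area_domain "Grm r m"
proof
  show "open (Grm r m)"
    unfolding Grm_def by (intro open_Collect_less continuous_intros)
  have "cmod z \<le> 2" if "z \<in> Grm r m" for z
  proof (rule ccontr)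
    assume "\<not> cmod z \<le> 2"
    then have "2 < cmod z" by simp
    also have "\<dots> \<le> cmod z ^ m" using \<open>2 < cmod z\<close> m_pos by (intro self_le_power) auto
    also have "\<dots> \<le> cmod (z ^ m - 1) + 1"
      using norm_triangle_sub[of "z ^ m" 1] by (simp add: norm_power)
    also have "\<dots> < 2" using that R_less by (simp add: Grm_def R_def)
    finally show False .
  qed
  then show "bounded (Grm r m)" by (auto simp: bounded_iff)
  have "1 \<in> Grm r m" using R_pos by (simp add: Grm_def R_def)
  then show "Grm r m \<noteq> {}" by auto
qed

lemma \<beta>_bounds: "j < m \<Longrightarrow> 0 \<le> \<beta> j \<and> \<beta> j \<le> 1"
  by (simp add: \<beta>_def field_simps)

lemma norm_hc: "j < m \<Longrightarrow> cmod (hc j k) \<le> R ^ k" and norm_gc: "j < m \<Longrightarrow> cmod (gc j k) \<le> R ^ k"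
  using norm_gbinomial_le_one[of "of_real (- \<beta> j)" k] norm_gbinomial_le_one[of "of_real (\<beta> j)" k] \<beta>_bounds[of j] R_pos
  by (auto simp: hc_def gc_def norm_mult norm_power intro!: mult_left_le_one_le)

text \<open>In the Vandermonde identity the upper arguments \<open>- \<beta> j\<close> and
  \<open>\<beta> j\<close> add up to 0, which leaves only the constant term. Formal series invert
  the weight without any question of convergence.\<close>

lemma hc_gc: "Abs_fps (hc j) * Abs_fps (gc j) = 1"
proof (rule fps_ext)
  fix n
  have "fps_nth (Abs_fps (hc j) * Abs_fps (gc j)) n =
      (\<Sum>i=0..n. (of_real (- \<beta> j) gchoose i) * (of_real (\<beta> j) gchoose (n - i)) * of_real R ^ n)"
    unfolding fps_mult_nth by (intro sum.cong) (auto simp: hc_def gc_def mult_ac simp flip: power_add)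
  also have "\<dots> = (of_real (- \<beta> j) + of_real (\<beta> j) gchoose n) * of_real R ^ n"
    by (subst gbinomial_Vandermonde[symmetric]) (simp add: sum_distrib_right)
  also have "\<dots> = fps_nth 1 n"
    by (cases n) auto
  finally show "fps_nth (Abs_fps (hc j) * Abs_fps (gc j)) n = fps_nth 1 n" .
qed

text \<open>Dividing by the weight is triangular: coefficient \<open>i\<close> involves only
  weighted coefficients up to index \<open>i\<close>. A polynomial of bounded degree is thus
  recovered from finitely many of them.\<close>

lemma coeff_conv_cf: "coeff P i = (\<Sum>k\<le>i. cf j P k * gc j (i - k))"
proof -
  have "Abs_fps (cf j P) = fps_of_poly P * Abs_fps (hc j)"
    by (rule fps_ext) (simp add: cf_def fps_mult_nth atMost_atLeast0)
  then have "Abs_fps (cf j P) * Abs_fps (gc j) = fps_of_poly P"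
    by (simp add: mult.assoc hc_gc)
  then have "coeff P i = fps_nth (Abs_fps (cf j P) * Abs_fps (gc j)) i"
    by simp
  then show ?thesis
    by (simp add: fps_mult_nth atMost_atLeast0)
qed

lemma summable_hc: assumes "j < m" "cmod x * R < 1" shows "summable (\<lambda>k. cmod (hc j k * x ^ k))"
proof (rule summable_comparison_test'[where N = 0])
  show "summable (\<lambda>k. (cmod x * R) ^ k)" using assms R_pos by (intro summable_geometric) (simp add: abs_mult)
  show "norm (cmod (hc j k * x ^ k)) \<le> (cmod x * R) ^ k" for k
    using mult_right_mono[OF norm_hc[OF assms(1), of k], of "cmod x ^ k"]
    by (simp add: norm_mult norm_power power_mult_distrib mult_ac)
qed

lemma cmod_R_less: "cmod x \<le> 1 \<Longrightarrow> cmod x * R < 1"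
  using R_pos R_less by (metis le_less_trans mult_left_le_one_le norm_ge_zero less_eq_real_def)

lemma hc_sums: assumes "cmod x * R < 1" shows "(\<lambda>k. hc j k * x ^ k) sums ((1 + of_real R * x) powr of_real (- \<beta> j))"
  using gen_binomial_complex[of "of_real R * x" "of_real (- \<beta> j)"] assms R_pos
  by (simp add: hc_def norm_mult power_mult_distrib mult_ac)

lemma gc_sums: assumes "cmod x * R < 1" shows "(\<lambda>k. gc j k * x ^ k) sums ((1 + of_real R * x) powr of_real (\<beta> j))"
  using gen_binomial_complex[of "of_real R * x" "of_real (\<beta> j)"] assms R_pos
  by (simp add: gc_def norm_mult power_mult_distrib mult_ac)

text \<open>Each \<open>cf j P k\<close> combines the numbers \<open>hc j (k - i)\<close> with
  \<open>i\<close> at most the degree of \<open>P\<close>, so it inherits the decay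
  \<open>R ^ k\<close> up to the constant \<open>C\<close>.\<close>

lemma summable_cf: assumes "j < m" shows "summable (\<lambda>k. cmod (cf j P k))"
proof (rule summable_comparison_test'[where N = 0])
  define C where "C = (\<Sum>i\<le>degree P. cmod (coeff P i) / R ^ i)"
  show "summable (\<lambda>k. C * R ^ k)" using R_pos R_less by (intro summable_mult summable_geometric) simp
  fix k
  have "cmod (cf j P k) \<le> (\<Sum>i\<le>k. cmod (coeff P i) * R ^ (k - i))"
    unfolding cf_def by (intro sum_norm_le) (auto simp: norm_mult intro!: mult_left_mono norm_hc assms)
  also have "\<dots> = (\<Sum>i\<le>k. cmod (coeff P i) / R ^ i) * R ^ k"
    unfolding sum_distrib_right using R_pos by (intro sum.cong) (auto simp: power_diff)
  also have "(\<Sum>i\<le>k. cmod (coeff P i) / R ^ i) = (\<Sum>i\<in>{..k} \<inter> {..degree P}. cmod (coeff P i) / R ^ i)"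
    by (intro sum.mono_neutral_right) (auto simp: coeff_eq_0)
  also have "\<dots> \<le> C"
    unfolding C_def using R_pos by (intro sum_mono2) auto
  finally show "norm (cmod (cf j P k)) \<le> C * R ^ k"
    using R_pos by (simp add: mult_right_mono)
qed

lemma suminf_cf:
  assumes "j < m" "cmod x \<le> 1"
  shows "(\<Sum>k. cf j P k * x ^ k) = poly P x * (1 + of_real R * x) powr of_real (- \<beta> j)"
proof -
  have "summable (\<lambda>k. cmod (coeff P k * x ^ k))"
    by (rule summable_finite[of "{..degree P}"]) (auto simp: coeff_eq_0)
  then have "(\<lambda>k. \<Sum>i\<le>k. (coeff P i * x ^ i) * (hc j (k - i) * x ^ (k - i))) sums
      ((\<Sum>k. coeff P k * x ^ k) * (\<Sum>k. hc j k * x ^ k))"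
    by (intro Cauchy_product_sums summable_hc cmod_R_less assms)
  also have "(\<lambda>k. \<Sum>i\<le>k. (coeff P i * x ^ i) * (hc j (k - i) * x ^ (k - i))) = (\<lambda>k. cf j P k * x ^ k)"
    unfolding cf_def sum_distrib_right by (intro ext sum.cong) (auto simp: mult_ac simp flip: power_add)
  also have "(\<Sum>k. coeff P k * x ^ k) = poly P x"
    unfolding poly_altdef by (rule suminf_finite) (auto simp: coeff_eq_0)
  also have "(\<Sum>k. hc j k * x ^ k) = (1 + of_real R * x) powr of_real (- \<beta> j)"
    using hc_sums[OF cmod_R_less[OF assms(2)]] by (simp add: sums_iff)
  finally show ?thesis by (simp add: sums_iff)
qed

section \<open>Splitting the area inner product along the inverse branches\<close>

text \<open>The inner product of the disk with the \<open>j\<close>-th weight. It is encoded by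
  Taylor coefficients because the coefficient bound and the reproducing estimate act on single terms
  of this series; \<open>bip_sums\<close> identifies it with the integral.\<close>

definition bip :: "nat \<Rightarrow> complex poly \<Rightarrow> complex poly \<Rightarrow> complex" where
  "bip j P Q = (\<Sum>k. of_real (pi / (real k + 1)) * cf j P k * cnj (cf j Q k))"

definition rep :: "(nat \<Rightarrow> complex poly) \<Rightarrow> complex poly \<Rightarrow> bool" where
  "rep P p \<longleftrightarrow> (\<forall>z. poly p z = (\<Sum>j<m. z ^ j * poly (P j) (\<phi> z)))"

text \<open>
  The \<open>\<psi> l\<close> are the inverse branches of \<open>\<phi>\<close> on the components of the lemniscate domain.
\<close>

definition \<psi> :: "nat \<Rightarrow> complex \<Rightarrow> complex" where
  "\<psi> l x = cis (2 * pi * real l / real m) * (1 + of_real R * x) powr of_real (1 / real m)"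

definition \<psi>' :: "nat \<Rightarrow> complex \<Rightarrow> complex" where
  "\<psi>' l x = cis (2 * pi * real l / real m) * of_real (R / real m) * (1 + of_real R * x) powr of_real (1 / real m - 1)"

lemma bip_sums:
  assumes "j < m"
  shows "(\<lambda>k. of_real (pi / (real k + 1)) * cf j P k * cnj (cf j Q k)) sums bip j P Q"
    and "bip j P Q = (LINT x:ball 0 1|lborel. poly P x * (1 + of_real R * x) powr of_real (- \<beta> j) *
           cnj (poly Q x * (1 + of_real R * x) powr of_real (- \<beta> j)))"
proof -
  note * = disk_power_series_inner[OF summable_cf[OF assms, of P] summable_cf[OF assms, of Q]]
  show "(\<lambda>k. of_real (pi / (real k + 1)) * cf j P k * cnj (cf j Q k)) sums bip j P Q"
    unfolding bip_def using * by (simp add: sums_iff)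
  have "bip j P Q = (LINT x:ball 0 1|lborel. (\<Sum>k. cf j P k * x ^ k) * cnj (\<Sum>k. cf j Q k * x ^ k))"
    using * by (simp add: bip_def sums_iff)
  also have "\<dots> = (LINT x:ball 0 1|lborel. poly P x * (1 + of_real R * x) powr of_real (- \<beta> j) *
           cnj (poly Q x * (1 + of_real R * x) powr of_real (- \<beta> j)))"
    by (intro set_lebesgue_integral_cong) (auto simp: suminf_cf[OF assms])
  finally show "bip j P Q = \<dots>" .
qed

text \<open>Since \<open>R < 1\<close>, the real part is positive. The base thus avoids the branch
  cut of \<open>powr\<close>, and its powers are differentiable at every point of the closed
  disk.\<close>

lemma one_plus_R_not_nonpos: "cmod x \<le> 1 \<Longrightarrow> 1 + of_real R * x \<notin> \<real>\<^sub>\<le>\<^sub>0"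
proof
  assume x: "cmod x \<le> 1" and "1 + of_real R * x \<in> \<real>\<^sub>\<le>\<^sub>0"
  then have "1 + R * Re x \<le> 0" by (auto simp: complex_nonpos_Reals_iff)
  moreover have "\<bar>Re x\<bar> * R < 1"
    using cmod_R_less[OF x] abs_Re_le_cmod[of x] R_pos by (meson less_le_not_le mult_right_mono order_le_less_trans)
  moreover have "- Re x * R \<le> \<bar>Re x\<bar> * R"
    using R_pos by (intro mult_right_mono) auto
  ultimately show False by (simp add: mult.commute)
qed

lemma powr_power: "u \<noteq> 0 \<Longrightarrow> (u powr of_real a) ^ n = (u::complex) powr of_real (real n * a)"
  by (simp add: powr_def exp_of_nat_mult[symmetric] mult_ac)

lemma one_plus_R_nonzero: "cmod x \<le> 1 \<Longrightarrow> 1 + of_real R * x \<noteq> 0"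
  using one_plus_R_not_nonpos[of x] by auto

lemma cis_m: "cis (2 * pi * real l / real m) ^ m = 1"
  using m_pos by (simp add: Complex.DeMoivre)

lemma \<psi>_power: "cmod x \<le> 1 \<Longrightarrow> \<psi> l x ^ m = 1 + of_real R * x"
  using m_pos one_plus_R_nonzero[of x] by (simp add: \<psi>_def power_mult_distrib powr_power cis_m del: of_real_divide of_real_mult)

lemma \<phi>_\<psi>: "cmod x \<le> 1 \<Longrightarrow> \<phi> (\<psi> l x) = x"
  using R_pos by (simp add: \<phi>_def \<psi>_power)

lemma \<psi>_inj: "inj_on (\<psi> l) (ball 0 1)"
  by (rule inj_on_inverseI[of _ \<phi>]) (simp add: \<phi>_\<psi>)

lemma \<psi>_deriv:
  assumes "cmod x \<le> 1"
  shows "(\<psi> l has_field_derivative \<psi>' l x) (at x)"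
  unfolding \<psi>_def \<psi>'_def
  by (rule derivative_eq_intros refl | use one_plus_R_not_nonpos[OF assms] in simp)+

lemma continuous_on_powr_disk:
  "continuous_on (cball 0 1) (\<lambda>x::complex. (1 + of_real R * x) powr of_real a)"
proof (intro continuous_at_imp_continuous_on ballI)
  fix x :: complex assume "x \<in> cball 0 1"
  then have u: "1 + of_real R * x \<notin> \<real>\<^sub>\<le>\<^sub>0" by (simp add: one_plus_R_not_nonpos)
  have "((\<lambda>x. 1 + of_real R * x) has_field_derivative of_real R) (at x)"
    by (auto intro!: derivative_eq_intros)
  from DERIV_isCont[OF DERIV_chain2[OF has_field_derivative_powr[OF u] this]]
  show "isCont (\<lambda>x. (1 + of_real R * x) powr of_real a) x" .
qed

lemma Grm_image: "Grm r m = (\<Union>l<m. \<psi> l ` ball 0 1)"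
proof (intro equalityI subsetI)
  fix z assume "z \<in> Grm r m"
  then have x: "cmod (\<phi> z) < 1" by (simp add: Grm_eq)
  \<comment> \<open>The branch \<open>\<psi> 0\<close> supplies a reference point with the same
    \<open>m\<close>-th power as \<open>z\<close>; the quotient \<open>z / y\<close> is then a root
    of unity, and it selects the branch \<open>l\<close>.\<close>
  define y where "y = \<psi> 0 (\<phi> z)"
  have yz: "y ^ m = z ^ m"
    using x R_pos by (simp add: y_def \<psi>_power) (simp add: \<phi>_def)
  have "y \<noteq> 0"
    using one_plus_R_nonzero[of "\<phi> z"] x m_pos \<psi>_power[of "\<phi> z" 0] by (auto simp: y_def power_0_left)
  then have "(z / y) ^ m = 1" by (simp add: power_divide flip: yz)
  then obtain l where l: "l < m" "z / y = cis (2 * pi * real l / real m)"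
    using bij_betw_imp_surj_on[OF Complex.bij_betw_roots_unity[OF m_pos]] by (auto simp: set_eq_iff image_iff)
  then have "z = \<psi> l (\<phi> z)"
    using \<open>y \<noteq> 0\<close> by (simp add: y_def \<psi>_def field_simps)
  then have "z \<in> \<psi> l ` ball 0 1" using x by (intro image_eqI[of _ _ "\<phi> z"]) auto
  then show "z \<in> (\<Union>l<m. \<psi> l ` ball 0 1)" using l by blast
next
  fix z assume "z \<in> (\<Union>l<m. \<psi> l ` ball 0 1)"
  then show "z \<in> Grm r m" by (auto simp: Grm_eq \<phi>_\<psi>)
qed

lemma \<psi>_disjoint: "disjoint_family_on (\<lambda>l. \<psi> l ` ball 0 1) {..<m}"
proof (unfold disjoint_family_on_def, intro ballI impI equals0I)
  fix l k z assume lk: "l \<in> {..<m}" "k \<in> {..<m}" "l \<noteq> k" and "z \<in> \<psi> l ` ball 0 1 \<inter> \<psi> k ` ball 0 1"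
  then obtain x y where xy: "cmod x < 1" "cmod y < 1" "z = \<psi> l x" "z = \<psi> k y" by auto
  then have "x = y" using \<phi>_\<psi>[of x l] \<phi>_\<psi>[of y k] by simp
  then have "cis (2 * pi * real l / real m) = cis (2 * pi * real k / real m)"
    using xy one_plus_R_nonzero[of y] by (simp add: \<psi>_def)
  then show False
    using lk bij_betw_imp_inj_on[OF Complex.bij_betw_roots_unity[OF m_pos]] by (auto simp: inj_on_def)
qed

text \<open>The derivative is kept attached to \<open>p\<close> because the Jacobian is
  \<open>\<psi>' l x\<close> times its conjugate: one factor goes to each argument of the inner
  product.\<close>

lemma rep_pullback:
  assumes "rep P p" "cmod x \<le> 1"
  shows "poly p (\<psi> l x) * \<psi>' l x = of_real (R / real m) *
    (\<Sum>j<m. cis (2 * pi * real l / real m) ^ Suc j * (poly (P j) x * (1 + of_real R * x) powr of_real (- \<beta> j)))"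
proof -
  let ?u = "1 + of_real R * x" and ?w = "cis (2 * pi * real l / real m)"
  have pull: "\<psi> l x ^ j * \<psi>' l x = of_real (R / real m) * (?w ^ Suc j * ?u powr of_real (- \<beta> j))" for j
  proof -
    have "?u powr of_real (- \<beta> j) = ?u powr of_real (real j * (1 / real m)) * ?u powr of_real (1 / real m - 1)"
      by (subst powr_add[symmetric]) (simp add: \<beta>_def add_divide_distrib add_diff_eq)
    then show ?thesis
      unfolding \<psi>_def \<psi>'_def power_mult_distrib powr_power[OF one_plus_R_nonzero[OF assms(2)]]
      by (simp only: power_Suc mult_ac)
  qed
  have "\<psi> l x ^ j * poly (P j) x * \<psi>' l x =
      of_real (R / real m) * (?w ^ Suc j * (poly (P j) x * ?u powr of_real (- \<beta> j)))" for j
  proof -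
    have "\<psi> l x ^ j * poly (P j) x * \<psi>' l x = poly (P j) x * (\<psi> l x ^ j * \<psi>' l x)"
      by (simp only: mult_ac)
    then show ?thesis unfolding pull by (simp only: mult_ac)
  qed
  moreover have "poly p (\<psi> l x) = (\<Sum>j<m. \<psi> l x ^ j * poly (P j) x)"
    using assms by (simp add: rep_def \<phi>_\<psi>)
  ultimately show ?thesis
    by (simp only: sum_distrib_right sum_distrib_left)
qed

text \<open>Pulling back along all branches gives a triple sum over \<open>l\<close>,
  \<open>j\<close> and \<open>k\<close>; the sum over \<open>l\<close> is the orthogonality relation
  of the roots of unity and removes the terms with \<open>j\<close> different from \<open>k\<close>.
  The constant is \<open>(R / m)\<^sup>2\<close> from the two derivatives times \<open>m\<close>
  from the roots.\<close>

theorem area_ip_rep: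
  assumes "rep P p" "rep Q q"
  shows "area_ip (Grm r m) p q = of_real (R\<^sup>2 / real m) * (\<Sum>j<m. bip j (P j) (Q j))"
proof -
  define E where "E j x = poly (P j) x * (1 + of_real R * x) powr of_real (- \<beta> j)" for j x
  define E' where "E' j x = poly (Q j) x * (1 + of_real R * x) powr of_real (- \<beta> j)" for j x
  define \<omega> where "\<omega> l = cis (2 * pi * real l / real m)" for l
  let ?f = "\<lambda>z. poly p z * cnj (poly q z)"
  let ?F = "\<lambda>l x. (poly p (\<psi> l x) * \<psi>' l x) * cnj (poly q (\<psi> l x) * \<psi>' l x)"
  have c\<psi>: "continuous_on (ball 0 1) (\<psi> l)" for l
    using \<psi>_deriv by (meson DERIV_isCont continuous_at_imp_continuous_on less_imp_le mem_ball_0)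
  have open\<psi>: "open (\<psi> l ` ball 0 1)" for l
    by (rule invariance_of_domain) (auto simp: c\<psi> \<psi>_inj)
  have c\<psi>': "continuous_on (ball 0 1) (\<psi>' l)" for l
    unfolding \<psi>'_def
    by (intro continuous_intros continuous_on_subset[OF continuous_on_powr_disk ball_subset_cball])
  have int\<psi>: "set_integrable lborel (\<psi> l ` ball 0 1) ?f" if "l < m" for l
    by (rule set_integrable_subset[OF ip_integrable]) (use open\<psi> that Grm_image in auto)
  have cov: "set_integrable lborel (ball 0 1) (?F l)" "(LINT x:ball 0 1|lborel. ?F l x) = (LINT z:\<psi> l ` ball 0 1|lborel. ?f z)"
    if "l < m" for l
  proof -
    have eq: "(\<lambda>x. of_real ((cmod (\<psi>' l x))\<^sup>2) * ?f (\<psi> l x)) = ?F l"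
      by (simp only: complex_norm_square) (simp add: fun_eq_iff mult_ac)
    have der: "(\<psi> l has_field_derivative \<psi>' l x) (at x)" if "x \<in> ball 0 1" for x
      using that by (intro \<psi>_deriv) simp
    have *: "continuous_on (\<psi> l ` ball 0 1) ?f" by (intro continuous_intros)
    note cov = complex_change_of_variables[OF open_ball \<psi>_inj der c\<psi>' * int\<psi>[OF that]]
    show "set_integrable lborel (ball 0 1) (?F l)"
      using cov(1) unfolding eq .
    show "(LINT x:ball 0 1|lborel. ?F l x) = (LINT z:\<psi> l ` ball 0 1|lborel. ?f z)"
      using cov(2) unfolding eq .
  qed
  have "area_ip (Grm r m) p q = (LINT z:(\<Union>l<m. \<psi> l ` ball 0 1)|lborel. ?f z)"
    by (simp only: area_ip_def Grm_image)
  also have "\<dots> = (\<Sum>l<m. LINT z:\<psi> l ` ball 0 1|lborel. ?f z)"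
    by (rule set_integral_finite_Union) (use int\<psi> open\<psi> \<psi>_disjoint in auto)
  also have "\<dots> = (\<Sum>l<m. LINT x:ball 0 1|lborel. ?F l x)"
    by (intro sum.cong refl) (simp only: cov(2) lessThan_iff)
  also have "\<dots> = (LINT x:ball 0 1|lborel. (\<Sum>l<m. ?F l x))"
    using cov(1) unfolding set_lebesgue_integral_def set_integrable_def
    by (subst Bochner_Integration.integral_sum[symmetric]) (auto simp: scaleR_sum_right)
  also have "\<dots> = (LINT x:ball 0 1|lborel. of_real (R\<^sup>2 / real m) * (\<Sum>j<m. E j x * cnj (E' j x)))"
  proof (rule set_lebesgue_integral_cong)
    show "\<forall>x. x \<in> ball 0 1 \<longrightarrow> (\<Sum>l<m. ?F l x) = of_real (R\<^sup>2 / real m) * (\<Sum>j<m. E j x * cnj (E' j x))"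
    proof (intro allI impI)
      fix x :: complex assume "x \<in> ball 0 1"
      then have x: "cmod x \<le> 1" by simp
      define a where "a = complex_of_real (R / real m)"
      have "?F l x = a * a * (\<Sum>j<m. \<Sum>k<m. (\<omega> l ^ Suc j * cnj (\<omega> l ^ Suc k)) * (E j x * cnj (E' k x)))" for l
        unfolding rep_pullback[OF assms(1) x] rep_pullback[OF assms(2) x]
        unfolding E_def[symmetric] E'_def[symmetric] \<omega>_def[symmetric] a_def[symmetric]
        by (simp add: sum_product mult_ac a_def)
      then have "(\<Sum>l<m. ?F l x) = a * a * (\<Sum>l<m. \<Sum>j<m. \<Sum>k<m. (\<omega> l ^ Suc j * cnj (\<omega> l ^ Suc k)) * (E j x * cnj (E' k x)))"
        by (simp only: sum_distrib_left)
      also have "(\<Sum>l<m. \<Sum>j<m. \<Sum>k<m. (\<omega> l ^ Suc j * cnj (\<omega> l ^ Suc k)) * (E j x * cnj (E' k x))) =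
          (\<Sum>j<m. \<Sum>k<m. (\<Sum>l<m. \<omega> l ^ Suc j * cnj (\<omega> l ^ Suc k)) * (E j x * cnj (E' k x)))"
        unfolding sum_distrib_right by (subst sum.swap) (intro sum.cong refl sum.swap)
      also have "\<dots> = (\<Sum>j<m. \<Sum>k<m. (if j = k then of_nat m else 0) * (E j x * cnj (E' k x)))"
        unfolding \<omega>_def by (intro sum.cong refl) (simp only: roots_of_unity_orthogonal lessThan_iff)
      also have "\<dots> = of_nat m * (\<Sum>j<m. E j x * cnj (E' j x))"
        unfolding sum_distrib_left by (intro sum.cong refl) (simp add: if_distrib[of "\<lambda>c. c * _"] cong: if_cong)
      finally show "(\<Sum>l<m. ?F l x) = of_real (R\<^sup>2 / real m) * (\<Sum>j<m. E j x * cnj (E' j x))"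
        using m_pos by (simp add: a_def power2_eq_square)
    qed
  qed simp
  also have "\<dots> = of_real (R\<^sup>2 / real m) * (LINT x:ball 0 1|lborel. (\<Sum>j<m. E j x * cnj (E' j x)))"
    by (rule set_integral_mult_right)
  also have "(LINT x:ball 0 1|lborel. (\<Sum>j<m. E j x * cnj (E' j x))) = (\<Sum>j<m. LINT x:ball 0 1|lborel. E j x * cnj (E' j x))"
  proof -
    have "set_integrable lborel (ball 0 1) (\<lambda>x. E j x * cnj (E' j x))" for j
      unfolding E_def E'_def
      by (intro set_integrable_ball_continuous continuous_intros continuous_on_powr_disk)
    then show ?thesis
      unfolding set_lebesgue_integral_def set_integrable_def
      by (subst Bochner_Integration.integral_sum[symmetric]) (auto simp: scaleR_sum_right)
  qed
  also have "\<dots> = (\<Sum>j<m. bip j (P j) (Q j))"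
    by (intro sum.cong refl) (simp only: bip_sums(2) E_def E'_def lessThan_iff)
  finally show ?thesis .
qed

end

section \<open>An almost reproducing polynomial\<close>

lemma poly_as_sum_le:
  fixes p :: "'a::comm_semiring_1 poly"
  assumes "degree p \<le> n"
  shows "poly p z = (\<Sum>k\<le>n. coeff p k * z ^ k)"
  unfolding poly_altdef using assms by (intro sum.mono_neutral_left) (auto simp: coeff_eq_0)

context lemniscate begin

definition cf_const :: real where "cf_const = sqrt (real m / (pi * R\<^sup>2))"

lemma cf_const_nonneg: "cf_const \<ge> 0"
  using R_pos by (simp add: cf_const_def)

text \<open>The expansion of \<open>(nrm p)\<^sup>2\<close> has nonnegative terms, so any single
  \<open>pi / (k + 1)\<close> times a squared coefficient is at most
  \<open>m / R\<^sup>2 * (nrm p)\<^sup>2\<close>; \<open>cf_const\<close> is the root of the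
  resulting constant. The growth \<open>sqrt (k + 1)\<close> is what later limits the
  cut-off.\<close>

lemma cf_bound:
  assumes "rep P p" "j < m"
  shows "cmod (cf j (P j) k) \<le> cf_const * sqrt (real k + 1) * nrm p"
proof -
  define T where "T i k = pi / (real k + 1) * (cmod (cf i (P i) k))\<^sup>2" for i k
  have T0: "T i k \<ge> 0" for i k by (simp add: T_def)
  have sums: "T i sums Re (bip i (P i) (P i))" if "i < m" for i
  proof -
    have "(\<lambda>k. Re (of_real (pi / (real k + 1)) * cf i (P i) k * cnj (cf i (P i) k))) sums Re (bip i (P i) (P i))"
      by (intro sums_Re bip_sums that)
    also have "(\<lambda>k. Re (of_real (pi / (real k + 1)) * cf i (P i) k * cnj (cf i (P i) k))) = T i"
      unfolding mult.assoc complex_norm_square[symmetric] of_real_mult[symmetric] by (simp add: T_def fun_eq_iff)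
    finally show ?thesis .
  qed
  have nonneg: "Re (bip i (P i) (P i)) \<ge> 0" if "i < m" for i
    using sums_le[OF T0 sums_zero sums[OF that]] .
  have "T j k \<le> Re (bip j (P j) (P j))"
    using sum_le_suminf[of "T j" "{k}"] sums[OF assms(2)] T0 by (auto simp: sums_iff)
  also have "\<dots> \<le> (\<Sum>i<m. Re (bip i (P i) (P i)))"
    using nonneg assms(2) by (intro member_le_sum) auto
  also have "\<dots> = real m / R\<^sup>2 * (nrm p)\<^sup>2"
  proof -
    have "(nrm p)\<^sup>2 = R\<^sup>2 / real m * (\<Sum>i<m. Re (bip i (P i) (P i)))"
      using arg_cong[OF area_ip_rep[OF assms(1) assms(1)], of Re] unfolding ip_self_nrm
      by (simp del: of_real_divide of_real_power of_real_mult)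
    then show ?thesis using R_pos m_pos by simp
  qed
  finally have "(cmod (cf j (P j) k))\<^sup>2 \<le> real m / (pi * R\<^sup>2) * (real k + 1) * (nrm p)\<^sup>2"
    using R_pos by (simp add: T_def field_simps)
  also have "\<dots> = (cf_const * sqrt (real k + 1) * nrm p)\<^sup>2"
    using R_pos by (simp add: cf_const_def power_mult_distrib)
  finally show ?thesis
    by (rule power2_le_imp_le) (simp add: cf_const_nonneg)
qed

text \<open>
  The component \<open>test_component M L w j\<close> approximates the weighted reproducing kernel in the \<open>j\<close>-th summand:
  \<open>gp\<close> truncates \<open>(1 + R x)^(\<beta> j)\<close> at degree \<open>M\<close>, and \<open>kp\<close> is the Bergman kernel of the disk cut to degrees below \<open>L\<close>.
\<close>

definition gp :: "nat \<Rightarrow> nat \<Rightarrow> complex poly" where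
  "gp M j = (\<Sum>t\<le>M. monom (gc j t) t)"

definition kp :: "nat \<Rightarrow> complex \<Rightarrow> complex poly" where
  "kp L y = (\<Sum>k<L. monom (of_real ((real k + 1) / pi) * cnj y ^ k) k)"

definition test_component :: "nat \<Rightarrow> nat \<Rightarrow> complex \<Rightarrow> nat \<Rightarrow> complex poly" where
  "test_component M L w j = smult (of_real (real m / R\<^sup>2) * cnj (w ^ j * poly (gp M j) (\<phi> w))) (gp M j * kp L (\<phi> w))"

definition test_poly :: "nat \<Rightarrow> nat \<Rightarrow> complex \<Rightarrow> complex poly" where
  "test_poly M L w = (\<Sum>j<m. monom 1 j * pcompose (test_component M L w j) (smult (of_real (1 / R)) (monom 1 m - 1)))"

lemma poly_gp: "poly (gp M j) x = (\<Sum>t\<le>M. gc j t * x ^ t)"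
  by (simp add: gp_def poly_sum poly_monom)

lemma poly_kp: "poly (kp L y) x = (\<Sum>k<L. of_real ((real k + 1) / pi) * (x * cnj y) ^ k)"
  by (simp add: kp_def poly_sum poly_monom power_mult_distrib mult_ac)

lemma coeff_gp: "coeff (gp M j) t = (if t \<le> M then gc j t else 0)"
  by (simp add: gp_def coeff_sum)

lemma coeff_kp: "coeff (kp L y) k = (if k < L then of_real ((real k + 1) / pi) * cnj y ^ k else 0)"
  by (simp add: kp_def coeff_sum)

lemma rep_test_poly: "rep (test_component M L w) (test_poly M L w)"
  by (simp add: rep_def test_poly_def poly_sum poly_monom poly_pcompose \<phi>_def)

text \<open>\<open>kp\<close> sees the two points only through
  \<open>\<phi> z * cnj (\<phi> w)\<close>, which is the same for every \<open>j\<close>, so the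
  value factors: the sum over \<open>j\<close> converges without scaling, and the weighted geometric
  sum carries the growth \<open>n\<^sup>2\<close>.\<close>

lemma poly_test_poly: "poly (test_poly M L w) z = of_real (real m / (pi * R\<^sup>2)) *
   (\<Sum>j<m. z ^ j * poly (gp M j) (\<phi> z) * cnj (w ^ j * poly (gp M j) (\<phi> w))) *
   (\<Sum>k<L. of_nat (k + 1) * (\<phi> z * cnj (\<phi> w)) ^ k)"
proof -
  define K where "K = (\<Sum>k<L. of_nat (k + 1) * (\<phi> z * cnj (\<phi> w)) ^ k)"
  have "poly (kp L (\<phi> w)) (\<phi> z) = of_real (1 / pi) * K"
    unfolding poly_kp K_def sum_distrib_left by (intro sum.cong) (auto simp: field_simps)
  then have "poly (test_poly M L w) z = (\<Sum>j<m. of_real (real m / (pi * R\<^sup>2)) *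
      (z ^ j * poly (gp M j) (\<phi> z) * cnj (w ^ j * poly (gp M j) (\<phi> w))) * K)"
    using rep_test_poly[of M L w] unfolding rep_def test_component_def by (simp add: mult_ac)
  then show ?thesis
    unfolding K_def[symmetric] by (simp only: sum_distrib_left sum_distrib_right)
qed

text \<open>\<open>kp\<close> stops below degree \<open>L\<close>, so a component has degree at most
  \<open>M + L - 1\<close>. The missing unit pays for the monomial factor, because
  \<open>j + (n div m - 1) * m\<close> stays below \<open>(n div m) * m\<close> for
  \<open>j < m\<close>; positivity of \<open>L\<close> ensures that \<open>n div m\<close> is not
  0.\<close>

lemma degree_test_poly:
  assumes "M + L \<le> n div m" "L > 0"
  shows "degree (test_poly M L w) \<le> n"
  unfolding test_poly_def
proof (rule degree_sum_le)
  fix j assume j: "j \<in> {..<m}"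
  have "degree (gp M j) \<le> M" "degree (kp L (\<phi> w)) \<le> L - 1"
    by (auto intro!: degree_le simp: coeff_gp coeff_kp)
  then have "degree (test_component M L w j) \<le> n div m - 1"
    unfolding test_component_def using assms
    by (intro order_trans[OF degree_smult_le] order_trans[OF degree_mult_le]) linarith
  moreover have "degree (smult (complex_of_real (1 / R)) (monom 1 m - 1)) \<le> m"
    by (intro order_trans[OF degree_smult_le] degree_diff_le) (auto simp: degree_monom_le)
  ultimately have "degree (pcompose (test_component M L w j) (smult (of_real (1 / R)) (monom 1 m - 1))) \<le> (n div m - 1) * m"
    unfolding degree_pcompose by (intro mult_mono) auto
  then have "degree (monom 1 j * pcompose (test_component M L w j) (smult (of_real (1 / R)) (monom 1 m - 1))) \<le> j + (n div m - 1) * m"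
    by (intro order_trans[OF degree_mult_le] add_mono) (auto simp: degree_monom_le)
  also have "\<dots> \<le> (n div m) * m"
    using j assms by (cases "n div m") auto
  also have "\<dots> \<le> n" by simp
  finally show "degree (monom 1 j * pcompose (test_component M L w j) (smult (of_real (1 / R)) (monom 1 m - 1))) \<le> n" .
qed simp

text \<open>Monomials are grouped by the residue of the exponent modulo \<open>m\<close>. The
  remaining power of \<open>z ^ m\<close> is a power of \<open>1 + R \<phi>\<close>, hence of the
  linear polynomial \<open>[:1, of_real R:]\<close> at \<open>\<phi> z\<close>.\<close>

lemma rep_exists:
  assumes "degree p \<le> n"
  shows "\<exists>P. rep P p \<and> (\<forall>j<m. degree (P j) \<le> n div m)"
proof -
  define P where "P j = (\<Sum>k\<in>{k. k \<le> n \<and> k mod m = j}. smult (coeff p k) ([:1, of_real R:] ^ (k div m)))" for j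
  have "rep P p"
    unfolding rep_def
  proof
    fix z
    have u: "poly [:1, of_real R:] (\<phi> z) = z ^ m" using R_pos by (simp add: \<phi>_def)
    have "(\<Sum>j<m. z ^ j * poly (P j) (\<phi> z)) =
        (\<Sum>j<m. \<Sum>k\<in>{k. k \<in> {..n} \<and> k mod m = j}. coeff p k * z ^ k)"
    proof (intro sum.cong refl)
      fix j
      show "z ^ j * poly (P j) (\<phi> z) = (\<Sum>k\<in>{k. k \<in> {..n} \<and> k mod m = j}. coeff p k * z ^ k)"
        unfolding P_def poly_sum poly_smult poly_power u sum_distrib_left
        by (intro sum.cong) (auto simp: mult_ac simp flip: power_mult power_add)
    qed
    also have "\<dots> = (\<Sum>k\<le>n. coeff p k * z ^ k)"
      using m_pos by (intro sum.group) auto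
    also have "\<dots> = poly p z"
      by (rule poly_as_sum_le[OF assms, symmetric])
    finally show "poly p z = (\<Sum>j<m. z ^ j * poly (P j) (\<phi> z))" ..
  qed
  moreover have "degree (P j) \<le> n div m" for j
    unfolding P_def
  proof (rule degree_sum_le)
    fix k assume k: "k \<in> {k. k \<le> n \<and> k mod m = j}"
    have "degree (smult (coeff p k) ([:1, complex_of_real R:] ^ (k div m))) \<le> degree ([:1, complex_of_real R:] ^ (k div m))"
      by (rule degree_smult_le)
    also have "\<dots> \<le> degree [:1, complex_of_real R:] * (k div m)" by (rule degree_power_le)
    also have "\<dots> \<le> k div m" by simp
    also have "\<dots> \<le> n div m" using k by (simp add: div_le_mono)
    finally show "degree (smult (coeff p k) ([:1, complex_of_real R:] ^ (k div m))) \<le> n div m" .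
  qed simp
  ultimately show ?thesis by blast
qed

section \<open>Geometric tails and the two truncation errors\<close>

lemma geometric_tail: "(\<lambda>t. if t \<le> M then 0 else R ^ t) sums (R ^ Suc M / (1 - R))"
proof -
  have "(\<lambda>t. R ^ Suc M * R ^ t) sums (R ^ Suc M * (1 / (1 - R)))"
    using R_pos R_less by (intro sums_mult geometric_sums) simp
  then have "(\<lambda>t. (if t + Suc M \<le> M then 0 else R ^ (t + Suc M))) sums (R ^ Suc M / (1 - R))"
    by (simp add: power_add mult_ac)
  then have "(\<lambda>t. if t \<le> M then 0 else R ^ t) sums (R ^ Suc M / (1 - R) + (\<Sum>t<Suc M. if t \<le> M then 0 else R ^ t))"
    using sums_iff_shift[of "\<lambda>t. if t \<le> M then 0 else R ^ t" "Suc M"] by blast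
  then show ?thesis by simp
qed

lemma sum_geometric_le: "finite T \<Longrightarrow> (\<Sum>t\<in>T. R ^ t) \<le> 1 / (1 - R)"
  using R_pos R_less sum_le_suminf[of "\<lambda>t. R ^ t" T] by (simp add: suminf_geometric summable_geometric)

lemma sum_geometric_tail_le:
  assumes "finite T" "\<And>t. t \<in> T \<Longrightarrow> M < t"
  shows "(\<Sum>t\<in>T. R ^ t) \<le> R ^ Suc M / (1 - R)"
proof -
  have "(\<Sum>t\<in>T. R ^ t) = (\<Sum>t\<in>T. if t \<le> M then 0 else R ^ t)"
  proof (intro sum.cong refl)
    fix t assume "t \<in> T"
    then show "R ^ t = (if t \<le> M then 0 else R ^ t)" using assms(2)[of t] by simp
  qed
  also have "\<dots> \<le> (\<Sum>t. if t \<le> M then 0 else R ^ t)"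
    using geometric_tail R_pos assms(1) by (intro sum_le_suminf) (auto simp: sums_iff)
  also have "\<dots> = R ^ Suc M / (1 - R)" using geometric_tail by (simp add: sums_iff)
  finally show ?thesis .
qed

lemma norm_poly_gp_le:
  assumes "j < m" "\<And>k. k \<le> M \<Longrightarrow> cmod y ^ k \<le> C"
  shows "cmod (poly (gp M j) y) \<le> C / (1 - R)"
proof -
  have C: "C \<ge> 0" using assms(2)[of 0] by simp
  have "cmod (poly (gp M j) y) \<le> (\<Sum>t\<le>M. R ^ t * C)"
    unfolding poly_gp using assms R_pos
    by (intro sum_norm_le) (auto simp: norm_mult norm_power intro!: mult_mono norm_gc)
  also have "\<dots> \<le> C / (1 - R)"
    using mult_right_mono[OF sum_geometric_le[of "{..M}"] C] by (simp add: sum_distrib_right)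
  finally show ?thesis .
qed

lemma bip_smult_right:
  assumes "j < m"
  shows "bip j P (smult c Q) = cnj c * bip j P Q"
proof -
  have cf: "cf j (smult c Q) k = c * cf j Q k" for k
    by (simp add: cf_def sum_distrib_left mult_ac)
  have "(\<lambda>k. cnj c * (of_real (pi / (real k + 1)) * cf j P k * cnj (cf j Q k))) sums (cnj c * bip j P Q)"
    by (intro sums_mult bip_sums assms)
  then have "(\<lambda>k. of_real (pi / (real k + 1)) * cf j P k * cnj (cf j (smult c Q) k)) sums (cnj c * bip j P Q)"
    by (simp add: cf mult_ac)
  then show ?thesis
    using bip_sums(1)[OF assms, of P "smult c Q"] sums_unique2 by blast
qed

text \<open>The weight turns \<open>gp\<close> into \<open>1 - e\<close>, where \<open>e\<close> is
  the tail \<open>d\<close> of the reciprocal weight times the weight. So the weighted coefficients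
  of \<open>gp * kp\<close> are those of \<open>kp\<close> minus the convolution \<open>b\<close> of
  \<open>kp\<close> with \<open>e\<close>. For \<open>kp\<close> alone the factors
  \<open>(k + 1) / pi\<close> and \<open>pi / (k + 1)\<close> cancel and exactly the partial sum
  remains; the rest is controlled by the absolute sums of \<open>kp\<close>, \<open>d\<close> and
  the weight, which multiply under convolution.\<close>

lemma bip_gp_kp:
  assumes j: "j < m" and rp: "rep P p" and C: "\<And>k. k < L \<Longrightarrow> cmod y ^ k \<le> C" "C \<ge> 0"
  shows "cmod (bip j (P j) (gp M j * kp L y) - (\<Sum>k<L. cf j (P j) k * y ^ k)) \<le>
     cf_const * nrm p * ((real L)\<^sup>2 * C) * (R ^ Suc M / (1 - R)\<^sup>2)"
proof -
  define f where "f = cf j (P j)"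
  define d where "d t = (if t \<le> M then 0 else gc j t)" for t
  define e where "e k = (\<Sum>i\<le>k. d i * hc j (k - i))" for k
  define b where "b k = (\<Sum>s\<le>k. coeff (kp L y) s * e (k - s))" for k
  have fps_gp: "fps_of_poly (gp M j) = Abs_fps (gc j) - Abs_fps d"
    by (rule fps_ext) (simp add: coeff_gp d_def)
  have fps_e: "Abs_fps e = Abs_fps d * Abs_fps (hc j)"
    by (rule fps_ext) (simp add: e_def fps_mult_nth atMost_atLeast0)
  have fps_b: "Abs_fps b = fps_of_poly (kp L y) * Abs_fps e"
    by (rule fps_ext) (simp add: b_def fps_mult_nth atMost_atLeast0)
  have "Abs_fps (cf j (gp M j * kp L y)) = fps_of_poly (gp M j * kp L y) * Abs_fps (hc j)"
    by (rule fps_ext) (simp add: cf_def fps_mult_nth atMost_atLeast0)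
  also have "\<dots> = fps_of_poly (kp L y) - Abs_fps b"
    using hc_gc[of j] unfolding fps_of_poly_mult fps_gp fps_b fps_e by (simp add: algebra_simps)
  finally have "fps_nth (Abs_fps (cf j (gp M j * kp L y))) k = fps_nth (fps_of_poly (kp L y) - Abs_fps b) k" for k
    by simp
  then have cfk: "cf j (gp M j * kp L y) k = coeff (kp L y) k - b k" for k
    by simp
  have nd: "cmod (d t) \<le> (if t \<le> M then 0 else R ^ t)" for t
    using norm_gc[OF j] by (simp add: d_def)
  have sd: "summable (\<lambda>t. cmod (d t))"
    by (rule summable_comparison_test'[OF sums_summable[OF geometric_tail[of M]], of 0]) (use nd in auto)
  have sh: "summable (\<lambda>t. cmod (hc j t))"
    using summable_hc[OF j, of 1] R_less by simp
  have sgeo: "summable (\<lambda>t. R ^ t)" using R_pos R_less by (intro summable_geometric) simp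
  have "(\<lambda>k. \<Sum>i\<le>k. cmod (d i) * cmod (hc j (k - i))) sums ((\<Sum>k. cmod (d k)) * (\<Sum>k. cmod (hc j k)))"
    using sd sh by (intro Cauchy_product_sums) auto
  then have e1: "summable (\<lambda>k. \<Sum>i\<le>k. cmod (d i) * cmod (hc j (k - i)))"
    and e2: "(\<Sum>k. \<Sum>i\<le>k. cmod (d i) * cmod (hc j (k - i))) = (\<Sum>k. cmod (d k)) * (\<Sum>k. cmod (hc j k))"
    by (auto simp: sums_iff)
  have ne: "cmod (e k) \<le> (\<Sum>i\<le>k. cmod (d i) * cmod (hc j (k - i)))" for k
    unfolding e_def by (intro sum_norm_le) (simp add: norm_mult)
  have se: "summable (\<lambda>k. cmod (e k))"
    by (rule summable_comparison_test'[OF e1, of 0]) (use ne in auto)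
  have "(\<Sum>k. cmod (e k)) \<le> (\<Sum>k. cmod (d k)) * (\<Sum>k. cmod (hc j k))"
    unfolding e2[symmetric] by (intro suminf_le ne se e1)
  also have "\<dots> \<le> (R ^ Suc M / (1 - R)) * (1 / (1 - R))"
  proof (intro mult_mono)
    show "(\<Sum>k. cmod (d k)) \<le> R ^ Suc M / (1 - R)"
      using suminf_le[OF nd sd sums_summable[OF geometric_tail]] geometric_tail[of M] by (simp add: sums_iff)
    show "(\<Sum>k. cmod (hc j k)) \<le> 1 / (1 - R)"
      using suminf_le[OF norm_hc[OF j] sh sgeo] R_pos R_less by (simp add: suminf_geometric)
  qed (use R_pos R_less sh in \<open>auto intro!: suminf_nonneg\<close>)
  finally have sume: "(\<Sum>k. cmod (e k)) \<le> R ^ Suc M / (1 - R)\<^sup>2"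
    by (simp add: power2_eq_square)
  have sk: "summable (\<lambda>k. cmod (coeff (kp L y) k))"
    by (rule summable_finite[of "{..<L}"]) (auto simp: coeff_kp)
  have "(\<Sum>k. cmod (coeff (kp L y) k)) = (\<Sum>k<L. cmod (coeff (kp L y) k))"
    by (rule suminf_finite) (auto simp: coeff_kp)
  also have "\<dots> \<le> (\<Sum>k<L. real L / pi * C)"
  proof (rule sum_mono)
    fix k assume "k \<in> {..<L}"
    then show "cmod (coeff (kp L y) k) \<le> real L / pi * C"
      using C by (auto simp: coeff_kp norm_mult norm_power intro!: mult_mono divide_right_mono simp del: of_real_divide of_real_add)
  qed
  finally have sumk: "(\<Sum>k. cmod (coeff (kp L y) k)) \<le> (real L)\<^sup>2 * C / pi"
    by (simp add: power2_eq_square)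
  have "(\<lambda>k. \<Sum>i\<le>k. cmod (coeff (kp L y) i) * cmod (e (k - i))) sums ((\<Sum>k. cmod (coeff (kp L y) k)) * (\<Sum>k. cmod (e k)))"
    using sk se by (intro Cauchy_product_sums) auto
  then have b1: "summable (\<lambda>k. \<Sum>i\<le>k. cmod (coeff (kp L y) i) * cmod (e (k - i)))"
    and b2: "(\<Sum>k. \<Sum>i\<le>k. cmod (coeff (kp L y) i) * cmod (e (k - i))) = (\<Sum>k. cmod (coeff (kp L y) k)) * (\<Sum>k. cmod (e k))"
    by (auto simp: sums_iff)
  have nb: "cmod (b k) \<le> (\<Sum>i\<le>k. cmod (coeff (kp L y) i) * cmod (e (k - i)))" for k
    unfolding b_def by (intro sum_norm_le) (simp add: norm_mult)
  have sb: "summable (\<lambda>k. cmod (b k))"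
    by (rule summable_comparison_test'[OF b1, of 0]) (use nb in auto)
  have "(\<Sum>k. cmod (b k)) \<le> (\<Sum>k. cmod (coeff (kp L y) k)) * (\<Sum>k. cmod (e k))"
    unfolding b2[symmetric] by (intro suminf_le nb sb b1)
  also have "\<dots> \<le> ((real L)\<^sup>2 * C / pi) * (R ^ Suc M / (1 - R)\<^sup>2)"
    using C by (intro mult_mono sumk sume) (auto intro!: suminf_nonneg se)
  finally have sumb: "(\<Sum>k. cmod (b k)) \<le> ((real L)\<^sup>2 * C / pi) * (R ^ Suc M / (1 - R)\<^sup>2)" .
  define c where "c k = of_real (pi / (real k + 1)) * f k * cnj (b k)" for k
  \<comment> \<open>The growth \<open>sqrt (k + 1)\<close> of the coefficients is absorbed by
    \<open>1 / (k + 1)\<close>, so that summability of \<open>b\<close> is enough.\<close>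
  have nc: "cmod (c k) \<le> pi * cf_const * nrm p * cmod (b k)" for k
  proof -
    have "cmod (c k) = pi / (real k + 1) * cmod (f k) * cmod (b k)"
      by (simp add: c_def norm_mult del: of_real_divide of_real_add)
    also have "\<dots> \<le> pi / (real k + 1) * (cf_const * sqrt (real k + 1) * nrm p) * cmod (b k)"
      unfolding f_def by (intro mult_right_mono mult_left_mono cf_bound rp j) auto
    also have "\<dots> = (sqrt (real k + 1) / (real k + 1)) * (pi * cf_const * nrm p * cmod (b k))"
      by simp
    also have "\<dots> \<le> 1 * (pi * cf_const * nrm p * cmod (b k))"
      using cf_const_nonneg by (intro mult_right_mono) (auto simp: field_simps intro!: real_le_lsqrt simp: power2_eq_square)
    finally show ?thesis by simp
  qed
  have sc: "summable (\<lambda>k. cmod (c k))"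
    by (rule summable_comparison_test'[OF summable_mult[OF sb], of 0]) (use nc in auto)
  have main: "(\<lambda>k. of_real (pi / (real k + 1)) * f k * cnj (coeff (kp L y) k)) sums (\<Sum>k<L. f k * y ^ k)"
  proof -
    have "(\<lambda>k. of_real (pi / (real k + 1)) * f k * cnj (coeff (kp L y) k)) = (\<lambda>k. if k \<in> {..<L} then f k * y ^ k else 0)"
    proof
      fix k
      have "of_real (pi / (real k + 1)) * of_real ((real k + 1) / pi) = (1::complex)"
        unfolding of_real_mult[symmetric] by simp
      then have "of_real (pi / (real k + 1)) * f k * (of_real ((real k + 1) / pi) * y ^ k) = f k * y ^ k"
        by (metis (no_types) mult.left_commute mult.assoc mult_1)
      then show "of_real (pi / (real k + 1)) * f k * cnj (coeff (kp L y) k) = (if k \<in> {..<L} then f k * y ^ k else 0)"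
        by (simp add: coeff_kp del: of_real_divide of_real_add)
    qed
    then show ?thesis using sums_If_finite_set[of "{..<L}" "\<lambda>k. f k * y ^ k"] by (simp only: finite_lessThan)
  qed
  have "(\<lambda>k. of_real (pi / (real k + 1)) * f k * cnj (coeff (kp L y) k) - c k) sums ((\<Sum>k<L. f k * y ^ k) - suminf c)"
    by (rule sums_diff[OF main summable_sums[OF summable_norm_cancel[OF sc]]])
  also have "(\<lambda>k. of_real (pi / (real k + 1)) * f k * cnj (coeff (kp L y) k) - c k) =
      (\<lambda>k. of_real (pi / (real k + 1)) * cf j (P j) k * cnj (cf j (gp M j * kp L y) k))"
    by (simp only: cfk c_def f_def complex_cnj_diff right_diff_distrib)
  finally have "bip j (P j) (gp M j * kp L y) = (\<Sum>k<L. f k * y ^ k) - suminf c"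
    using bip_sums(1)[OF j] sums_unique2 by blast
  then have "cmod (bip j (P j) (gp M j * kp L y) - (\<Sum>k<L. cf j (P j) k * y ^ k)) = cmod (suminf c)"
    by (simp add: f_def)
  also have "\<dots> \<le> (\<Sum>k. cmod (c k))"
    by (rule summable_norm[OF sc])
  also have "\<dots> \<le> (\<Sum>k. pi * cf_const * nrm p * cmod (b k))"
    by (intro suminf_le nc sc summable_mult sb)
  also have "\<dots> = pi * cf_const * nrm p * (\<Sum>k. cmod (b k))"
    by (rule suminf_mult[OF sb])
  also have "\<dots> \<le> pi * cf_const * nrm p * (((real L)\<^sup>2 * C / pi) * (R ^ Suc M / (1 - R)\<^sup>2))"
    using cf_const_nonneg by (intro mult_left_mono sumb) auto
  also have "\<dots> = cf_const * nrm p * ((real L)\<^sup>2 * C) * (R ^ Suc M / (1 - R)\<^sup>2)"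
    by simp
  finally show ?thesis .
qed

text \<open>By \<open>coeff_conv_cf\<close> the value of \<open>P j\<close> is a sum over the
  triangle \<open>k + t \<le> N\<close>, while the product with \<open>gp\<close> covers the
  rectangle \<open>k < L\<close>, \<open>t \<le> M\<close> inside it. Left over are the terms with
  \<open>k < L\<close> and \<open>t > M\<close>, a geometric tail, and the \<open>N + 1 - L\<close>
  rows with \<open>k \<ge> L\<close>, where the coefficient bound has to do.\<close>

lemma gp_truncation:
  assumes j: "j < m" and rp: "rep P p" and deg: "degree (P j) \<le> N" and MLN: "M + L \<le> N"
    and C: "\<And>k. k \<le> N \<Longrightarrow> cmod y ^ k \<le> C" "C \<ge> 0"
  shows "cmod (poly (gp M j) y * (\<Sum>k<L. cf j (P j) k * y ^ k) - poly (P j) y) \<le>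
     cf_const * nrm p * sqrt (real N + 1) * C * (real L * (R ^ Suc M / (1 - R)) + (real N + 1 - real L) / (1 - R))"
proof -
  define f where "f = cf j (P j)"
  define F where "F = cf_const * sqrt (real N + 1) * nrm p"
  define T where "T k = (\<Sum>t\<le>N - k. gc j t * y ^ (k + t))" for k
  define T' where "T' k = (\<Sum>t\<le>M. gc j t * y ^ (k + t))" for k
  have F0: "F \<ge> 0" using cf_const_nonneg by (simp add: F_def)
  have nf: "cmod (f k) \<le> F" if "k \<le> N" for k
  proof -
    have "cmod (f k) \<le> cf_const * sqrt (real k + 1) * nrm p"
      unfolding f_def by (rule cf_bound[OF rp j])
    also have "\<dots> \<le> F"
      unfolding F_def using that cf_const_nonneg by (intro mult_right_mono mult_left_mono) auto
    finally show ?thesis .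
  qed
  have "poly (P j) y = (\<Sum>i\<le>N. coeff (P j) i * y ^ i)"
    by (rule poly_as_sum_le[OF deg])
  also have "\<dots> = (\<Sum>i\<le>N. \<Sum>k\<le>i. f k * gc j (i - k) * y ^ (k + (i - k)))"
    unfolding f_def by (subst coeff_conv_cf[of _ _ j]) (simp add: sum_distrib_right)
  also have "\<dots> = (\<Sum>(k,t)\<in>{(k,t). k + t \<le> N}. f k * gc j t * y ^ (k + t))"
    by (rule sum.triangle_reindex_eq[symmetric])
  also have "{(k,t). k + t \<le> N} = (SIGMA k:{..N}. {..N - k})"
    by auto
  also have "(\<Sum>(k,t)\<in>(SIGMA k:{..N}. {..N - k}). f k * gc j t * y ^ (k + t)) = (\<Sum>k\<le>N. f k * T k)"
    by (subst sum.Sigma[symmetric]) (auto simp: T_def sum_distrib_left mult_ac)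
  also have "{..N} = {..<L} \<union> {L..N}" using MLN by auto
  also have "(\<Sum>k\<in>{..<L} \<union> {L..N}. f k * T k) = (\<Sum>k<L. f k * T k) + (\<Sum>k\<in>{L..N}. f k * T k)"
    by (rule sum.union_disjoint) auto
  finally have P: "poly (P j) y = (\<Sum>k<L. f k * T k) + (\<Sum>k\<in>{L..N}. f k * T k)" .
  have S: "poly (gp M j) y * (\<Sum>k<L. f k * y ^ k) = (\<Sum>k<L. f k * T' k)"
    unfolding poly_gp T'_def sum_distrib_left sum_distrib_right
    by (auto simp: power_add mult_ac intro!: sum.cong)
  have tb: "cmod (gc j t * y ^ (k + t)) \<le> R ^ t * C" if "k + t \<le> N" for k t
    using that R_pos unfolding norm_mult norm_power by (intro mult_mono norm_gc j C) auto
  have nT: "cmod (T k) \<le> C / (1 - R)" if "k \<le> N" for k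
  proof -
    have "cmod (T k) \<le> (\<Sum>t\<le>N - k. R ^ t * C)"
      unfolding T_def using that by (intro sum_norm_le tb) auto
    also have "\<dots> \<le> 1 / (1 - R) * C"
      unfolding sum_distrib_right[symmetric] by (intro mult_right_mono sum_geometric_le C) auto
    finally show ?thesis by simp
  qed
  have nT': "cmod (T' k - T k) \<le> R ^ Suc M / (1 - R) * C" if "k < L" for k
  proof -
    \<comment> \<open>From \<open>k < L\<close> and \<open>M + L \<le> N\<close> follows
      \<open>M \<le> N - k\<close>: the rectangle fits into the triangle.\<close>
    have "{..N - k} = {..M} \<union> {M<..N - k}" using that MLN by auto
    then have "T k = T' k + (\<Sum>t\<in>{M<..N - k}. gc j t * y ^ (k + t))"
      unfolding T_def T'_def by (simp only:) (rule sum.union_disjoint, auto)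
    then have "cmod (T' k - T k) = cmod (\<Sum>t\<in>{M<..N - k}. gc j t * y ^ (k + t))"
      by simp
    also have "\<dots> \<le> (\<Sum>t\<in>{M<..N - k}. R ^ t * C)"
      using that MLN by (intro sum_norm_le tb) auto
    also have "\<dots> \<le> R ^ Suc M / (1 - R) * C"
      unfolding sum_distrib_right[symmetric] by (intro mult_right_mono sum_geometric_tail_le C) auto
    finally show ?thesis .
  qed
  have "poly (gp M j) y * (\<Sum>k<L. f k * y ^ k) - poly (P j) y =
      (\<Sum>k<L. f k * (T' k - T k)) - (\<Sum>k\<in>{L..N}. f k * T k)"
    unfolding P S by (simp add: right_diff_distrib sum_subtractf)
  also have "cmod \<dots> \<le> cmod (\<Sum>k<L. f k * (T' k - T k)) + cmod (\<Sum>k\<in>{L..N}. f k * T k)"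
    by (rule norm_triangle_ineq4)
  also have "\<dots> \<le> (\<Sum>k<L. F * (R ^ Suc M / (1 - R) * C)) + (\<Sum>k\<in>{L..N}. F * (C / (1 - R)))"
  proof (intro add_mono sum_norm_le)
    show "cmod (f k * (T' k - T k)) \<le> F * (R ^ Suc M / (1 - R) * C)" if "k \<in> {..<L}" for k
      unfolding norm_mult using that MLN by (intro mult_mono nf nT' F0) auto
    show "cmod (f k * T k) \<le> F * (C / (1 - R))" if "k \<in> {L..N}" for k
      unfolding norm_mult using that by (intro mult_mono nf nT F0) auto
  qed
  also have "\<dots> = F * C * (real L * (R ^ Suc M / (1 - R)) + (real N + 1 - real L) / (1 - R))"
    using MLN by (simp add: algebra_simps of_nat_diff)
  finally show ?thesis by (simp add: F_def f_def mult_ac)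
qed

end

section \<open>Weighted geometric sums\<close>

lemma norm_power_diff_le:
  fixes a b :: "'a::{real_normed_field}"
  assumes "norm a \<le> B" "norm b \<le> B" "B \<ge> 1"
  shows "norm (a ^ k - b ^ k) \<le> real k * B ^ k * norm (a - b)"
proof (induction k)
  case (Suc k)
  have "a ^ Suc k - b ^ Suc k = a * (a ^ k - b ^ k) + (a - b) * b ^ k"
    by (simp add: algebra_simps)
  also have "norm \<dots> \<le> norm a * norm (a ^ k - b ^ k) + norm (a - b) * norm b ^ k"
    by (metis norm_triangle_ineq norm_mult norm_power)
  also have "\<dots> \<le> B * (real k * B ^ k * norm (a - b)) + norm (a - b) * B ^ Suc k"
  proof (intro add_mono mult_mono Suc.IH assms)
    have "norm b ^ k \<le> B ^ k" using assms by (intro power_mono) auto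
    also have "\<dots> \<le> B ^ Suc k" using assms by (intro power_increasing) auto
    finally show "norm b ^ k \<le> B ^ Suc k" .
  qed (use assms in auto)
  also have "\<dots> = real (Suc k) * B ^ Suc k * norm (a - b)"
    by (simp add: algebra_simps)
  finally show ?case .
qed simp

text \<open>
  \<open>Hprim A\<close> is the primitive of \<open>t exp (A t)\<close> vanishing at \<open>0\<close>; the sums are compared with its telescoping increments.
\<close>

definition Hprim :: "complex \<Rightarrow> complex \<Rightarrow> complex" where
  "Hprim A s = (if A = 0 then s\<^sup>2 / 2 else (exp (A * s) * (A * s - 1) + 1) / A\<^sup>2)"

lemma Hprim_0: "Hprim A 0 = 0" and Hprim_1: "Hprim A 1 = Hfun A / 2"
  by (auto simp: Hprim_def Hfun_def)

lemma Hprim_deriv: "(Hprim A has_field_derivative s * exp (A * s)) (at s within S)"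
proof (cases "A = 0")
  case True
  then have "Hprim A = (\<lambda>s. s\<^sup>2 / 2)" by (auto simp: Hprim_def)
  then show ?thesis using True by (auto intro!: derivative_eq_intros)
next
  case False
  then have "Hprim A = (\<lambda>s. (exp (A * s) * (A * s - 1) + 1) / A\<^sup>2)" by (auto simp: Hprim_def)
  moreover have "((\<lambda>s. (exp (A * s) * (A * s - 1) + 1) / A\<^sup>2) has_field_derivative
      (exp (A * s) * A * (A * s - 1) + exp (A * s) * A) / A\<^sup>2) (at s within S)"
    by (rule DERIV_cdivide) (auto intro!: derivative_eq_intros)
  moreover have "(exp (A * s) * A * (A * s - 1) + exp (A * s) * A) / A\<^sup>2 = s * exp (A * s)"
    using False by (simp add: field_simps power2_eq_square)
  ultimately show ?thesis by simp
qed

lemma norm_exp_le_bound: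
  assumes "cmod A \<le> C" "cmod s \<le> 1"
  shows "cmod (exp (A * s)) \<le> exp C"
proof -
  have "cmod (A * s) \<le> C * 1" unfolding norm_mult using assms by (intro mult_mono) (auto intro: order_trans[OF norm_ge_zero])
  then show ?thesis using norm_exp[of "A * s"] by (metis exp_le_cancel_iff mult.right_neutral order_trans)
qed

text \<open>The mean value bound is applied to \<open>Hprim A s - s * c\<close> with
  \<open>c\<close> the sampled value; the derivative \<open>s * exp (A * s) - c\<close> is of order
  \<open>u - t\<close>. The weight is sampled at the right end and the exponential at the left end,
  which is the pattern \<open>(k + 1) * q ^ k\<close> of the sums to come.\<close>

lemma Hprim_increment:
  assumes A: "cmod A \<le> C" and "0 \<le> t" "t \<le> u" "u \<le> 1"
  shows "cmod (Hprim A (of_real u) - Hprim A (of_real t) - of_real (u - t) * (of_real u * exp (A * of_real t)))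
     \<le> (1 + C) * exp C * (u - t)\<^sup>2"
proof -
  have C: "C \<ge> 0" using A norm_ge_zero order_trans by blast
  define S where "S = closed_segment (complex_of_real t) (of_real u)"
  have Sreal: "\<exists>x. s = of_real x \<and> t \<le> x \<and> x \<le> u" if "s \<in> S" for s
    using that assms unfolding S_def closed_segment_of_real by (auto simp: closed_segment_eq_real_ivl)
  have ed: "cmod (exp (A * s) - exp (A * of_real t)) \<le> (C * exp C) * (u - t)" if "s \<in> S" for s
  proof -
    have "cmod (exp (A * s) - exp (A * of_real t)) \<le> (C * exp C) * cmod (s - of_real t)"
    proof (rule field_differentiable_bound[of S _ "\<lambda>s. A * exp (A * s)"])
      show "convex S" by (simp add: S_def)
      fix z assume "z \<in> S"
      then have z: "cmod z \<le> 1" using Sreal[of z] assms by auto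
      show "((\<lambda>s. exp (A * s)) has_field_derivative A * exp (A * z)) (at z within S)"
        by (auto intro!: derivative_eq_intros)
      show "cmod (A * exp (A * z)) \<le> C * exp C"
        unfolding norm_mult using C by (intro mult_mono A norm_exp_le_bound z) auto
    qed (use that in \<open>auto simp: S_def\<close>)
    also have "cmod (s - of_real t) \<le> u - t"
      using Sreal[OF that] by (auto simp flip: of_real_diff)
    finally show ?thesis using C by (simp add: mult_left_mono)
  qed
  define c where "c = of_real u * exp (A * of_real t)"
  have "cmod ((Hprim A (of_real u) - of_real u * c) - (Hprim A (of_real t) - of_real t * c))
      \<le> ((1 + C) * exp C * (u - t)) * cmod (of_real u - of_real t)"
  proof (rule field_differentiable_bound[of S _ "\<lambda>s. s * exp (A * s) - c"])
    show "convex S" by (simp add: S_def)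
    fix z assume zS: "z \<in> S"
    then obtain x where x: "z = of_real x" "t \<le> x" "x \<le> u" using Sreal by blast
    then have z: "cmod z \<le> 1" using assms by auto
    show "((\<lambda>s. Hprim A s - s * c) has_field_derivative z * exp (A * z) - c) (at z within S)"
      by (auto intro!: derivative_eq_intros Hprim_deriv)
    have "z * exp (A * z) - c = (z - of_real u) * exp (A * z) + of_real u * (exp (A * z) - exp (A * of_real t))"
      by (simp add: c_def algebra_simps)
    also have "cmod \<dots> \<le> cmod (z - of_real u) * cmod (exp (A * z)) + cmod (of_real u) * cmod (exp (A * z) - exp (A * of_real t))"
      by (metis norm_triangle_ineq norm_mult)
    also have "\<dots> \<le> (u - t) * exp C + 1 * ((C * exp C) * (u - t))"
      using x assms C by (intro add_mono mult_mono norm_exp_le_bound A z ed zS) (auto simp flip: of_real_diff)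
    finally show "cmod (z * exp (A * z) - c) \<le> (1 + C) * exp C * (u - t)"
      by (simp add: algebra_simps)
  qed (auto simp: S_def)
  also have "cmod (of_real u - of_real t) = u - t"
    using assms by (simp flip: of_real_diff)
  finally show ?thesis by (simp add: c_def algebra_simps power2_eq_square)
qed

text \<open>Read as the increment of \<open>Hprim A\<close> from 0 to 1, the quotient in
  \<open>Hfun\<close> needs no separate treatment near \<open>A = 0\<close>.\<close>

lemma Hfun_bound:
  assumes A: "cmod A \<le> C"
  shows "cmod (Hfun A / 2) \<le> exp C"
proof -
  have "cmod (Hprim A 1 - Hprim A 0) \<le> exp C * cmod (1 - 0)"
  proof (rule field_differentiable_bound[of "cball 0 1" _ "\<lambda>s. s * exp (A * s)"])
    fix z :: complex assume "z \<in> cball 0 1"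
    then have "cmod z * cmod (exp (A * z)) \<le> 1 * exp C"
      by (intro mult_mono norm_exp_le_bound A) auto
    then show "cmod (z * exp (A * z)) \<le> exp C" by (simp add: norm_mult)
  qed (auto intro: Hprim_deriv)
  then show ?thesis by (simp add: Hprim_0 Hprim_1)
qed

text \<open>The base \<open>v\<close> is replaced by \<open>q = exp (A / N)\<close>, at distance of
  order \<open>N^-2\<close>. Powers up to \<open>N\<close> enlarge this to order \<open>1/N\<close>,
  and weights of total size \<open>N\<^sup>2\<close> leave an error of order \<open>N\<close>. The
  sum with base \<open>q\<close> is compared with \<open>N\<close> increments of
  \<open>Hprim A\<close>, each accurate to order \<open>N^-2\<close> before scaling by
  \<open>N\<^sup>2\<close>. \<open>K\<close> depends on \<open>C\<close> and \<open>D\<close> alone,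
  the source of later uniformity.\<close>

lemma weighted_geometric_sum_limit:
  fixes C D :: real
  assumes "C \<ge> 0" "D \<ge> 0"
  shows "\<exists>K\<ge>0. \<forall>N\<ge>1. \<forall>v A. cmod A \<le> C \<longrightarrow> cmod (v - 1 - A / of_nat N) \<le> D / (real N)\<^sup>2 \<longrightarrow>
    cmod ((\<Sum>k<N. of_nat (k + 1) * v ^ k) - of_nat N ^ 2 * (Hfun A / 2)) \<le> K * real N"
proof -
  \<comment> \<open>\<open>E\<close> bounds \<open>N\<^sup>2 * cmod (v - q)\<close>:
    \<open>D\<close> is assumed for \<open>v\<close>, and \<open>C\<^sup>2 * exp C\<close> is the
    second-order remainder of \<open>exp (A / N)\<close>.\<close>
  define E where "E = D + C\<^sup>2 * exp C"
  define K where "K = E * exp (C + D) + (1 + C) * exp C"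
  show ?thesis
  proof (intro exI[of _ K] conjI allI impI)
    show "K \<ge> 0" using assms by (simp add: K_def E_def)
    fix N :: nat and v A :: complex
    assume N: "1 \<le> N" and A: "cmod A \<le> C" and v: "cmod (v - 1 - A / of_nat N) \<le> D / (real N)\<^sup>2"
    define q where "q = exp (A / of_nat N)"
    define B where "B = exp ((C + D) / real N)"
    have B1: "B \<ge> 1" using assms by (simp add: B_def)
    have AN: "cmod (A / of_nat N) \<le> C / real N" using A N by (simp add: norm_divide divide_right_mono)
    have CN: "C / real N \<le> C" using assms N by (simp add: field_simps mult_left_mono[of 1 "real N" C, simplified])
    have "\<bar>Re (A / of_nat N)\<bar> \<le> C"
      using abs_Re_le_cmod[of "A / of_nat N"] AN CN by linarith
    have "cmod (q - (\<Sum>k\<le>1. (A / of_nat N) ^ k / fact k)) \<le> exp \<bar>Re (A / of_nat N)\<bar> * cmod (A / of_nat N) ^ Suc 1 / fact 1"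
      unfolding q_def by (rule Taylor_exp)
    also have "\<dots> \<le> exp C * (C / real N)\<^sup>2"
      using AN \<open>\<bar>Re (A / of_nat N)\<bar> \<le> C\<close> by (auto simp: numeral_2_eq_2[symmetric] intro!: mult_mono power_mono)
    finally have q1: "cmod (q - 1 - A / of_nat N) \<le> C\<^sup>2 * exp C / (real N)\<^sup>2"
      by (simp add: power_divide mult_ac diff_diff_eq)
    have "v - q = (v - 1 - A / of_nat N) - (q - 1 - A / of_nat N)" by simp
    then have "cmod (v - q) \<le> cmod (v - 1 - A / of_nat N) + cmod (q - 1 - A / of_nat N)"
      by (metis norm_triangle_ineq4)
    also have "\<dots> \<le> E / (real N)\<^sup>2" using v q1 by (simp add: E_def add_divide_distrib)
    finally have vq: "cmod (v - q) \<le> E / (real N)\<^sup>2" .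
    have nq: "cmod q \<le> B"
    proof -
      have "cmod q \<le> exp (cmod (A / of_nat N))" unfolding q_def by (rule norm_exp)
      also have "\<dots> \<le> B" unfolding B_def using AN assms N by (simp add: add_divide_distrib add_increasing2)
      finally show ?thesis .
    qed
    have nv: "cmod v \<le> B"
    proof -
      have "v = 1 + A / of_nat N + (v - 1 - A / of_nat N)" by simp
      then have "cmod v \<le> 1 + cmod (A / of_nat N) + cmod (v - 1 - A / of_nat N)"
        by (metis norm_triangle_le norm_triangle_ineq norm_one add_mono order_refl)
      also have "\<dots> \<le> 1 + C / real N + D / real N"
      proof -
        have "D / (real N)\<^sup>2 \<le> D / real N"
          using N assms by (intro divide_left_mono) (auto simp: power2_eq_square)
        then show ?thesis using AN v by linarith
      qed
      also have "\<dots> = 1 + (C + D) / real N" by (simp add: add_divide_distrib)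
      also have "\<dots> \<le> B" unfolding B_def by (rule exp_ge_add_one_self)
      finally show ?thesis .
    qed
    have Bk: "B ^ k \<le> exp (C + D)" if "k \<le> N" for k
    proof -
      have "B ^ k \<le> B ^ N" using B1 that by (rule power_increasing[rotated])
      also have "\<dots> = exp (C + D)" unfolding B_def using N by (simp flip: exp_of_nat_mult)
      finally show ?thesis .
    qed
    have pw: "cmod (v ^ k - q ^ k) \<le> E * exp (C + D) / real N" if "k < N" for k
    proof -
      have "cmod (v ^ k - q ^ k) \<le> real k * B ^ k * cmod (v - q)"
        by (rule norm_power_diff_le[OF nv nq B1])
      also have "\<dots> \<le> real N * exp (C + D) * (E / (real N)\<^sup>2)"
        using that Bk[of k] B1 by (intro mult_mono vq) auto
      also have "\<dots> = E * exp (C + D) / real N"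
        using N by (simp add: power2_eq_square)
      finally show ?thesis .
    qed
    have s1: "cmod ((\<Sum>k<N. of_nat (k + 1) * v ^ k) - (\<Sum>k<N. of_nat (k + 1) * q ^ k)) \<le> E * exp (C + D) * real N"
    proof -
      have "(\<Sum>k<N. of_nat (k + 1) * v ^ k) - (\<Sum>k<N. of_nat (k + 1) * q ^ k) = (\<Sum>k<N. of_nat (k + 1) * (v ^ k - q ^ k))"
        by (simp add: sum_subtractf right_diff_distrib)
      also have "cmod \<dots> \<le> (\<Sum>k<N. real N * (E * exp (C + D) / real N))"
      proof (rule sum_norm_le)
        fix k assume "k \<in> {..<N}"
        then have k: "k < N" by simp
        have "cmod (of_nat (k + 1)) \<le> real N" using k by (simp only: norm_of_nat)
        then show "cmod (of_nat (k + 1) * (v ^ k - q ^ k)) \<le> real N * (E * exp (C + D) / real N)"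
          unfolding norm_mult using pw[OF k] by (intro mult_mono) auto
      qed
      also have "\<dots> = E * exp (C + D) * real N" using N by simp
      finally show ?thesis .
    qed
    define T where "T k = Hprim A (of_real (real k / real N))" for k
    have inc: "cmod (T (Suc k) - T k - of_nat (k + 1) * q ^ k / of_nat N ^ 2) \<le> (1 + C) * exp C / (real N)\<^sup>2"
      if "k < N" for k
    proof -
      have d: "real (Suc k) / real N - real k / real N = 1 / real N" by (simp add: diff_divide_distrib[symmetric])
      have q: "exp (A * complex_of_real (real k / real N)) = q ^ k"
        by (simp add: q_def flip: exp_of_nat_mult) (simp add: mult_ac)
      have "cmod (T (Suc k) - T k - of_real (1 / real N) * (of_real (real (Suc k) / real N) * q ^ k)) \<le> (1 + C) * exp C * (1 / real N)\<^sup>2"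
        using Hprim_increment[OF A, of "real k / real N" "real (Suc k) / real N"] that
        unfolding T_def d q by (simp add: divide_right_mono)
      then show ?thesis by (simp add: power_divide power2_eq_square)
    qed
    have tel: "Hfun A / 2 = (\<Sum>k<N. T (Suc k) - T k)"
      unfolding sum_lessThan_telescope using N by (simp add: T_def Hprim_0 Hprim_1)
    have "(\<Sum>k<N. of_nat (k + 1) * q ^ k) - of_nat N ^ 2 * (Hfun A / 2) =
        - (of_nat N ^ 2 * (\<Sum>k<N. T (Suc k) - T k - of_nat (k + 1) * q ^ k / of_nat N ^ 2))"
      unfolding tel sum_subtractf right_diff_distrib sum_distrib_left using N by simp
    also have "cmod \<dots> = (real N)\<^sup>2 * cmod (\<Sum>k<N. T (Suc k) - T k - of_nat (k + 1) * q ^ k / of_nat N ^ 2)"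
      by (simp only: norm_minus_cancel norm_mult norm_power norm_of_nat)
    also have "\<dots> \<le> (real N)\<^sup>2 * (\<Sum>k<N. (1 + C) * exp C / (real N)\<^sup>2)"
      using inc by (intro mult_left_mono sum_norm_le) auto
    also have "\<dots> = (1 + C) * exp C * real N" using N by (simp add: power2_eq_square)
    finally have s2: "cmod ((\<Sum>k<N. of_nat (k + 1) * q ^ k) - of_nat N ^ 2 * (Hfun A / 2)) \<le> (1 + C) * exp C * real N" .
    have "cmod ((\<Sum>k<N. of_nat (k + 1) * v ^ k) - of_nat N ^ 2 * (Hfun A / 2)) \<le>
        E * exp (C + D) * real N + (1 + C) * exp C * real N"
      using norm_triangle_mono[OF s1 s2] by simp
    then show "cmod ((\<Sum>k<N. of_nat (k + 1) * v ^ k) - of_nat N ^ 2 * (Hfun A / 2)) \<le> K * real N"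
      by (simp add: K_def algebra_simps)
  qed
qed

lemma uniform_limit_rate:
  fixes f :: "nat \<Rightarrow> 'a \<Rightarrow> 'b::real_normed_vector"
  assumes "e \<longlonglongrightarrow> 0" "\<forall>\<^sub>F n in sequentially. \<forall>x\<in>X. norm (f n x - l x) \<le> e n"
  shows "uniform_limit X f l sequentially"
proof (rule uniform_limitI)
  fix \<epsilon> :: real assume "\<epsilon> > 0"
  then have "\<forall>\<^sub>F n in sequentially. e n < \<epsilon>" by (rule order_tendstoD(2)[OF assms(1)])
  with assms(2) show "\<forall>\<^sub>F n in sequentially. \<forall>x\<in>X. dist (f n x) (l x) < \<epsilon>"
    by eventually_elim (force simp: dist_norm)
qed

lemma weighted_sum_bound:
  assumes "\<And>k. k \<in> T \<Longrightarrow> cmod v ^ k \<le> D" "D \<ge> 0" "\<And>k. k \<in> T \<Longrightarrow> k < N"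
  shows "cmod (\<Sum>k\<in>T. of_nat (k + 1) * v ^ k) \<le> real (card T) * (real N * D)"
proof -
  have "cmod (\<Sum>k\<in>T. of_nat (k + 1) * v ^ k) \<le> (\<Sum>k\<in>T. real N * D)"
  proof (rule sum_norm_le)
    fix k assume k: "k \<in> T"
    have "real (k + 1) \<le> real N" using assms(3)[OF k] by linarith
    then show "cmod (of_nat (k + 1) * v ^ k) \<le> real N * D"
      unfolding norm_mult norm_power norm_of_nat using assms(1)[OF k] assms(2) by (intro mult_mono) auto
  qed
  then show ?thesis by simp
qed

section \<open>Error of the almost reproducing functional and choice of the cut-off\<close>

context lemniscate begin

text \<open>The error of the functional given by \<open>test_poly\<close>, per unit of
  \<open>nrm p\<close>: \<open>3 ^ m\<close> bounds \<open>w ^ j\<close>, the first summand is the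
  estimate of \<open>bip_gp_kp\<close> times the bound \<open>C / (1 - R)\<close> for
  \<open>gp\<close>, the second is the estimate of \<open>gp_truncation\<close>. \<open>C\<close>
  bounds powers of \<open>\<phi> w\<close>, since \<open>\<phi> w\<close> may lie slightly outside
  the unit disk.\<close>

definition repro_error :: "real \<Rightarrow> nat \<Rightarrow> nat \<Rightarrow> nat \<Rightarrow> real" where
  "repro_error C N M L = real m * 3 ^ m *
     (C / (1 - R) * (cf_const * ((real L)\<^sup>2 * C) * (R ^ Suc M / (1 - R)\<^sup>2)) +
      cf_const * sqrt (real N + 1) * C * (real L * (R ^ Suc M / (1 - R)) + (real N + 1 - real L) / (1 - R)))"

lemma repro_error_nonneg:
  assumes "L \<le> N" "C \<ge> 0"
  shows "repro_error C N M L \<ge> 0"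
  unfolding repro_error_def using assms R_pos R_less cf_const_nonneg
  by (intro mult_nonneg_nonneg add_nonneg_nonneg divide_nonneg_nonneg) auto

lemma test_poly_almost_reproducing:
  assumes p: "degree p \<le> n" and MLN: "M + L \<le> n div m"
    and C: "\<And>k. k \<le> n div m \<Longrightarrow> cmod (\<phi> w) ^ k \<le> C" "C \<ge> 0" and w: "cmod w \<le> 3"
  shows "cmod (ip p (test_poly M L w) - poly p w) \<le> repro_error C (n div m) M L * nrm p"
proof -
  obtain P where P: "rep P p" "\<And>j. j < m \<Longrightarrow> degree (P j) \<le> n div m"
    using rep_exists[OF p] by blast
  define y where "y = \<phi> w"
  define N where "N = n div m"
  define E1 where "E1 = cf_const * nrm p * ((real L)\<^sup>2 * C) * (R ^ Suc M / (1 - R)\<^sup>2)"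
  define E2 where "E2 = cf_const * nrm p * sqrt (real N + 1) * C * (real L * (R ^ Suc M / (1 - R)) + (real N + 1 - real L) / (1 - R))"
  define t where "t j = of_real (R\<^sup>2 / real m) * bip j (P j) (test_component M L w j) - w ^ j * poly (P j) y" for j
  have "ip p (test_poly M L w) - poly p w = (\<Sum>j<m. t j)"
    using area_ip_rep[OF P(1) rep_test_poly] P(1) unfolding rep_def
    by (simp add: t_def sum_subtractf sum_distrib_left y_def)
  also have "cmod \<dots> \<le> (\<Sum>j<m. 3 ^ m * (C / (1 - R) * E1 + E2))"
  proof (rule sum_norm_le)
    fix j assume "j \<in> {..<m}"
    then have j: "j < m" by simp
    define b where "b = bip j (P j) (gp M j * kp L y)"
    define s where "s = (\<Sum>k<L. cf j (P j) k * y ^ k)"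
    define g where "g = poly (gp M j) y"
    have "of_real (R\<^sup>2 / real m) * of_real (real m / R\<^sup>2) = (1::complex)"
      using R_pos m_pos by (simp flip: of_real_mult)
    then have "of_real (R\<^sup>2 / real m) * (of_real (real m / R\<^sup>2) * (w ^ j * g) * b) = w ^ j * g * b"
      by (simp only: mult.assoc[symmetric] mult_1)
    then have "t j = w ^ j * (g * b) - w ^ j * poly (P j) y"
      unfolding t_def test_component_def bip_smult_right[OF j] y_def[symmetric] b_def[symmetric] g_def
      by (simp add: mult.assoc)
    \<comment> \<open>The partial sum \<open>s\<close> is inserted: \<open>b - s\<close> is the
      error of pairing with the truncated kernel, and \<open>g * s\<close> differs from the value of
      \<open>P j\<close> by the error of undoing the weight.\<close>
    also have "\<dots> = w ^ j * (g * (b - s) + (g * s - poly (P j) y))"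
      by (simp add: algebra_simps)
    finally have t: "t j = w ^ j * (g * (b - s) + (g * s - poly (P j) y))" .
    have nw: "cmod (w ^ j) \<le> 3 ^ m"
    proof -
      have "cmod w ^ j \<le> 3 ^ j" using w by (intro power_mono) auto
      also have "\<dots> \<le> 3 ^ m" using j by (intro power_increasing) auto
      finally show ?thesis by (simp add: norm_power)
    qed
    have ng: "cmod g \<le> C / (1 - R)"
      unfolding g_def y_def using MLN by (intro norm_poly_gp_le[OF j] C) auto
    have nb: "cmod (b - s) \<le> E1"
      unfolding b_def s_def E1_def using MLN by (intro bip_gp_kp[OF j P(1)]) (auto simp: y_def intro!: C)
    have ns: "cmod (g * s - poly (P j) y) \<le> E2"
      unfolding g_def s_def E2_def N_def using MLN C P(2)[OF j] by (intro gp_truncation[OF j P(1)]) (auto simp: y_def)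
    have "cmod (g * (b - s) + (g * s - poly (P j) y)) \<le> C / (1 - R) * E1 + E2"
      using norm_triangle_ineq[of "g * (b - s)" "g * s - poly (P j) y"] ns
        mult_mono[OF ng nb] C R_less by (simp add: norm_mult)
    then show "cmod (t j) \<le> 3 ^ m * (C / (1 - R) * E1 + E2)"
      unfolding t norm_mult[of "w ^ j"] using nw by (intro mult_mono) auto
  qed
  also have "\<dots> = repro_error C (n div m) M L * nrm p"
    by (simp add: repro_error_def E1_def E2_def N_def algebra_simps)
  finally show ?thesis .
qed

text \<open>Normalised as the base of a square, since the comparison of kernels asks for a diagonal
  bound \<open>B\<^sup>2\<close>, here with \<open>B\<close> of order \<open>L\<close>; hence
  \<open>sqrt pi * R\<close> in place of \<open>pi * R\<^sup>2\<close>.\<close>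

definition diag_const :: "real \<Rightarrow> real" where
  "diag_const C = real m / (sqrt pi * R) * (3 ^ m * (C / (1 - R))) * C"

lemma test_poly_diagonal_bound:
  assumes MLN: "M + L \<le> N" and C: "\<And>k. k \<le> N \<Longrightarrow> cmod (\<phi> z) ^ k \<le> C" "C \<ge> 0" and z: "cmod z \<le> 3"
  shows "cmod (poly (test_poly M L z) z) \<le> (diag_const C * real L)\<^sup>2"
proof -
  define G where "G = 3 ^ m * (C / (1 - R))"
  have G0: "G \<ge> 0" using C R_less by (simp add: G_def)
  have "cmod (\<Sum>j<m. z ^ j * poly (gp M j) (\<phi> z) * cnj (z ^ j * poly (gp M j) (\<phi> z))) \<le> (\<Sum>j<m. G * G)"
  proof (rule sum_norm_le)
    fix j assume "j \<in> {..<m}"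
    then have j: "j < m" by simp
    have "cmod z ^ j \<le> 3 ^ j" using z by (intro power_mono) auto
    also have "\<dots> \<le> 3 ^ m" using j by (intro power_increasing) auto
    finally have "cmod (z ^ j * poly (gp M j) (\<phi> z)) \<le> G"
      unfolding G_def norm_mult norm_power using MLN by (intro mult_mono norm_poly_gp_le[OF j] C) auto
    then show "cmod (z ^ j * poly (gp M j) (\<phi> z) * cnj (z ^ j * poly (gp M j) (\<phi> z))) \<le> G * G"
      unfolding norm_mult[of "z ^ j * poly (gp M j) (\<phi> z)"] complex_mod_cnj using G0 by (intro mult_mono) auto
  qed
  then have 1: "cmod (\<Sum>j<m. z ^ j * poly (gp M j) (\<phi> z) * cnj (z ^ j * poly (gp M j) (\<phi> z))) \<le> real m * (G * G)"
    by simp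
  have 2: "cmod (\<Sum>k<L. of_nat (k + 1) * (\<phi> z * cnj (\<phi> z)) ^ k) \<le> real (card {..<L}) * (real L * (C * C))"
    using C MLN by (intro weighted_sum_bound) (auto simp: norm_mult power_mult_distrib intro!: mult_mono)
  have "cmod (poly (test_poly M L z) z) \<le> (real m / (pi * R\<^sup>2)) * (real m * (G * G)) * (real L * (real L * (C * C)))"
    unfolding poly_test_poly norm_mult
    using 1 2 R_pos G0 by (intro mult_mono) (auto simp: norm_mult norm_divide norm_power)
  also have "\<dots> = (diag_const C * real L)\<^sup>2"
    by (simp add: diag_const_def G_def power_mult_distrib power_divide) (simp add: power2_eq_square mult_ac)
  finally show ?thesis .
qed

lemma CD_kernel_test_poly:
  assumes MLN: "M + L \<le> n div m" and L: "L > 0"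
    and C: "\<And>k. k \<le> n div m \<Longrightarrow> cmod (\<phi> z) ^ k \<le> C" "\<And>k. k \<le> n div m \<Longrightarrow> cmod (\<phi> w) ^ k \<le> C" "C \<ge> 0"
    and zw: "cmod z \<le> 3" "cmod w \<le> 3"
  shows "cmod (CD_kernel (Grm r m) n z w - poly (test_poly M L w) z) \<le>
     repro_error C (n div m) M L * (diag_const C * real L + 2 * repro_error C (n div m) M L)"
proof (rule CD_kernel_approx)
  show "degree (test_poly M L w) \<le> n" "degree (test_poly M L z) \<le> n"
    using degree_test_poly[OF MLN L] by auto
  show "cmod (ip p (test_poly M L w) - poly p w) \<le> repro_error C (n div m) M L * nrm p" if "degree p \<le> n" for p
    by (rule test_poly_almost_reproducing[OF that MLN C(2,3) zw(2)])
  show "cmod (ip p (test_poly M L z) - poly p z) \<le> repro_error C (n div m) M L * nrm p" if "degree p \<le> n" for p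
    by (rule test_poly_almost_reproducing[OF that MLN C(1,3) zw(1)])
  show "cmod (poly (test_poly M L z) z) \<le> (diag_const C * real L)\<^sup>2"
    by (rule test_poly_diagonal_bound[OF MLN C(1,3) zw(1)])
  show "diag_const C * real L \<ge> 0"
    using C(3) R_pos R_less by (simp add: diag_const_def)
  show "repro_error C (n div m) M L \<ge> 0"
    using MLN C(3) by (intro repro_error_nonneg) auto
qed

text \<open>
  Any cut-off that is \<open>o(sqrt n)\<close> and grows faster than \<open>log n\<close> makes \<open>repro_error\<close> of order \<open>o(n)\<close>.
\<close>

definition Mcut :: "nat \<Rightarrow> nat" where "Mcut n = nat \<lfloor>real n powr (1/4)\<rfloor>"
definition Lcut :: "nat \<Rightarrow> nat" where "Lcut n = n div m - Mcut n"

lemma Mcut_le: "real (Mcut n) \<le> real n powr (1/4)"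
  unfolding Mcut_def by (simp add: of_nat_nat)

lemma R_power_Mcut: "R ^ Suc (Mcut n) \<le> R powr (real n powr (1/4))"
proof -
  have "real n powr (1/4) \<le> real (Suc (Mcut n))" unfolding Mcut_def by linarith
  then have "R powr real (Suc (Mcut n)) \<le> R powr (real n powr (1/4))"
    using R_pos R_less by (intro powr_mono') auto
  then show ?thesis using R_pos by (simp only: powr_realpow)
qed

lemma R_powr_limit: "(\<lambda>n. real n * R powr (real n powr (1/4))) \<longlonglongrightarrow> 0"
proof -
  define c where "c = - ln R"
  have c: "c > 0" using R_pos R_less by (simp add: c_def)
  have "(\<lambda>n. real n * exp (- (c * real n powr (1/4)))) \<longlonglongrightarrow> 0"
    using c by real_asymp
  then show ?thesis using R_pos by (simp add: powr_def c_def mult_ac)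
qed

lemma R_power_Mcut_limit: "(\<lambda>n. real n * R ^ Suc (Mcut n)) \<longlonglongrightarrow> 0"
  by (rule Lim_null_comparison[OF _ R_powr_limit])
     (use R_pos R_power_Mcut in \<open>auto intro!: always_eventually mult_left_mono simp del: power_Suc\<close>)

lemma Mcut_limit: "(\<lambda>n. real (Mcut n) / real n) \<longlonglongrightarrow> 0"
proof (rule Lim_null_comparison)
  show "\<forall>\<^sub>F n in sequentially. norm (real (Mcut n) / real n) \<le> real n powr (1/4) / real n"
    using Mcut_le by (intro always_eventually allI) (simp add: divide_right_mono)
  show "(\<lambda>n. real n powr (1/4) / real n) \<longlonglongrightarrow> 0" by real_asymp
qed

lemma Mcut_less: "\<forall>\<^sub>F n in sequentially. Mcut n < n div m"
proof -
  have "\<forall>\<^sub>F n in sequentially. real n powr (1/4) + 1 < real n / real m"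
    using m_pos by real_asymp
  then show ?thesis
  proof eventually_elim
    case (elim n)
    have "real n / real m < real (n div m) + 1"
      using floor_divide_of_nat_eq[of n m, where ?'a = real] by linarith
    then have "real (Mcut n) < real (n div m)" using elim Mcut_le[of n] by linarith
    then show ?case by simp
  qed
qed

text \<open>\<open>f1\<close> and \<open>f2\<close> contain \<open>R ^ Suc (Mcut n)\<close>, which
  beats every power of \<open>n\<close>. In \<open>f3\<close> the \<open>Mcut n + 1\<close>
  coefficients lost at the top, each weighted by \<open>sqrt n\<close>, leave the order
  \<open>n powr (-1/4)\<close>; here the cut-off has to be small.\<close>

lemma repro_error_limit: "(\<lambda>n. repro_error C (n div m) (Mcut n) (Lcut n) / real n) \<longlonglongrightarrow> 0"
proof -
  define c1 where "c1 = real m * 3 ^ m * (C / (1 - R) * cf_const * C / (1 - R)\<^sup>2)"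
  define c2 where "c2 = real m * 3 ^ m * (cf_const * C / (1 - R))"
  define f1 where "f1 n = (real (Lcut n))\<^sup>2 * R ^ Suc (Mcut n) / real n" for n
  define f2 where "f2 n = sqrt (real (n div m) + 1) * (real (Lcut n) * R ^ Suc (Mcut n)) / real n" for n
  define f3 where "f3 n = sqrt (real (n div m) + 1) * (real (n div m) + 1 - real (Lcut n)) / real n" for n
  have eq: "repro_error C (n div m) (Mcut n) (Lcut n) / real n = c1 * f1 n + c2 * (f2 n + f3 n)" for n
    unfolding repro_error_def c1_def c2_def f1_def f2_def f3_def
    by (simp add: divide_inverse algebra_simps del: power_Suc)
  have L: "real (Lcut n) \<le> real n" and N: "real (n div m) \<le> real n" for n
    by (auto simp: Lcut_def intro: le_trans[OF diff_le_self])
  have "f1 \<longlonglongrightarrow> 0"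
  proof (rule Lim_null_comparison[OF _ R_power_Mcut_limit], intro always_eventually allI)
    fix n
    have "(real (Lcut n))\<^sup>2 * R ^ Suc (Mcut n) / real n \<le> (real n)\<^sup>2 * R ^ Suc (Mcut n) / real n"
      using L R_pos by (intro divide_right_mono mult_right_mono power_mono) auto
    then show "norm (f1 n) \<le> real n * R ^ Suc (Mcut n)"
      using R_pos by (cases "n = 0") (simp_all add: f1_def power2_eq_square del: power_Suc)
  qed
  moreover have "f2 \<longlonglongrightarrow> 0"
  proof (rule Lim_null_comparison)
    have "(\<lambda>n. sqrt (real n + 1) / real n * (real n * R ^ Suc (Mcut n))) \<longlonglongrightarrow> 0 * 0"
      by (intro tendsto_mult R_power_Mcut_limit) real_asymp
    then show "(\<lambda>n. sqrt (real n + 1) / real n * (real n * R ^ Suc (Mcut n))) \<longlonglongrightarrow> 0" by simp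
    show "\<forall>\<^sub>F n in sequentially. norm (f2 n) \<le> sqrt (real n + 1) / real n * (real n * R ^ Suc (Mcut n))"
    proof (intro always_eventually allI)
      fix n
      have "sqrt (real (n div m) + 1) * (real (Lcut n) * R ^ Suc (Mcut n)) / real n \<le>
          sqrt (real n + 1) * (real n * R ^ Suc (Mcut n)) / real n"
        using L N R_pos by (intro divide_right_mono mult_mono) auto
      then show "norm (f2 n) \<le> sqrt (real n + 1) / real n * (real n * R ^ Suc (Mcut n))"
        using R_pos by (simp add: f2_def del: power_Suc)
    qed
  qed
  moreover have "f3 \<longlonglongrightarrow> 0"
  proof (rule Lim_null_comparison)
    show "(\<lambda>n. sqrt (real n + 1) * (real n powr (1/4) + 1) / real n) \<longlonglongrightarrow> 0" by real_asymp
    show "\<forall>\<^sub>F n in sequentially. norm (f3 n) \<le> sqrt (real n + 1) * (real n powr (1/4) + 1) / real n"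
      using Mcut_less
    proof eventually_elim
      case (elim n)
      then have eq: "real (n div m) + 1 - real (Lcut n) = real (Mcut n) + 1" by (simp add: Lcut_def)
      have "sqrt (real (n div m) + 1) * (real (Mcut n) + 1) / real n \<le>
          sqrt (real n + 1) * (real n powr (1/4) + 1) / real n"
        using N Mcut_le by (intro divide_right_mono mult_mono) auto
      then show ?case unfolding f3_def eq by simp
    qed
  qed
  ultimately have "(\<lambda>n. c1 * f1 n + c2 * (f2 n + f3 n)) \<longlonglongrightarrow> c1 * 0 + c2 * (0 + 0)"
    by (intro tendsto_intros)
  then show ?thesis unfolding eq by simp
qed

end

section \<open>Location of the boundary and local expansion of \<open>\<phi>\<close>\<close>

context lemniscate begin

text \<open>Here \<open>z ^ m\<close> lies on the circle of radius \<open>R < 1\<close> around 1.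
  The bound 2 leaves room for a shift of size 1, whence the 3 in the estimates;
  \<open>z \<noteq> 0\<close> is used to combine real powers of \<open>cmod z\<close>.\<close>

lemma frontier_Grm_bounds:
  assumes "cmod (\<phi> z) = 1"
  shows "cmod z \<le> 2" "z \<noteq> 0"
proof -
  have zm: "z ^ m = 1 + of_real R * \<phi> z" using R_pos by (simp add: \<phi>_def)
  have "cmod (z ^ m) \<le> 1 + cmod (of_real R * \<phi> z)"
    unfolding zm by (metis norm_triangle_ineq norm_one)
  also have "\<dots> < 2" using assms R_pos R_less by (simp add: norm_mult)
  finally have less: "cmod z ^ m < 2" by (simp add: norm_power)
  show "cmod z \<le> 2"
  proof (rule ccontr)
    assume "\<not> cmod z \<le> 2"
    then have "cmod z \<le> cmod z ^ m" using m_pos by (intro self_le_power) auto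
    then show False using less \<open>\<not> cmod z \<le> 2\<close> by simp
  qed
  show "z \<noteq> 0"
  proof
    assume "z = 0"
    then have "of_real R * \<phi> z = - 1" using zm m_pos by (simp add: power_0_left eq_neg_iff_add_eq_0 add.commute)
    then have "cmod (of_real R * \<phi> z) = 1" by simp
    then show False using assms R_pos R_less by (simp add: norm_mult)
  qed
qed

lemma frontier_Grm_subset: "frontier (Grm r m) \<subseteq> {z. cmod (\<phi> z) = 1}"
proof -
  have c: "continuous_on UNIV (\<lambda>z. cmod (\<phi> z))"
    unfolding \<phi>_def using R_pos by (intro continuous_intros) auto
  have "closed {z. cmod (\<phi> z) \<le> 1}"
    using c by (intro closed_Collect_le) auto
  then have "closure (Grm r m) \<subseteq> {z. cmod (\<phi> z) \<le> 1}"
    by (intro closure_minimal) (auto simp: Grm_eq)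
  then show ?thesis
    using S_open by (auto simp: frontier_def interior_open Grm_eq)
qed

lemma \<phi>_lipschitz:
  assumes "cmod z \<le> 3" "cmod w \<le> 3"
  shows "cmod (\<phi> z - \<phi> w) \<le> real m * 3 ^ m / R * cmod (z - w)"
proof -
  have "\<phi> z - \<phi> w = (z ^ m - w ^ m) / of_real R" by (simp add: \<phi>_def diff_divide_distrib)
  then have "cmod (\<phi> z - \<phi> w) = cmod (z ^ m - w ^ m) / R" using R_pos by (simp add: norm_divide)
  also have "\<dots> \<le> (real m * 3 ^ m * cmod (z - w)) / R"
    using R_pos assms by (intro divide_right_mono norm_power_diff_le) auto
  finally show ?thesis by simp
qed

lemma \<phi>_expansion:
  assumes "cmod z \<le> 3" "cmod (z + h) \<le> 3"
  shows "cmod (\<phi> (z + h) - \<phi> z - of_nat m * z ^ (m - 1) * h / of_real R) \<le>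
    real m * real m * 3 ^ m / R * (cmod h)\<^sup>2"
proof (cases "h = 0")
  case False
  have "\<phi> (z + h) - \<phi> z - of_nat m * z ^ (m - 1) * h / of_real R =
      (((z + h) ^ m - z ^ m) / h - of_nat m * z ^ (m - Suc 0)) * h / of_real R"
    using False R_pos by (simp add: \<phi>_def field_simps)
  also have "cmod \<dots> = cmod (((z + h) ^ m - z ^ m) / h - of_nat m * z ^ (m - Suc 0)) * cmod h / R"
    using R_pos by (simp add: norm_mult norm_divide)
  also have "\<dots> \<le> (real m * real (m - Suc 0) * 3 ^ (m - 2) * cmod h) * cmod h / R"
    using R_pos assms False by (intro divide_right_mono mult_right_mono lemma_termdiff3) auto
  also have "\<dots> \<le> (real m * real m * 3 ^ m * cmod h) * cmod h / R"
    using R_pos by (intro divide_right_mono mult_right_mono mult_mono power_increasing) auto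
  finally show ?thesis by (simp add: power2_eq_square)
qed simp

end

section \<open>Scaling limit at the boundary\<close>

text \<open>Uniformity is carried by an arbitrary index set \<open>X\<close>: an index stands for a
  choice of boundary point and, later, of both shifts, so every limit is a uniform limit over one
  set.\<close>

locale lemniscate_family = lemniscate +
  fixes X :: "'i set" and A0 :: real and zf :: "'i \<Rightarrow> complex"
  assumes A0: "A0 \<ge> 0" and zf: "\<And>i. i \<in> X \<Longrightarrow> cmod (\<phi> (zf i)) = 1"
begin

text \<open>Under a shift of size at most \<open>A0 / n\<close>, \<open>D2 / n\<close> bounds the
  variation of \<open>\<phi>\<close> and \<open>D1 / n\<^sup>2\<close> its second-order error;
  \<open>CC\<close> bounds the powers of \<open>1 + D2 / n\<close> up to exponent
  \<open>n\<close>.\<close>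

definition D1 :: real where "D1 = real m * real m * 3 ^ m / R * A0\<^sup>2"
definition D2 :: real where "D2 = real m * 3 ^ m / R * A0"
definition CC :: real where "CC = exp D2"

lemma D1_nonneg: "D1 \<ge> 0" and D2_nonneg: "D2 \<ge> 0" and CC_ge: "CC \<ge> 1"
  using A0 R_pos by (auto simp: D1_def D2_def CC_def)

context
  fixes n :: nat and i :: 'i and a :: complex
  assumes n: "n \<ge> 1" "real n \<ge> A0" and i: "i \<in> X" and a: "cmod a \<le> A0"
begin

lemma shift_bounds:
  "cmod (zf i) \<le> 3" "cmod (zf i + a / of_nat n) \<le> 3" "cmod (a / of_nat n) \<le> A0 / real n"
proof -
  have z: "cmod (zf i) \<le> 2" using frontier_Grm_bounds zf[OF i] by auto
  then show "cmod (zf i) \<le> 3" by simp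
  show *: "cmod (a / of_nat n) \<le> A0 / real n"
    using a n by (simp add: norm_divide divide_right_mono)
  have "A0 / real n \<le> 1" using n by simp
  then show "cmod (zf i + a / of_nat n) \<le> 3"
    using norm_triangle_ineq[of "zf i" "a / of_nat n"] z * by linarith
qed

lemma shift_\<phi>_diff: "cmod (\<phi> (zf i + a / of_nat n) - \<phi> (zf i)) \<le> D2 / real n"
proof -
  have "cmod (\<phi> (zf i + a / of_nat n) - \<phi> (zf i)) \<le> real m * 3 ^ m / R * cmod (a / of_nat n)"
    using \<phi>_lipschitz[OF shift_bounds(2,1)] by simp
  also have "\<dots> \<le> real m * 3 ^ m / R * (A0 / real n)"
    using R_pos by (intro mult_left_mono shift_bounds) auto
  finally show ?thesis by (simp add: D2_def)
qed

lemma shift_\<phi>_bound: "cmod (\<phi> (zf i + a / of_nat n)) \<le> 1 + D2 / real n"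
  using shift_\<phi>_diff zf[OF i] norm_triangle_sub[of "\<phi> (zf i + a / of_nat n)" "\<phi> (zf i)"] by linarith

lemma base_power_bound: "k \<le> n \<Longrightarrow> (1 + D2 / real n) ^ k \<le> CC"
proof -
  assume "k \<le> n"
  then have "(1 + D2 / real n) ^ k \<le> (1 + D2 / real n) ^ n"
    using D2_nonneg by (intro power_increasing) auto
  also have "\<dots> \<le> exp (D2 / real n) ^ n"
    using D2_nonneg by (intro power_mono exp_ge_add_one_self) auto
  also have "\<dots> = CC" using n by (simp add: CC_def flip: exp_of_nat_mult)
  finally show ?thesis .
qed

lemma shift_power_bound: "k \<le> n \<Longrightarrow> cmod (\<phi> (zf i + a / of_nat n)) ^ k \<le> CC"
  using power_mono[OF shift_\<phi>_bound norm_ge_zero, of k] base_power_bound[of k] by linarith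

lemma shift_\<phi>_expansion:
  "cmod (\<phi> (zf i + a / of_nat n) - \<phi> (zf i) - of_nat m * zf i ^ (m - 1) * (a / of_nat n) / of_real R) \<le> D1 / (real n)\<^sup>2"
proof -
  have "cmod (\<phi> (zf i + a / of_nat n) - \<phi> (zf i) - of_nat m * zf i ^ (m - 1) * (a / of_nat n) / of_real R) \<le>
      real m * real m * 3 ^ m / R * (cmod (a / of_nat n))\<^sup>2"
    by (rule \<phi>_expansion[OF shift_bounds(1,2)])
  also have "\<dots> \<le> real m * real m * 3 ^ m / R * (A0 / real n)\<^sup>2"
    using R_pos by (intro mult_left_mono power_mono shift_bounds) auto
  finally show ?thesis by (simp add: D1_def power_divide)
qed

text \<open>Two errors add up. Moving the argument back to the boundary point costs differences of
  powers weighted by \<open>R ^ t\<close>, whose sum is bounded independently of \<open>M\<close>;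
  cutting the binomial series at \<open>M\<close> costs a geometric tail on the unit circle.\<close>

lemma shift_gp:
  assumes j: "j < m" and M: "M \<le> n"
  shows "cmod (poly (gp M j) (\<phi> (zf i + a / of_nat n)) - (1 + of_real R * \<phi> (zf i)) powr of_real (\<beta> j))
     \<le> CC * D2 / (1 - R)\<^sup>2 / real n + R ^ Suc M / (1 - R)"
proof -
  define x where "x = \<phi> (zf i + a / of_nat n)"
  define y where "y = \<phi> (zf i)"
  have y: "cmod y = 1" using zf[OF i] by (simp add: y_def)
  have "cmod (poly (gp M j) x - poly (gp M j) y) \<le> CC * D2 / (1 - R)\<^sup>2 / real n"
  proof -
    have "cmod (poly (gp M j) x - poly (gp M j) y) = cmod (\<Sum>t\<le>M. gc j t * (x ^ t - y ^ t))"
      by (simp add: poly_gp right_diff_distrib sum_subtractf)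
    also have "\<dots> \<le> (\<Sum>t\<le>M. R ^ t * (real (Suc t) * CC * (D2 / real n)))"
    proof (rule sum_norm_le)
      fix t assume "t \<in> {..M}"
      then have t: "t \<le> n" using M by simp
      have "cmod (x ^ t - y ^ t) \<le> real t * (1 + D2 / real n) ^ t * cmod (x - y)"
        using y D2_nonneg shift_\<phi>_bound by (intro norm_power_diff_le) (auto simp: x_def)
      \<comment> \<open>\<open>t\<close> is enlarged to \<open>Suc t\<close> so that the sum becomes
        the derivative of the geometric series.\<close>
      also have "\<dots> \<le> real (Suc t) * CC * (D2 / real n)"
        using shift_\<phi>_diff base_power_bound[OF t] D2_nonneg CC_ge unfolding x_def y_def by (intro mult_mono) auto
      finally show "cmod (gc j t * (x ^ t - y ^ t)) \<le> R ^ t * (real (Suc t) * CC * (D2 / real n))"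
        unfolding norm_mult using R_pos by (intro mult_mono norm_gc j) auto
    qed
    also have "\<dots> = (\<Sum>t\<le>M. real (Suc t) * R ^ t) * (CC * D2 / real n)"
      unfolding sum_distrib_right by (intro sum.cong) auto
    also have "\<dots> \<le> (1 / (1 - R)\<^sup>2) * (CC * D2 / real n)"
    proof (intro mult_right_mono)
      have s: "(\<lambda>t. real (Suc t) * R ^ t) sums (1 / (1 - R)\<^sup>2)"
        using geometric_deriv_sums[of R] R_pos R_less by simp
      have "(\<Sum>t\<le>M. real (Suc t) * R ^ t) \<le> (\<Sum>t. real (Suc t) * R ^ t)"
        using R_pos by (intro sum_le_suminf sums_summable[OF s]) auto
      then show "(\<Sum>t\<le>M. real (Suc t) * R ^ t) \<le> 1 / (1 - R)\<^sup>2"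
        using s by (simp only: sums_iff)
    qed (use CC_ge D2_nonneg in auto)
    finally show ?thesis by (simp add: mult_ac)
  qed
  moreover have "cmod (poly (gp M j) y - (1 + of_real R * y) powr of_real (\<beta> j)) \<le> R ^ Suc M / (1 - R)"
  proof -
    define d where "d t = gc j t * y ^ t - (if t \<in> {..M} then gc j t * y ^ t else 0)" for t
    have d: "d sums ((1 + of_real R * y) powr of_real (\<beta> j) - poly (gp M j) y)"
      unfolding d_def poly_gp using y R_less by (intro sums_diff gc_sums sums_If_finite_set) auto
    have nd: "cmod (d t) \<le> (if t \<le> M then 0 else R ^ t)" for t
      using norm_gc[OF j] y by (simp add: d_def norm_mult norm_power)
    have "cmod (suminf d) \<le> (\<Sum>t. if t \<le> M then 0 else R ^ t)"
      by (rule norm_suminf_le[OF nd sums_summable[OF geometric_tail]])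
    then show ?thesis
      using d geometric_tail[of M] by (simp add: sums_iff norm_minus_commute)
  qed
  ultimately show ?thesis
    unfolding x_def[symmetric] y_def[symmetric]
    using norm_triangle_ineq[of "poly (gp M j) x - poly (gp M j) y" "poly (gp M j) y - (1 + of_real R * y) powr of_real (\<beta> j)"]
    by simp
qed

end

lemma eventually_admissible: "\<forall>\<^sub>F n in sequentially. n \<ge> 1 \<and> real n \<ge> A0 \<and> Mcut n < n div m"
proof -
  have "\<forall>\<^sub>F n in sequentially. real n \<ge> A0"
    using filterlim_real_sequentially by (auto simp: filterlim_at_top)
  with eventually_ge_at_top[of "1::nat"] Mcut_less show ?thesis by eventually_elim auto
qed

lemma gp_shift_limit:
  assumes j: "j < m" and af: "\<And>i. i \<in> X \<Longrightarrow> cmod (af i) \<le> A0"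
  shows "uniform_limit X (\<lambda>n i. (zf i + af i / of_nat n) ^ j * poly (gp (Mcut n) j) (\<phi> (zf i + af i / of_nat n)))
     (\<lambda>i. zf i ^ j * (1 + of_real R * \<phi> (zf i)) powr of_real (\<beta> j)) sequentially"
proof (rule uniform_lim_mult)
  show "uniform_limit X (\<lambda>n i. (zf i + af i / of_nat n) ^ j) (\<lambda>i. zf i ^ j) sequentially"
  proof (rule uniform_limit_rate)
    show "(\<lambda>n. real j * 3 ^ j * (A0 / real n)) \<longlonglongrightarrow> 0" by real_asymp
    show "\<forall>\<^sub>F n in sequentially. \<forall>i\<in>X. cmod ((zf i + af i / of_nat n) ^ j - zf i ^ j) \<le> real j * 3 ^ j * (A0 / real n)"
      using eventually_admissible
    proof eventually_elim
      case (elim n)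
      show ?case
      proof
        fix i assume i: "i \<in> X"
        note b = shift_bounds[OF _ _ i af[OF i], of n]
        have "cmod ((zf i + af i / of_nat n) ^ j - zf i ^ j) \<le> real j * 3 ^ j * cmod ((zf i + af i / of_nat n) - zf i)"
          using b elim by (intro norm_power_diff_le) auto
        also have "\<dots> \<le> real j * 3 ^ j * (A0 / real n)"
          using b elim by (intro mult_left_mono) auto
        finally show "cmod ((zf i + af i / of_nat n) ^ j - zf i ^ j) \<le> real j * 3 ^ j * (A0 / real n)" .
      qed
    qed
  qed
  show "uniform_limit X (\<lambda>n i. poly (gp (Mcut n) j) (\<phi> (zf i + af i / of_nat n)))
     (\<lambda>i. (1 + of_real R * \<phi> (zf i)) powr of_real (\<beta> j)) sequentially"
  proof (rule uniform_limit_rate)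
    have "(\<lambda>n. real n * R ^ Suc (Mcut n) * (1 / real n)) \<longlonglongrightarrow> 0 * 0"
      by (intro tendsto_mult R_power_Mcut_limit) real_asymp
    moreover have "\<forall>\<^sub>F n in sequentially. real n * R ^ Suc (Mcut n) * (1 / real n) = R ^ Suc (Mcut n)"
      using eventually_gt_at_top[of 0] by eventually_elim simp
    ultimately have "(\<lambda>n. R ^ Suc (Mcut n)) \<longlonglongrightarrow> 0"
      by (simp add: tendsto_cong del: power_Suc)
    then have "(\<lambda>n. R ^ Suc (Mcut n) / (1 - R)) \<longlonglongrightarrow> 0 / (1 - R)"
      using R_less by (intro tendsto_divide tendsto_const) auto
    moreover have "(\<lambda>n. CC * D2 / (1 - R)\<^sup>2 / real n) \<longlonglongrightarrow> 0" by real_asymp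
    ultimately have "(\<lambda>n. CC * D2 / (1 - R)\<^sup>2 / real n + R ^ Suc (Mcut n) / (1 - R)) \<longlonglongrightarrow> 0 + 0 / (1 - R)"
      by (rule tendsto_add[rotated])
    then show "(\<lambda>n. CC * D2 / (1 - R)\<^sup>2 / real n + R ^ Suc (Mcut n) / (1 - R)) \<longlonglongrightarrow> 0" by simp
    show "\<forall>\<^sub>F n in sequentially. \<forall>i\<in>X. cmod (poly (gp (Mcut n) j) (\<phi> (zf i + af i / of_nat n)) -
        (1 + of_real R * \<phi> (zf i)) powr of_real (\<beta> j)) \<le> CC * D2 / (1 - R)\<^sup>2 / real n + R ^ Suc (Mcut n) / (1 - R)"
      using eventually_admissible
    proof eventually_elim
      case (elim n)
      have "Mcut n \<le> n" using elim div_le_dividend[of n m] by linarith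
      then show ?case using elim shift_gp[OF _ _ _ af j] by blast
    qed
  qed
  show "bounded ((\<lambda>i. zf i ^ j) ` X)"
    unfolding bounded_iff
  proof (intro exI ballI)
    fix u assume "u \<in> (\<lambda>i. zf i ^ j) ` X"
    then show "cmod u \<le> 2 ^ j" using frontier_Grm_bounds(1) zf by (auto simp: norm_power intro!: power_mono)
  qed
  show "bounded ((\<lambda>i. (1 + of_real R * \<phi> (zf i)) powr of_real (\<beta> j)) ` X)"
    unfolding bounded_iff
  proof (intro exI ballI)
    fix u assume "u \<in> (\<lambda>i. (1 + of_real R * \<phi> (zf i)) powr of_real (\<beta> j)) ` X"
    then obtain i where i: "i \<in> X" "u = (1 + of_real R * \<phi> (zf i)) powr of_real (\<beta> j)" by auto
    have "1 + of_real R * \<phi> (zf i) = zf i ^ m" using R_pos by (simp add: \<phi>_def)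
    then have "cmod u = (cmod (zf i) ^ m) powr \<beta> j"
      using i by (simp add: norm_powr_real_powr' norm_power)
    also have "\<dots> \<le> (2 ^ m) powr \<beta> j"
      using frontier_Grm_bounds(1)[OF zf[OF i(1)]] \<beta>_bounds[OF j] by (intro powr_mono2 power_mono) auto
    finally show "cmod u \<le> (2 ^ m) powr \<beta> j" .
  qed
qed

text \<open>Since \<open>1 + R \<phi>\<close> is the \<open>m\<close>-th power of the point, the
  modulus is \<open>cmod (zf i)\<close> to the exponent \<open>j + m * \<beta> j = m - 1\<close>.
  This is the same for all residues \<open>j\<close>, so each contributes equally to the
  limit.\<close>

lemma gp_limit_norm:
  assumes j: "j < m" and i: "i \<in> X"
  shows "(zf i ^ j * (1 + of_real R * \<phi> (zf i)) powr of_real (\<beta> j)) *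
     cnj (zf i ^ j * (1 + of_real R * \<phi> (zf i)) powr of_real (\<beta> j)) = of_real (cmod (zf i) ^ (2 * m - 2))"
proof -
  define z where "z = zf i"
  have z: "cmod z > 0" using frontier_Grm_bounds(2)[OF zf[OF i]] by (simp add: z_def)
  have "1 + of_real R * \<phi> z = z ^ m" using R_pos by (simp add: \<phi>_def)
  then have "cmod (z ^ j * (1 + of_real R * \<phi> z) powr of_real (\<beta> j)) = cmod z ^ j * (cmod z ^ m) powr \<beta> j"
    by (simp add: norm_mult norm_powr_real_powr' norm_power)
  also have "\<dots> = cmod z powr real j * cmod z powr (real m * \<beta> j)"
    using z by (simp add: powr_powr flip: powr_realpow)
  also have "\<dots> = cmod z powr (real j + real m * \<beta> j)"
    by (rule powr_add[symmetric])
  also have "real j + real m * \<beta> j = real (m - 1)"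
    using m_pos by (simp add: \<beta>_def field_simps of_nat_diff)
  also have "cmod z powr real (m - 1) = cmod z ^ (m - 1)"
    using z by (rule powr_realpow)
  finally have n: "cmod (z ^ j * (1 + of_real R * \<phi> z) powr of_real (\<beta> j)) = cmod z ^ (m - 1)" .
  have "(cmod z ^ (m - 1))\<^sup>2 = cmod z ^ (2 * m - 2)"
    by (simp add: right_diff_distrib' mult.commute flip: power_mult)
  then show ?thesis
    unfolding z_def[symmetric] complex_norm_square[symmetric] n by simp
qed

end

lemma uniform_limit_sum:
  fixes f :: "'j \<Rightarrow> 'n \<Rightarrow> 'a \<Rightarrow> 'b::real_normed_vector"
  assumes "\<And>j. j \<in> I \<Longrightarrow> uniform_limit X (f j) (l j) F"
  shows "uniform_limit X (\<lambda>n x. \<Sum>j\<in>I. f j n x) (\<lambda>x. \<Sum>j\<in>I. l j x) F"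
  using assms by (induction I rule: infinite_finite_induct) (auto intro!: uniform_limit_intros)

section \<open>Both shifts together and the limit of the kernel\<close>

locale lemniscate_pair = lemniscate_family +
  fixes af bf :: "'i \<Rightarrow> complex"
  assumes af: "\<And>i. i \<in> X \<Longrightarrow> cmod (af i) \<le> A0" and bf: "\<And>i. i \<in> X \<Longrightarrow> cmod (bf i) \<le> A0"
begin

definition Af :: "'i \<Rightarrow> complex" where
  "Af i = (cnj (\<phi> (zf i)) * af i * zf i ^ (m - 1) + \<phi> (zf i) * cnj (bf i) * cnj (zf i) ^ (m - 1)) / of_real R"

definition CA :: real where "CA = A0 * 2 ^ m / R"

definition vf :: "nat \<Rightarrow> 'i \<Rightarrow> complex" where
  "vf n i = \<phi> (zf i + af i / of_nat n) * cnj (\<phi> (zf i + bf i / of_nat n))"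

lemma CA_nonneg: "CA \<ge> 0" using A0 R_pos by (simp add: CA_def)

lemma norm_Af: assumes i: "i \<in> X" shows "cmod (Af i) \<le> CA"
proof -
  have z: "cmod (zf i) ^ (m - 1) \<le> 2 ^ (m - 1)"
    using frontier_Grm_bounds(1)[OF zf[OF i]] by (intro power_mono) auto
  have 1: "cmod (cnj (\<phi> (zf i)) * af i * zf i ^ (m - 1)) \<le> A0 * 2 ^ (m - 1)"
    unfolding norm_mult norm_power complex_mod_cnj zf[OF i] mult_1
    using af[OF i] z A0 by (intro mult_mono) auto
  have 2: "cmod (\<phi> (zf i) * cnj (bf i) * cnj (zf i) ^ (m - 1)) \<le> A0 * 2 ^ (m - 1)"
    unfolding norm_mult norm_power complex_mod_cnj zf[OF i] mult_1
    using bf[OF i] z A0 by (intro mult_mono) auto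
  have "cmod (Af i) \<le> (A0 * 2 ^ (m - 1) + A0 * 2 ^ (m - 1)) / R"
    unfolding Af_def norm_divide norm_of_real abs_of_pos[OF R_pos]
    using norm_triangle_mono[OF 1 2] R_pos by (intro divide_right_mono) auto
  also have "\<dots> = CA"
    using m_pos unfolding CA_def by (cases m) auto
  finally show ?thesis .
qed

text \<open>As \<open>\<phi>\<close> has modulus 1 and derivative \<open>m * z ^ (m - 1) / R\<close>
  at the boundary point, the linear part of the product is \<open>m * Af i / n\<close>. What remains
  is two second-order errors and one product of first-order variations, which explains
  \<open>2 * D1 + D2\<^sup>2\<close>.\<close>

lemma vf_expansion:
  assumes n: "n \<ge> 1" "real n \<ge> A0" and i: "i \<in> X"
  shows "cmod (vf n i - 1 - of_nat m * Af i / of_nat n) \<le> (2 * D1 + D2\<^sup>2) / (real n)\<^sup>2"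
proof -
  define x0 where "x0 = \<phi> (zf i)"
  define x where "x = \<phi> (zf i + af i / of_nat n)"
  define y where "y = \<phi> (zf i + bf i / of_nat n)"
  define \<alpha> where "\<alpha> = of_nat m * zf i ^ (m - 1) * (af i / of_nat n) / of_real R"
  define \<delta> where "\<delta> = of_nat m * zf i ^ (m - 1) * (bf i / of_nat n) / of_real R"
  have x0: "cmod x0 = 1" using zf[OF i] by (simp add: x0_def)
  then have x00: "x0 * cnj x0 = 1" by (simp add: complex_norm_square[symmetric])
  have "of_nat m * Af i / of_nat n = cnj x0 * \<alpha> + x0 * cnj \<delta>"
    by (simp add: Af_def \<alpha>_def \<delta>_def x0_def add_divide_distrib distrib_left mult_ac)
  then have "vf n i - 1 - of_nat m * Af i / of_nat n = x * cnj y - x0 * cnj x0 - (cnj x0 * \<alpha> + x0 * cnj \<delta>)"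
    by (simp add: vf_def x_def y_def x00)
  also have "\<dots> = cnj x0 * (x - x0 - \<alpha>) + x0 * cnj (y - x0 - \<delta>) + (x - x0) * cnj (y - x0)"
    by (simp add: algebra_simps)
  also have "cmod \<dots> \<le> D1 / (real n)\<^sup>2 + D1 / (real n)\<^sup>2 + D2 / real n * (D2 / real n)"
  proof (intro norm_triangle_mono)
    show "cmod (cnj x0 * (x - x0 - \<alpha>)) \<le> D1 / (real n)\<^sup>2"
      unfolding norm_mult complex_mod_cnj x0 mult_1
      using shift_\<phi>_expansion[OF n i af[OF i]] by (simp add: x_def x0_def \<alpha>_def)
    show "cmod (x0 * cnj (y - x0 - \<delta>)) \<le> D1 / (real n)\<^sup>2"
      unfolding norm_mult complex_mod_cnj x0 mult_1
      using shift_\<phi>_expansion[OF n i bf[OF i]] by (simp add: y_def x0_def \<delta>_def)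
    show "cmod ((x - x0) * cnj (y - x0)) \<le> D2 / real n * (D2 / real n)"
      unfolding norm_mult complex_mod_cnj x_def y_def x0_def
      using shift_\<phi>_diff[OF n i af[OF i]] shift_\<phi>_diff[OF n i bf[OF i]] D2_nonneg by (intro mult_mono) auto
  qed
  also have "\<dots> = (2 * D1 + D2\<^sup>2) / (real n)\<^sup>2"
    by (simp add: add_divide_distrib power2_eq_square)
  finally show ?thesis .
qed

text \<open>With \<open>N = n div m\<close>, three replacements lead to
  \<open>weighted_geometric_sum_limit\<close>: the range is extended from \<open>Lcut n\<close> to
  \<open>N\<close> at the cost of \<open>Mcut n\<close> terms of order \<open>n\<close>,
  \<open>m * A / n\<close> becomes \<open>A / N\<close>, and in the result \<open>N\<^sup>2\<close>
  becomes \<open>n\<^sup>2 / m\<^sup>2\<close>.\<close>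

lemma weighted_sum_shift_limit:
  "uniform_limit X (\<lambda>n i. (\<Sum>k<Lcut n. of_nat (k + 1) * vf n i ^ k) / of_nat n ^ 2)
     (\<lambda>i. Hfun (Af i) / 2 / of_nat m ^ 2) sequentially"
proof -
  \<comment> \<open>The first two terms come from the expansion of \<open>vf\<close>;
    \<open>CA * m\<close> pays for replacing \<open>m * A / n\<close> by \<open>A / N\<close>, as
    \<open>n\<close> exceeds \<open>m * N\<close> by less than \<open>m\<close>.\<close>
  define D where "D = 2 * D1 + D2\<^sup>2 + CA * real m"
  have D: "D \<ge> 0" using D1_nonneg CA_nonneg by (simp add: D_def)
  obtain K where K: "K \<ge> 0" "\<And>N v A. N \<ge> 1 \<Longrightarrow> cmod A \<le> CA \<Longrightarrow> cmod (v - 1 - A / of_nat N) \<le> D / (real N)\<^sup>2 \<Longrightarrow>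
      cmod ((\<Sum>k<N. of_nat (k + 1) * v ^ k) - of_nat N ^ 2 * (Hfun A / 2)) \<le> K * real N"
    using weighted_geometric_sum_limit[OF CA_nonneg D] by blast
  show ?thesis
  proof (rule uniform_limit_rate)
    have "(\<lambda>n. (K + 2 * exp CA) * (1 / real n) + (CC * CC) * (real (Mcut n) / real n)) \<longlonglongrightarrow> (K + 2 * exp CA) * 0 + (CC * CC) * 0"
      by (intro tendsto_intros Mcut_limit)
    then show "(\<lambda>n. (K + 2 * exp CA) * (1 / real n) + (CC * CC) * (real (Mcut n) / real n)) \<longlonglongrightarrow> 0" by simp
    show "\<forall>\<^sub>F n in sequentially. \<forall>i\<in>X. cmod ((\<Sum>k<Lcut n. of_nat (k + 1) * vf n i ^ k) / of_nat n ^ 2 -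
        Hfun (Af i) / 2 / of_nat m ^ 2) \<le> (K + 2 * exp CA) * (1 / real n) + (CC * CC) * (real (Mcut n) / real n)"
      using eventually_admissible
    proof eventually_elim
      case (elim n)
      then have n: "n \<ge> 1" "real n \<ge> A0" by auto
      define N where "N = n div m"
      have N: "N \<ge> 1" "Mcut n \<le> N" "N \<le> n" using elim by (auto simp: N_def)
      have nN: "n = m * N + n mod m" by (simp add: N_def)
      show ?case
      proof
        fix i assume i: "i \<in> X"
        define v where "v = vf n i"
        define A where "A = Af i"
        define h where "h = Hfun A / 2"
        have A: "cmod A \<le> CA" using norm_Af[OF i] by (simp add: A_def)
        have h: "cmod h \<le> exp CA" using Hfun_bound[OF A] by (simp add: h_def)
        have "of_nat m * A / of_nat n - A / of_nat N = - (A * of_nat (n mod m) / (of_nat n * of_nat N))"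
        proof -
          have "(of_nat n :: complex) = of_nat m * of_nat N + of_nat (n mod m)"
            by (subst nN) simp
          then have "of_nat m * of_nat N - of_nat n = - (of_nat (n mod m) :: complex)" by simp
          moreover have "of_nat m * A / of_nat n - A / of_nat N = A * (of_nat m * of_nat N - of_nat n) / (of_nat n * of_nat N)"
            using n N by (simp add: field_simps)
          ultimately show ?thesis by simp
        qed
        then have "cmod (of_nat m * A / of_nat n - A / of_nat N) = cmod A * real (n mod m) / (real n * real N)"
          by (simp add: norm_mult norm_divide)
        also have "\<dots> \<le> CA * real m / (real N * real N)"
          using A N CA_nonneg m_pos by (intro frac_le mult_mono) (auto simp: less_imp_le)
        finally have 1: "cmod (of_nat m * A / of_nat n - A / of_nat N) \<le> CA * real m / (real N)\<^sup>2"
          by (simp add: power2_eq_square)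
        have "cmod (v - 1 - of_nat m * A / of_nat n) \<le> (2 * D1 + D2\<^sup>2) / (real n)\<^sup>2"
          unfolding v_def A_def by (rule vf_expansion[OF n i])
        also have "\<dots> \<le> (2 * D1 + D2\<^sup>2) / (real N)\<^sup>2"
          using D1_nonneg N by (intro divide_left_mono power_mono) auto
        finally have 2: "cmod (v - 1 - of_nat m * A / of_nat n) \<le> (2 * D1 + D2\<^sup>2) / (real N)\<^sup>2" .
        have eq: "v - 1 - A / of_nat N = (v - 1 - of_nat m * A / of_nat n) + (of_nat m * A / of_nat n - A / of_nat N)"
          by simp
        have "cmod (v - 1 - A / of_nat N) \<le> D / (real N)\<^sup>2"
          unfolding eq using norm_triangle_mono[OF 2 1] by (simp only: D_def add_divide_distrib)
        then have e1: "cmod ((\<Sum>k<N. of_nat (k + 1) * v ^ k) - of_nat N ^ 2 * h) \<le> K * real n"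
          using K(2)[OF N(1) A, of v] K(1) N mult_left_mono[of "real N" "real n" K] by (simp add: h_def)
        have vk: "cmod v ^ k \<le> CC * CC" if "k \<le> n" for k
          unfolding v_def vf_def norm_mult complex_mod_cnj power_mult_distrib
          using shift_power_bound[OF n i af[OF i] that] shift_power_bound[OF n i bf[OF i] that] CC_ge
          by (intro mult_mono) auto
        have e2: "cmod (\<Sum>k\<in>{Lcut n..<N}. of_nat (k + 1) * v ^ k) \<le> real (Mcut n) * (real n * (CC * CC))"
        proof -
          have "card {Lcut n..<N} = Mcut n" using N by (simp add: Lcut_def N_def[symmetric])
          moreover have "cmod (\<Sum>k\<in>{Lcut n..<N}. of_nat (k + 1) * v ^ k) \<le> real (card {Lcut n..<N}) * (real n * (CC * CC))"
            by (rule weighted_sum_bound) (use vk N CC_ge in auto)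
          ultimately show ?thesis by (simp only:)
        qed
        have split: "(\<Sum>k<N. of_nat (k + 1) * v ^ k) = (\<Sum>k<Lcut n. of_nat (k + 1) * v ^ k) + (\<Sum>k\<in>{Lcut n..<N}. of_nat (k + 1) * v ^ k)"
        proof -
          have "Lcut n \<le> N" by (simp add: Lcut_def N_def)
          then show ?thesis
            using sum.atLeastLessThan_concat[of 0 "Lcut n" N "\<lambda>k. of_nat (k + 1) * v ^ k"]
            unfolding lessThan_atLeast0 by (metis le0)
        qed
        have e3: "cmod ((of_nat N ^ 2 - of_nat n ^ 2 / of_nat m ^ 2) * h) \<le> 2 * real n * exp CA"
        proof -
          define q where "q = real n / real m"
          have q: "real N \<le> q" "q \<le> real N + 1" "q \<le> real n"
          proof -
            have fl: "\<lfloor>q\<rfloor> = int N" unfolding q_def N_def by (rule floor_divide_of_nat_eq)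
            show "real N \<le> q" "q \<le> real N + 1" using fl by linarith+
            show "q \<le> real n" using m_pos n by (simp add: q_def field_simps mult_left_mono[of 1 "real m" "real n", simplified])
          qed
          have "(of_nat N ^ 2 - of_nat n ^ 2 / of_nat m ^ 2 :: complex) = of_real ((real N)\<^sup>2 - q\<^sup>2)"
            by (simp add: q_def power_divide)
          then have "cmod (of_nat N ^ 2 - of_nat n ^ 2 / of_nat m ^ 2) = \<bar>(real N)\<^sup>2 - q\<^sup>2\<bar>"
            by (simp only: norm_of_real)
          also have "\<dots> = (q - real N) * (q + real N)"
            using power_mono[OF q(1), of 2] by (simp add: power2_eq_square algebra_simps)
          also have "\<dots> \<le> 1 * (2 * real n)"
            using q N by (intro mult_mono) auto
          finally show ?thesis
            unfolding norm_mult using h by (intro mult_mono) auto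
        qed
        have "(\<Sum>k<Lcut n. of_nat (k + 1) * v ^ k) - of_nat n ^ 2 / of_nat m ^ 2 * h =
            ((\<Sum>k<N. of_nat (k + 1) * v ^ k) - of_nat N ^ 2 * h) - (\<Sum>k\<in>{Lcut n..<N}. of_nat (k + 1) * v ^ k)
            + (of_nat N ^ 2 - of_nat n ^ 2 / of_nat m ^ 2) * h"
          unfolding split by (simp add: algebra_simps)
        also have "cmod \<dots> \<le> K * real n + real (Mcut n) * (real n * (CC * CC)) + 2 * real n * exp CA"
          by (intro norm_triangle_mono e3 order_trans[OF norm_triangle_ineq4] add_mono e1 e2)
        finally have "cmod ((\<Sum>k<Lcut n. of_nat (k + 1) * v ^ k) - of_nat n ^ 2 / of_nat m ^ 2 * h) / (real n)\<^sup>2 \<le>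
            (K * real n + real (Mcut n) * (real n * (CC * CC)) + 2 * real n * exp CA) / (real n)\<^sup>2"
          by (rule divide_right_mono) simp
        also have "\<dots> = (K + 2 * exp CA) * (1 / real n) + (CC * CC) * (real (Mcut n) / real n)"
          using n by (simp add: field_simps power2_eq_square)
        also have "cmod ((\<Sum>k<Lcut n. of_nat (k + 1) * v ^ k) - of_nat n ^ 2 / of_nat m ^ 2 * h) / (real n)\<^sup>2 =
            cmod ((\<Sum>k<Lcut n. of_nat (k + 1) * v ^ k) / of_nat n ^ 2 - h / of_nat m ^ 2)"
        proof -
          have "(\<Sum>k<Lcut n. of_nat (k + 1) * v ^ k) / of_nat n ^ 2 - h / of_nat m ^ 2 =
              ((\<Sum>k<Lcut n. of_nat (k + 1) * v ^ k) - of_nat n ^ 2 / of_nat m ^ 2 * h) / of_nat n ^ 2"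
            using n by (simp add: diff_divide_distrib)
          then show ?thesis by (simp only: norm_divide norm_power norm_of_nat)
        qed
        finally show "cmod ((\<Sum>k<Lcut n. of_nat (k + 1) * vf n i ^ k) / of_nat n ^ 2 - Hfun (Af i) / 2 / of_nat m ^ 2)
            \<le> (K + 2 * exp CA) * (1 / real n) + (CC * CC) * (real (Mcut n) / real n)"
          by (simp only: v_def A_def h_def)
      qed
    qed
  qed
qed

text \<open>The limits of the factors are multiplied, and their boundedness on \<open>X\<close>
  makes the product converge uniformly. The powers of \<open>m\<close> from the prefactor, the
  number of residues and the length of the geometric sum cancel.\<close>

lemma test_poly_limit:
  "uniform_limit X (\<lambda>n i. poly (test_poly (Mcut n) (Lcut n) (zf i + bf i / of_nat n)) (zf i + af i / of_nat n) / of_nat n ^ 2)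
     (\<lambda>i. Hfun (Af i) * of_real (cmod (zf i) ^ (2 * m - 2) / (2 * pi * R\<^sup>2))) sequentially"
proof -
  define u where "u j c n i = (zf i + c i / of_nat n) ^ j * poly (gp (Mcut n) j) (\<phi> (zf i + c i / of_nat n))"
    for j n i and c :: "'i \<Rightarrow> complex"
  define l where "l j i = zf i ^ j * (1 + of_real R * \<phi> (zf i)) powr of_real (\<beta> j)" for j i
  define Z where "Z i = complex_of_real (cmod (zf i) ^ (2 * m - 2))" for i
  have lZ: "l j i * cnj (l j i) = Z i" if "j < m" "i \<in> X" for i j
    unfolding l_def Z_def by (rule gp_limit_norm[OF that])
  have Zb: "bounded (Z ` X)"
    unfolding bounded_iff
  proof (intro exI ballI)
    fix y assume "y \<in> Z ` X"
    then show "cmod y \<le> 2 ^ (2 * m - 2)"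
      using frontier_Grm_bounds(1) zf by (auto simp: Z_def norm_power intro!: power_mono)
  qed
  have lb: "bounded (l j ` X)" if "j < m" for j
  proof -
    obtain B where B: "\<And>i. i \<in> X \<Longrightarrow> cmod (Z i) \<le> B" using Zb by (auto simp: bounded_iff)
    have "cmod (l j i) \<le> sqrt B" if i: "i \<in> X" for i
    proof -
      have "(cmod (l j i))\<^sup>2 = cmod (Z i)"
        unfolding lZ[OF \<open>j < m\<close> i, symmetric] by (simp add: norm_mult power2_eq_square)
      then show ?thesis using B[OF i] by (intro real_le_rsqrt) simp
    qed
    then show ?thesis by (auto simp: bounded_iff)
  qed
  have prod: "uniform_limit X (\<lambda>n i. u j af n i * cnj (u j bf n i)) (\<lambda>i. l j i * cnj (l j i)) sequentially" if "j \<in> {..<m}" for j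
  proof (rule uniform_lim_mult)
    have j: "j < m" using that by simp
    show "uniform_limit X (u j af) (l j) sequentially"
      unfolding u_def l_def by (rule gp_shift_limit[OF j af])
    have "uniform_limit X (u j bf) (l j) sequentially"
      unfolding u_def l_def by (rule gp_shift_limit[OF j bf])
    then show "uniform_limit X (\<lambda>n i. cnj (u j bf n i)) (\<lambda>i. cnj (l j i)) sequentially"
      by (rule bounded_linear.uniform_limit[OF bounded_linear_cnj])
    show "bounded (l j ` X)" by (rule lb[OF j])
    then show "bounded ((\<lambda>i. cnj (l j i)) ` X)" by (simp add: bounded_iff)
  qed
  have "uniform_limit X (\<lambda>n i. \<Sum>j<m. u j af n i * cnj (u j bf n i)) (\<lambda>i. \<Sum>j<m. l j i * cnj (l j i)) sequentially"
    by (rule uniform_limit_sum[OF prod])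
  then have G: "uniform_limit X (\<lambda>n i. \<Sum>j<m. u j af n i * cnj (u j bf n i)) (\<lambda>i. of_nat m * Z i) sequentially"
    by (rule uniform_limit_cong'[THEN iffD1, rotated 2]) (auto simp: lZ)
  have Hb: "bounded ((\<lambda>i. Hfun (Af i) / 2 / of_nat m ^ 2) ` X)"
    unfolding bounded_iff
  proof (intro exI ballI)
    fix y assume "y \<in> (\<lambda>i. Hfun (Af i) / 2 / of_nat m ^ 2) ` X"
    then obtain i where i: "i \<in> X" "y = Hfun (Af i) / 2 / of_nat m ^ 2" by auto
    then show "cmod y \<le> exp CA / real m ^ 2"
      using Hfun_bound[OF norm_Af[OF i(1)]] unfolding i(2) norm_divide[of "Hfun (Af i) / 2"] norm_power norm_of_nat
      by (intro divide_right_mono) auto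
  qed
  have Zb': "bounded ((\<lambda>i. of_nat m * Z i) ` X)"
  proof -
    obtain B where "\<And>i. i \<in> X \<Longrightarrow> cmod (Z i) \<le> B" using Zb by (auto simp: bounded_iff)
    then have "cmod (of_nat m * Z i) \<le> real m * B" if "i \<in> X" for i
      using that by (simp add: norm_mult mult_left_mono)
    then show ?thesis by (auto simp: bounded_iff)
  qed
  define c where "c = complex_of_real (real m / (pi * R\<^sup>2))"
  have GS: "uniform_limit X (\<lambda>n i. (\<Sum>j<m. u j af n i * cnj (u j bf n i)) * ((\<Sum>k<Lcut n. of_nat (k + 1) * vf n i ^ k) / of_nat n ^ 2))
     (\<lambda>i. of_nat m * Z i * (Hfun (Af i) / 2 / of_nat m ^ 2)) sequentially"
    by (rule uniform_lim_mult[OF G weighted_sum_shift_limit Zb' Hb])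
  have "uniform_limit X (\<lambda>n i. c * ((\<Sum>j<m. u j af n i * cnj (u j bf n i)) * ((\<Sum>k<Lcut n. of_nat (k + 1) * vf n i ^ k) / of_nat n ^ 2)))
     (\<lambda>i. c * (of_nat m * Z i * (Hfun (Af i) / 2 / of_nat m ^ 2))) sequentially"
    by (rule bounded_linear.uniform_limit[OF bounded_linear_mult_right GS])
  also have "(\<lambda>n i. c * ((\<Sum>j<m. u j af n i * cnj (u j bf n i)) * ((\<Sum>k<Lcut n. of_nat (k + 1) * vf n i ^ k) / of_nat n ^ 2))) =
      (\<lambda>n i. poly (test_poly (Mcut n) (Lcut n) (zf i + bf i / of_nat n)) (zf i + af i / of_nat n) / of_nat n ^ 2)"
    unfolding poly_test_poly c_def u_def vf_def by (simp only: times_divide_eq_right mult.assoc)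
  also have "(\<lambda>i. c * (of_nat m * Z i * (Hfun (Af i) / 2 / of_nat m ^ 2))) =
      (\<lambda>i. Hfun (Af i) * of_real (cmod (zf i) ^ (2 * m - 2) / (2 * pi * R\<^sup>2)))"
    using m_pos R_pos by (simp add: fun_eq_iff c_def Z_def field_simps power2_eq_square)
  finally show ?thesis .
qed

text \<open>With \<open>\<eta>\<close> the reproducing error, the difference from the test
  polynomial divided by \<open>n\<^sup>2\<close> is at most
  \<open>(\<eta> / n) * (diag_const CC + 2 * (\<eta> / n))\<close>, so \<open>\<eta>\<close> of
  order \<open>o(n)\<close> suffices for a kernel of order \<open>n\<^sup>2\<close>.\<close>

theorem CD_kernel_limit:
  "uniform_limit X (\<lambda>n i. CD_kernel (Grm r m) n (zf i + af i / of_nat n) (zf i + bf i / of_nat n) / of_nat n ^ 2)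
     (\<lambda>i. Hfun (Af i) * of_real (cmod (zf i) ^ (2 * m - 2) / (2 * pi * R\<^sup>2))) sequentially"
proof -
  let ?K = "\<lambda>n i. CD_kernel (Grm r m) n (zf i + af i / of_nat n) (zf i + bf i / of_nat n)"
  let ?Q = "\<lambda>n i. poly (test_poly (Mcut n) (Lcut n) (zf i + bf i / of_nat n)) (zf i + af i / of_nat n)"
  let ?\<eta> = "\<lambda>n. repro_error CC (n div m) (Mcut n) (Lcut n)"
  have "uniform_limit X (\<lambda>n i. (?K n i - ?Q n i) / of_nat n ^ 2) (\<lambda>i. 0) sequentially"
  proof (rule uniform_limit_rate)
    have "(\<lambda>n. (?\<eta> n / real n) * (diag_const CC + 2 * (?\<eta> n / real n))) \<longlonglongrightarrow> 0 * (diag_const CC + 2 * 0)"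
      by (intro tendsto_intros repro_error_limit)
    then show "(\<lambda>n. (?\<eta> n / real n) * (diag_const CC + 2 * (?\<eta> n / real n))) \<longlonglongrightarrow> 0" by simp
    show "\<forall>\<^sub>F n in sequentially. \<forall>i\<in>X. cmod ((?K n i - ?Q n i) / of_nat n ^ 2 - 0) \<le>
        (?\<eta> n / real n) * (diag_const CC + 2 * (?\<eta> n / real n))"
      using eventually_admissible
    proof eventually_elim
      case (elim n)
      then have n: "n \<ge> 1" "real n \<ge> A0" and M: "Mcut n < n div m" by auto
      have MLN: "Mcut n + Lcut n \<le> n div m" and L: "Lcut n > 0" using M by (auto simp: Lcut_def)
      have Ln: "real (Lcut n) \<le> real n" by (auto simp: Lcut_def intro: le_trans[OF diff_le_self])
      show ?case
      proof
        fix i assume i: "i \<in> X"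
        note a = n i af[OF i] and b = n i bf[OF i]
        have div: "k \<le> n" if "k \<le> n div m" for k using that div_le_dividend[of n m] by linarith
        have eta0: "?\<eta> n \<ge> 0"
          using CC_ge by (intro repro_error_nonneg) (auto simp: Lcut_def)
        have "cmod (?K n i - ?Q n i) \<le> ?\<eta> n * (diag_const CC * real (Lcut n) + 2 * ?\<eta> n)"
          using shift_power_bound[OF a div] shift_power_bound[OF b div] CC_ge shift_bounds(2)[OF a] shift_bounds(2)[OF b]
          by (intro CD_kernel_test_poly[OF MLN L]) auto
        also have "\<dots> \<le> ?\<eta> n * (diag_const CC * real n + 2 * ?\<eta> n)"
          using Ln eta0 CC_ge R_pos R_less by (intro mult_left_mono add_mono) (auto simp: diag_const_def)
        finally have "cmod (?K n i - ?Q n i) / (real n)\<^sup>2 \<le> ?\<eta> n * (diag_const CC * real n + 2 * ?\<eta> n) / (real n)\<^sup>2"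
          by (rule divide_right_mono) simp
        also have "\<dots> = (?\<eta> n / real n) * (diag_const CC + 2 * (?\<eta> n / real n))"
          using n by (simp add: field_simps power2_eq_square)
        finally show "cmod ((?K n i - ?Q n i) / of_nat n ^ 2 - 0) \<le> (?\<eta> n / real n) * (diag_const CC + 2 * (?\<eta> n / real n))"
          by (simp add: norm_divide norm_power)
      qed
    qed
  qed
  from uniform_limit_add[OF this test_poly_limit]
  show ?thesis by (simp add: diff_divide_distrib)
qed

end

theorem theorem3p6:
  fixes r :: real and m :: nat and \<gamma> :: "real \<Rightarrow> complex"
  assumes "0 < r" "r < 1" "m \<ge> 2"
    and "arc \<gamma>" "path_image \<gamma> \<subseteq> frontier (Grm r m)"
  shows "\<forall>Ka Kb. compact Ka \<longrightarrow> compact Kb \<longrightarrow> (\<forall>\<epsilon>>0. \<forall>\<^sub>F n in sequentially.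
     \<forall>z0\<in>path_image \<gamma>. \<forall>a\<in>Ka. \<forall>b\<in>Kb.
       (let w0 = (z0 ^ m - 1) / complex_of_real (r ^ m);
            A = (cnj w0 * a * z0 ^ (m - 1) + w0 * cnj b * cnj z0 ^ (m - 1)) / complex_of_real (r ^ m)
        in cmod (CD_kernel (Grm r m) n (z0 + a / of_nat n) (z0 + b / of_nat n)
                 - (of_nat n) ^ 2 * Hfun A * complex_of_real (cmod z0 ^ (2 * m - 2) / (2 * pi * r ^ (2 * m))))
           \<le> \<epsilon> * (real n) ^ 2))"
proof (intro allI impI)
  fix Ka Kb :: "complex set" and \<epsilon> :: real
  assume Ka: "compact Ka" and Kb: "compact Kb" and \<epsilon>: "\<epsilon> > 0"
  interpret lem: lemniscate r m by unfold_locales (use assms in auto)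
  obtain Ba where Ba: "Ba > 0" "\<And>a. a \<in> Ka \<Longrightarrow> cmod a \<le> Ba"
    using compact_imp_bounded[OF Ka] by (auto simp: bounded_pos)
  obtain Bb where Bb: "Bb > 0" "\<And>b. b \<in> Kb \<Longrightarrow> cmod b \<le> Bb"
    using compact_imp_bounded[OF Kb] by (auto simp: bounded_pos)
  \<comment> \<open>An index is a triple of boundary point and shifts, so uniformity over the arc
    and the two compact sets is one uniform limit; a common bound of the compact sets serves as
    \<open>A0\<close>.\<close>
  interpret lemniscate_pair r m "path_image \<gamma> \<times> Ka \<times> Kb" "max Ba Bb" fst "\<lambda>i. fst (snd i)" "\<lambda>i. snd (snd i)"
  proof unfold_locales
    show "cmod (lem.\<phi> (fst i)) = 1" if "i \<in> path_image \<gamma> \<times> Ka \<times> Kb" for i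
      using that assms(5) lem.frontier_Grm_subset by auto
    show "cmod (fst (snd i)) \<le> max Ba Bb" if "i \<in> path_image \<gamma> \<times> Ka \<times> Kb" for i
      using that Ba(2)[of "fst (snd i)"] by auto
    show "cmod (snd (snd i)) \<le> max Ba Bb" if "i \<in> path_image \<gamma> \<times> Ka \<times> Kb" for i
      using that Bb(2)[of "snd (snd i)"] by auto
  qed (use Ba Bb in auto)
  have "\<forall>\<^sub>F n in sequentially. \<forall>i\<in>path_image \<gamma> \<times> Ka \<times> Kb.
      dist (CD_kernel (Grm r m) n (fst i + fst (snd i) / of_nat n) (fst i + snd (snd i) / of_nat n) / of_nat n ^ 2)
        (Hfun (Af i) * of_real (cmod (fst i) ^ (2 * m - 2) / (2 * pi * lem.R\<^sup>2))) < \<epsilon>"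
    using uniform_limitD[OF CD_kernel_limit \<epsilon>] .
  \<comment> \<open>The limit is stated after division by \<open>n\<^sup>2\<close>;
    \<open>n > 0\<close> allows the factor to be restored.\<close>
  with eventually_gt_at_top[of 0]
  show "\<forall>\<^sub>F n in sequentially.
     \<forall>z0\<in>path_image \<gamma>. \<forall>a\<in>Ka. \<forall>b\<in>Kb.
       (let w0 = (z0 ^ m - 1) / complex_of_real (r ^ m);
            A = (cnj w0 * a * z0 ^ (m - 1) + w0 * cnj b * cnj z0 ^ (m - 1)) / complex_of_real (r ^ m)
        in cmod (CD_kernel (Grm r m) n (z0 + a / of_nat n) (z0 + b / of_nat n)
                 - (of_nat n) ^ 2 * Hfun A * complex_of_real (cmod z0 ^ (2 * m - 2) / (2 * pi * r ^ (2 * m))))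
           \<le> \<epsilon> * (real n) ^ 2)"
  proof eventually_elim
    case (elim n)
    show ?case
    proof (intro ballI)
      fix z0 a b assume zab: "z0 \<in> path_image \<gamma>" "a \<in> Ka" "b \<in> Kb"
      define w0 where "w0 = (z0 ^ m - 1) / complex_of_real (r ^ m)"
      define A where "A = (cnj w0 * a * z0 ^ (m - 1) + w0 * cnj b * cnj z0 ^ (m - 1)) / complex_of_real (r ^ m)"
      define k where "k = CD_kernel (Grm r m) n (z0 + a / of_nat n) (z0 + b / of_nat n)"
      define h where "h = Hfun A * complex_of_real (cmod z0 ^ (2 * m - 2) / (2 * pi * r ^ (2 * m)))"
      have A: "Af (z0, a, b) = A"
        by (simp add: Af_def A_def w0_def lem.\<phi>_def lem.R_def)
      have R2: "lem.R\<^sup>2 = r ^ (2 * m)" by (simp add: lem.R_def mult.commute flip: power_mult)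
      have "(z0, a, b) \<in> path_image \<gamma> \<times> Ka \<times> Kb" using zab by simp
      from bspec[OF elim(2) this]
      have "cmod (k / of_nat n ^ 2 - h) \<le> \<epsilon>"
        unfolding fst_conv snd_conv A R2 k_def h_def dist_norm by (rule less_imp_le)
      then have "cmod (k / of_nat n ^ 2 - h) * (real n)\<^sup>2 \<le> \<epsilon> * (real n)\<^sup>2"
        by (rule mult_right_mono) simp
      also have "cmod (k / of_nat n ^ 2 - h) * (real n)\<^sup>2 = cmod ((k / of_nat n ^ 2 - h) * of_nat n ^ 2)"
        by (simp add: norm_mult norm_power)
      also have "(k / of_nat n ^ 2 - h) * of_nat n ^ 2 = k - of_nat n ^ 2 * h"
        using elim(1) by (simp add: left_diff_distrib)
      finally show "let w0 = (z0 ^ m - 1) / complex_of_real (r ^ m);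
            A = (cnj w0 * a * z0 ^ (m - 1) + w0 * cnj b * cnj z0 ^ (m - 1)) / complex_of_real (r ^ m)
        in cmod (CD_kernel (Grm r m) n (z0 + a / of_nat n) (z0 + b / of_nat n)
                 - (of_nat n) ^ 2 * Hfun A * complex_of_real (cmod z0 ^ (2 * m - 2) / (2 * pi * r ^ (2 * m))))
           \<le> \<epsilon> * (real n) ^ 2"
        unfolding Let_def w0_def[symmetric] A_def[symmetric] k_def[symmetric] by (simp only: h_def mult.assoc)
    qed
  qed
qed

end
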